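(* Let $T$ be a Calderón–Zygmund operator on $\mathbb{R}^n$ with maximal singular integral operator $T^*$. Then there are constants $\alpha,c>0$, depending only on $n$ and $T$, such that for every cube $Q$ and every $f\in L^\infty_c(\mathbb{R}^n)$ with $\operatorname{supp}(f)\subseteq Q$, $$|\{x\in Q: |T^*f(x)|>t\,Mf(x)\}|\le c\,e^{-\alpha t}|Q|,\qquad t>0.$$
   Context: Cubes have sides parallel to the axes; $L^\infty_c(\mathbb{R}^n)$ is the space of bounded compactly supported functions. The Hardy–Littlewood maximal operator is $Mf(x)=\sup_{Q\ni x}\frac1{|Q|}\int_Q|f(y)|\,dy$, the supremum over all cubes $Q$ containing $x$. A Calderón–Zygmund operator is a linear operator $T:C_c^\infty(\mathbb{R}^n)\to L^1_{loc}(\mathbb{R}^n)$ that extends to a bounded operator on $L^2(\mathbb{R}^n)$ and for which there is a kernel $K$, a locally integrable function defined off the diagonal $x=y$ in $\mathbb{R}^n\times\mathbb{R}^n$, such that $|K(x,y)|\le \frac{c}{|x-y|^n}$ and, for some $\varepsilon>0$, $|K(x,y)-K(z,y)|+|K(y,x)-K(y,z)|\le c\frac{|x-z|^\varepsilon}{|x-y|^{n+\varepsilon}}$ whenever $2|x-z|<|x-y|$, and $Tf(x)=\int_{\mathbb{R}^n}K(x,y)f(y)\,dy$ for $f\in C_c^\infty(\mathbb{R}^n)$ and $x\notin\operatorname{supp}(f)$. The maximal singular integral operator is $T^*f(x)=\sup_{\varepsilon>0}|T_\varepsilon f(x)|$, where $T_\varepsilon f(x)=\int_{|x-y|>\varepsilon}K(x,y)f(y)\,dy$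 is the truncated singular integral. *)

theory Defs
  imports "HOL-Analysis.Analysis"
begin

text \<open>\<open>\<real>\<^sup>n\<close> is a type \<open>'a::euclidean_space\<close> with \<open>n = DIM('a)\<close>; functions are complex-valued.
  Elements of \<open>L\<^sup>2\<close>, \<open>L\<^sup>1\<^sub>l\<^sub>o\<^sub>c\<close>, \<open>L\<^sup>\<infinity>\<close> are represented by functions, with identities between
  them required almost everywhere.\<close>

definition is_cube :: "'a::euclidean_space set \<Rightarrow> bool" where
  "is_cube Q \<longleftrightarrow> (\<exists>a l. l > 0 \<and> Q = cbox a (a + l *\<^sub>R One))"

definition HL_maximal :: "('a::euclidean_space \<Rightarrow> complex) \<Rightarrow> 'a \<Rightarrow> ennreal" where
  "HL_maximal f x =
     (SUP Q \<in> {Q. is_cube Q \<and> x \<in> Q}.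
        (\<integral>\<^sup>+y\<in>Q. ennreal (norm (f y)) \<partial>lebesgue) / emeasure lebesgue Q)"

primrec C_k :: "nat \<Rightarrow> ('a::euclidean_space \<Rightarrow> complex) \<Rightarrow> bool" where
  "C_k 0 f \<longleftrightarrow> continuous_on UNIV f"
| "C_k (Suc k) f \<longleftrightarrow> (\<forall>x. f differentiable (at x)) \<and>
     (\<forall>v. C_k k (\<lambda>x. frechet_derivative f (at x) v))"

definition supp :: "('a::euclidean_space \<Rightarrow> complex) \<Rightarrow> 'a set" where
  "supp f = closure {x. f x \<noteq> 0}"

definition Cc_infinity :: "('a::euclidean_space \<Rightarrow> complex) set" where
  "Cc_infinity = {f. (\<forall>k. C_k k f) \<and> compact (supp f)}"

text \<open>The support of a function given only up to null sets: the complement of the largest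
  open set on which it vanishes almost everywhere.\<close>

definition ess_supp :: "('a::euclidean_space \<Rightarrow> complex) \<Rightarrow> 'a set" where
  "ess_supp f = - \<Union>{U. open U \<and> (AE x in lebesgue. x \<in> U \<longrightarrow> f x = 0)}"

definition Linfty_c :: "('a::euclidean_space \<Rightarrow> complex) set" where
  "Linfty_c = {f \<in> borel_measurable lebesgue.
     (\<exists>B. AE x in lebesgue. norm (f x) \<le> B) \<and> compact (ess_supp f)}"

definition locally_integrable_on ::
    "('a::euclidean_space \<Rightarrow> complex) \<Rightarrow> 'a set \<Rightarrow> bool" where
  "locally_integrable_on f U \<longleftrightarrow>
     (\<forall>C. compact C \<and> C \<subseteq> U \<longrightarrow> f absolutely_integrable_on C)"

definition L2 :: "('a::euclidean_space \<Rightarrow> complex) set" where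
  "L2 = {f \<in> borel_measurable lebesgue. integrable lebesgue (\<lambda>x. (norm (f x))\<^sup>2)}"

definition L2_norm :: "('a::euclidean_space \<Rightarrow> complex) \<Rightarrow> real" where
  "L2_norm f = sqrt (\<integral>x. (norm (f x))\<^sup>2 \<partial>lebesgue)"

definition ae_linear_on ::
    "('a::euclidean_space \<Rightarrow> complex) set \<Rightarrow> (('a \<Rightarrow> complex) \<Rightarrow> 'a \<Rightarrow> complex) \<Rightarrow> bool" where
  "ae_linear_on V T \<longleftrightarrow>
     (\<forall>f\<in>V. \<forall>g\<in>V. \<forall>a b. AE x in lebesgue.
        T (\<lambda>y. a * f y + b * g y) x = a * T f x + b * T g x)"

text \<open>Compatibility with almost-everywhere equality need not be assumed: it follows from
  linearity and boundedness.\<close>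

definition bounded_operator_L2 ::
    "(('a::euclidean_space \<Rightarrow> complex) \<Rightarrow> 'a \<Rightarrow> complex) \<Rightarrow> bool" where
  "bounded_operator_L2 S \<longleftrightarrow> ae_linear_on L2 S \<and> (\<forall>f\<in>L2. S f \<in> L2) \<and>
     (\<exists>C. \<forall>f\<in>L2. L2_norm (S f) \<le> C * L2_norm f)"

text \<open>The values of the kernel on the diagonal are irrelevant: they are not constrained by
  the following definition, and do not enter the truncated integrals.\<close>

definition CZ_kernel :: "('a::euclidean_space \<Rightarrow> 'a \<Rightarrow> complex) \<Rightarrow> bool" where
  "CZ_kernel K \<longleftrightarrow>
     locally_integrable_on (\<lambda>p. K (fst p) (snd p)) {p. fst p \<noteq> snd p} \<and>
     (\<exists>c. (\<forall>x y. x \<noteq> y \<longrightarrow> norm (K x y) \<le> c / norm (x - y) ^ DIM('a)) \<and>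
       (\<exists>\<epsilon>>0. \<forall>x y z. 2 * norm (x - z) < norm (x - y) \<longrightarrow>
          norm (K x y - K z y) + norm (K y x - K y z)
            \<le> c * (norm (x - z) powr \<epsilon> / norm (x - y) powr (real DIM('a) + \<epsilon>))))"

definition CZ_operator ::
    "(('a::euclidean_space \<Rightarrow> complex) \<Rightarrow> 'a \<Rightarrow> complex) \<Rightarrow> ('a \<Rightarrow> 'a \<Rightarrow> complex) \<Rightarrow> bool" where
  "CZ_operator T K \<longleftrightarrow>
     (\<forall>f\<in>Cc_infinity. locally_integrable_on (T f) UNIV) \<and>
     ae_linear_on Cc_infinity T \<and>
     (\<exists>S. bounded_operator_L2 S \<and> (\<forall>f\<in>Cc_infinity. AE x in lebesgue. S f x = T f x)) \<and>
     CZ_kernel K \<and>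
     (\<forall>f\<in>Cc_infinity. AE x in lebesgue. x \<notin> supp f \<longrightarrow>
        T f x = (\<integral>y. K x y * f y \<partial>lebesgue))"

definition truncated_integral ::
    "('a::euclidean_space \<Rightarrow> 'a \<Rightarrow> complex) \<Rightarrow> real \<Rightarrow> ('a \<Rightarrow> complex) \<Rightarrow> 'a \<Rightarrow> complex" where
  "truncated_integral K \<epsilon> f x = (LINT y:{y. norm (x - y) > \<epsilon>}|lebesgue. K x y * f y)"

definition maximal_singular_integral ::
    "('a::euclidean_space \<Rightarrow> 'a \<Rightarrow> complex) \<Rightarrow> ('a \<Rightarrow> complex) \<Rightarrow> 'a \<Rightarrow> ennreal" where
  "maximal_singular_integral K f x =
     (SUP \<epsilon>\<in>{0<..}. ennreal (norm (truncated_integral K \<epsilon> f x)))"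

end

theory Submission imports Defs begin

text \<open>The decay is obtained by iterating one localisation step. Let \<open>u = f 1\<^bsub>3Q\<^esub>\<close> and let \<open>\<tau>\<close> be a large
  multiple of the mean of \<open>|u|\<close> over \<open>3Q\<close>. By the weak type \<open>(1,1)\<close> estimates the set of points of \<open>Q\<close>
  where \<open>T\<^sup>*u\<close> or the maximal function of \<open>u\<close> exceeds \<open>\<tau>\<close> is so small that it is covered, up to a
  null set, by disjoint dyadic subcubes \<open>P\<^sub>j\<close> of \<open>Q\<close> of total measure at most \<open>|Q| / 2\<close>, each containing a
  point outside it. Comparison with that point gives \<open>T\<^sup>*u \<le> T\<^sup>*(f 1\<^bsub>3P\<^esub>) + C \<tau>\<close> on every \<open>P = P\<^sub>j\<close>, and
  \<open>\<tau> \<le> C M f\<close> on \<open>Q\<close>. After \<open>m\<close> rounds \<open>T\<^sup>*f \<le> C m M f\<close> outside a set of measure \<open>2\<^sup>-\<^sup>m |Q|\<close>.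

  The weak type estimate for \<open>T\<^sup>*\<close> splits \<open>f\<close> into a good and a bad part. The good part is bounded, so
  that Cotlar's inequality for it needs only the \<open>L\<^sup>2\<close> bound of the operator. The bad part only involves the
  truncated integrals, which converge absolutely, so the operator is never applied to it.\<close>

section \<open>Dyadic subcubes of a half-open cube\<close>

text \<open>\<open>emeasure_completion\<close> would rewrite every \<open>emeasure lebesgue A\<close> into the \<open>lborel\<close> measure of
  \<open>main_part lborel A\<close>.\<close>

declare emeasure_completion [simp del]

text \<open>The right-hand side carries the function \<open>M f\<close> and not a number. The reason
  is that the closure of \<open>3P\<close> competes in the supremum defining \<open>M f x\<close>
  for every \<open>x\<close> in \<open>P\<close>: the threshold of a round is tied to the mean of
  \<open>|f|\<close> over its own \<open>3P\<close>, so it is bounded by the same multiple of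
  \<open>M f x\<close> in every generation, and the rounds add up instead of compounding. This works
  because each round restarts from \<open>f\<close> restricted to \<open>3P\<close>, never from a
  corrected function.

  Tripling also creates the distance that the kernel estimates need: a point of \<open>P\<close> is
  at least one side length away from everything outside \<open>3P\<close>, so the discarded part of
  \<open>f\<close> meets the kernel only at the scale of \<open>P\<close> or beyond.

  An operator is not determined by its kernel: a multiplication operator has kernel zero. Hence the
  \<open>L2\<close> bound reaches the truncated integrals only through the kernel formula away from
  the support, and this formula, given for test functions, must first be extended to bounded
  functions that vanish near the point in question.\<close>

definition hcube :: "'a::euclidean_space \<Rightarrow> real \<Rightarrow> 'a set" where
  "hcube a l = {y. \<forall>i\<in>Basis. a \<bullet> i \<le> y \<bullet> i \<and> y \<bullet> i < a \<bullet> i + l}"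

lemma hcube_subset_cbox: "hcube a l \<subseteq> cbox a (a + l *\<^sub>R One)"
proof
  fix y assume "y \<in> hcube a l"
  then have "a \<bullet> i \<le> y \<bullet> i \<and> y \<bullet> i \<le> a \<bullet> i + l" if "i \<in> Basis" for i
    using that by (simp add: hcube_def less_imp_le)
  then show "y \<in> cbox a (a + l *\<^sub>R One)"
    by (simp add: mem_box inner_simps)
qed

lemma box_subset_hcube: "box a (a + l *\<^sub>R One) \<subseteq> hcube a l"
proof
  fix y assume "y \<in> box a (a + l *\<^sub>R One)"
  then show "y \<in> hcube a l"
    unfolding hcube_def mem_box by (simp add: inner_simps less_imp_le)
qed

lemma hcube_empty: "l \<le> 0 \<Longrightarrow> hcube (a::'a::euclidean_space) l = {}"
proof -
  assume "l \<le> 0"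
  moreover obtain i :: 'a where "i \<in> Basis" using nonempty_Basis by blast
  ultimately show ?thesis by (force simp: hcube_def)
qed

lemma hcube_borel [measurable]: "hcube a l \<in> sets borel"
proof -
  have "hcube a l = (\<Inter>i\<in>Basis. {y. a \<bullet> i \<le> y \<bullet> i} \<inter> {y. y \<bullet> i < a \<bullet> i + l})"
    by (auto simp: hcube_def)
  also have "\<dots> \<in> sets borel"
    by (intro sets.finite_INT) (auto intro!: borel_closed borel_open
        simp: closed_halfspace_component_ge open_halfspace_component_lt)
  finally show ?thesis .
qed

lemma sets_lebesgue_borel [measurable]: "A \<in> sets borel \<Longrightarrow> A \<in> sets lebesgue"
  by simp

lemma emeasure_cube_cbox:
  "l \<ge> 0 \<Longrightarrow> emeasure lebesgue (cbox (a::'a::euclidean_space) (a + l *\<^sub>R One)) = ennreal (l ^ DIM('a))"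
  by (simp add: inner_simps emeasure_completion)

lemma emeasure_hcube:
  assumes "l \<ge> 0"
  shows "emeasure lebesgue (hcube (a::'a::euclidean_space) l) = ennreal (l ^ DIM('a))"
proof (rule antisym)
  show "emeasure lebesgue (hcube a l) \<le> ennreal (l ^ DIM('a))"
    using emeasure_mono[OF hcube_subset_cbox[of a l], of lebesgue] emeasure_cube_cbox[OF assms, of a]
    by simp
  have "ennreal (l ^ DIM('a)) = emeasure lebesgue (box a (a + l *\<^sub>R One))"
    using assms by (simp add: inner_simps emeasure_completion)
  also have "\<dots> \<le> emeasure lebesgue (hcube a l)"
    by (intro emeasure_mono box_subset_hcube) simp
  finally show "ennreal (l ^ DIM('a)) \<le> emeasure lebesgue (hcube a l)" .
qed

text \<open>Disjoint sets with nonempty interior are at most countably many; this makes the cubes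
  selected by a stopping rule enumerable.\<close>

lemma interior_hcube_nonempty: "l > 0 \<Longrightarrow> interior (hcube a l) \<noteq> {}"
proof -
  assume "l > 0"
  then have "box a (a + l *\<^sub>R One) \<noteq> {}" by (simp add: box_eq_empty inner_simps not_le)
  moreover have "box a (a + l *\<^sub>R One) \<subseteq> interior (hcube a l)"
    by (intro interior_maximal box_subset_hcube open_box)
  ultimately show ?thesis by blast
qed

text \<open>The cube of generation \<open>k\<close> through \<open>x\<close>, encoded by equal
  integer parts of the rescaled coordinates. Lying in the same cube thereby becomes an equivalence
  relation, each generation partitions the space exactly, and nesting reduces to
  \<open>\<lfloor>w\<rfloor> = \<lfloor>2 * w\<rfloor> div 2\<close>.\<close>

definition dcube :: "'a::euclidean_space \<Rightarrow> real \<Rightarrow> nat \<Rightarrow> 'a \<Rightarrow> 'a set" where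
  "dcube a l k x = {y. \<forall>i\<in>Basis. \<lfloor>2 ^ k * ((y - a) \<bullet> i / l)\<rfloor> = \<lfloor>2 ^ k * ((x - a) \<bullet> i / l)\<rfloor>}"

lemma dcube_self [simp]: "x \<in> dcube a l k x"
  by (simp add: dcube_def)

lemma dcube_eqI: "y \<in> dcube a l k x \<Longrightarrow> dcube a l k y = dcube a l k x"
  by (auto simp: dcube_def)

lemma dcube_Suc_subset: "dcube a l (Suc k) x \<subseteq> dcube a l k x"
proof -
  have *: "\<lfloor>u\<rfloor> = \<lfloor>v\<rfloor>" if "\<lfloor>2 * u\<rfloor> = \<lfloor>2 * v\<rfloor>" for u v :: real
  proof -
    have "\<lfloor>w\<rfloor> = \<lfloor>2 * w\<rfloor> div 2" for w :: real
      using floor_divide_real_eq_div[of 2 "2 * w"] by simp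
    from this[of u] this[of v] that show ?thesis by simp
  qed
  show ?thesis
    unfolding dcube_def power_Suc mult.assoc by (blast intro: *)
qed

lemma dcube_antimono: "k \<le> m \<Longrightarrow> dcube a l m x \<subseteq> dcube a l k x"
  by (induction m rule: dec_induct) (use dcube_Suc_subset in blast)+

lemma dcube_eq_hcube:
  assumes "l > 0"
  shows "dcube a l k x =
    hcube (a + (\<Sum>i\<in>Basis. (l / 2 ^ k * of_int \<lfloor>2 ^ k * ((x - a) \<bullet> i / l)\<rfloor>) *\<^sub>R i)) (l / 2 ^ k)"
    (is "_ = hcube (a + ?s) _")
proof -
  have eq: "\<lfloor>2 ^ k * ((y - a) \<bullet> i / l)\<rfloor> = z \<longleftrightarrow>
      (a \<bullet> i + l / 2 ^ k * of_int z \<le> y \<bullet> i \<and> y \<bullet> i < a \<bullet> i + l / 2 ^ k * of_int z + l / 2 ^ k)"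
    for y i z
    using assms by (auto simp: floor_eq_iff field_simps inner_diff_left)
  have "(a + ?s) \<bullet> i = a \<bullet> i + l / 2 ^ k * of_int \<lfloor>2 ^ k * ((x - a) \<bullet> i / l)\<rfloor>" if "i \<in> Basis" for i
    using that by (simp add: inner_add_left inner_sum_left inner_Basis if_distrib if_distribR sum.delta cong: if_cong)
  then show ?thesis
    unfolding dcube_def hcube_def eq by auto
qed

lemma dcube_0:
  assumes "l > 0" "x \<in> hcube a l"
  shows "dcube a l 0 x = hcube a l"
proof -
  have *: "\<lfloor>(y - a) \<bullet> i / l\<rfloor> = 0 \<longleftrightarrow> a \<bullet> i \<le> y \<bullet> i \<and> y \<bullet> i < a \<bullet> i + l" for y i
    using assms(1) by (auto simp: floor_eq_iff field_simps inner_diff_left)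
  then have 0: "\<lfloor>(x - a) \<bullet> i / l\<rfloor> = 0" if "i \<in> Basis" for i
    using assms(2) that by (simp add: hcube_def)
  show ?thesis
    unfolding dcube_def hcube_def by (simp add: 0 * cong: ball_cong)
qed

lemma dcube_subset_hcube: "l > 0 \<Longrightarrow> x \<in> hcube a l \<Longrightarrow> dcube a l k x \<subseteq> hcube a l"
  using dcube_0 dcube_antimono[of 0 k] by fastforce

lemma emeasure_dcube:
  "l > 0 \<Longrightarrow> emeasure lebesgue (dcube (a::'a::euclidean_space) l k x) = ennreal ((l / 2 ^ k) ^ DIM('a))"
  by (subst dcube_eq_hcube, assumption, subst emeasure_hcube) auto

text \<open>Side length \<open>0\<close> encodes the empty cube, so that sequences also describe finite families.\<close>

lemma dyadic_stopping:
  fixes a :: "'a::euclidean_space"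
  assumes l: "l > 0"
  obtains b :: "nat \<Rightarrow> 'a" and s :: "nat \<Rightarrow> real" where
    "\<And>j. s j \<ge> 0" "disjoint_family (\<lambda>j. hcube (b j) (s j))"
    "(\<Union>j. hcube (b j) (s j)) = {x \<in> hcube a l. \<exists>k. \<Phi> (dcube a l k x)}"
    "\<And>j. s j > 0 \<Longrightarrow> \<exists>k x. x \<in> hcube a l \<and> hcube (b j) (s j) = dcube a l k x \<and> s j = l / 2 ^ k \<and>
        \<Phi> (dcube a l k x) \<and> (\<forall>m<k. \<not> \<Phi> (dcube a l m x))"
proof -
  let ?D = "dcube a l"
  \<comment> \<open>Stopping at the first generation with \<open>\<Phi>\<close> picks the maximal
    dyadic cubes with \<open>\<Phi>\<close>. The predicate stays abstract because two stopping rules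
    are used later: having a large mean, and lying inside an open set while meeting a given
    set.\<close>
  define sel where "sel k x \<longleftrightarrow> x \<in> hcube a l \<and> \<Phi> (?D k x) \<and> (\<forall>m<k. \<not> \<Phi> (?D m x))" for k x
  define \<P> where "\<P> = {?D k x |k x. sel k x}"
  have sel_unique: "?D k x = ?D m y" if "sel k x" "sel m y" "z \<in> ?D k x" "z \<in> ?D m y" "k \<le> m" for k m x y z
  proof -
    have 1: "?D k x = ?D k z" "?D m y = ?D m z"
      using that dcube_eqI by metis+
    have "z \<in> ?D k y"
      using that(4) dcube_antimono[OF that(5)] by blast
    then have "?D k y = ?D k x"
      using 1 dcube_eqI by metis
    \<comment> \<open>Otherwise the ancestor of generation \<open>k\<close> of the second cube would
      be the first cube, which satisfies \<open>\<Phi>\<close>, and \<open>m\<close> would not be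
      the first stopping generation.\<close>
    then have "\<not> k < m"
      using that(1,2) by (auto simp: sel_def)
    with that(5) 1 show ?thesis by auto
  qed
  have disj: "P = P'" if "P \<in> \<P>" "P' \<in> \<P>" "z \<in> P" "z \<in> P'" for P P' z
  proof -
    obtain k x m y where *: "P = ?D k x" "sel k x" "P' = ?D m y" "sel m y"
      using \<open>P \<in> \<P>\<close> \<open>P' \<in> \<P>\<close> unfolding \<P>_def by blast
    show ?thesis
      using sel_unique[of k x m y z] sel_unique[of m y k x z] * that by (cases "k \<le> m") auto
  qed
  have "countable \<P>"
  proof (rule countable_disjoint_nonempty_interior_subsets)
    show "pairwise disjnt \<P>"
      unfolding pairwise_def disjnt_def using disj by blast
    fix S assume "S \<in> \<P>" "interior S = {}"
    then obtain k x where "S = ?D k x" by (auto simp: \<P>_def)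
    then show "S = {}"
      using \<open>interior S = {}\<close> interior_hcube_nonempty[of "l / 2 ^ k"] l
      unfolding dcube_eq_hcube[OF l] by auto
  qed
  define f where "f = to_nat_on \<P>"
  have inj: "inj_on f \<P>"
    unfolding f_def by (rule inj_on_to_nat_on[OF \<open>countable \<P>\<close>])
  define P where "P j = (if j \<in> f ` \<P> then inv_into \<P> f j else {})" for j
  have P_in: "P j \<in> \<P>" if "P j \<noteq> {}" for j
    using that by (auto simp: P_def inj inv_into_f_f split: if_splits)
  have "\<exists>b s. s \<ge> 0 \<and> P j = hcube b s \<and> (s > 0 \<longrightarrow> (\<exists>k x. sel k x \<and> P j = ?D k x \<and> s = l / 2 ^ k))" for j
  proof (cases "P j = {}")
    case True
    then show ?thesis using hcube_empty[of 0] by (intro exI[of _ a] exI[of _ 0]) auto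
  next
    case False
    then obtain k x where "sel k x" "P j = ?D k x"
      using P_in[OF False] by (auto simp: \<P>_def)
    moreover from this have "P j = hcube (a + (\<Sum>i\<in>Basis.
        (l / 2 ^ k * of_int \<lfloor>2 ^ k * ((x - a) \<bullet> i / l)\<rfloor>) *\<^sub>R i)) (l / 2 ^ k)"
      using dcube_eq_hcube[OF l, of a k x] by simp
    moreover have "l / 2 ^ k \<ge> 0" using l by simp
    ultimately show ?thesis by blast
  qed
  then obtain b s where bs: "\<And>j. s j \<ge> 0" "\<And>j. P j = hcube (b j) (s j)"
      "\<And>j. s j > 0 \<Longrightarrow> \<exists>k x. sel k x \<and> P j = ?D k x \<and> s j = l / 2 ^ k"
    by metis
  have P_inj: "i = j" if "z \<in> P i" "z \<in> P j" for z i j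
  proof -
    have "i \<in> f ` \<P>" "j \<in> f ` \<P>" using that by (auto simp: P_def split: if_splits)
    moreover have "P i = P j" using disj[OF P_in P_in] that by blast
    ultimately show ?thesis by (auto simp: P_def inj)
  qed
  have Un: "(\<Union>j. P j) = \<Union>\<P>"
  proof -
    have "\<exists>j. P j = S" if "S \<in> \<P>" for S
      using that inj by (intro exI[of _ "f S"]) (simp add: P_def)
    then show ?thesis using P_in by blast
  qed
  have cover: "\<Union>\<P> = {x \<in> hcube a l. \<exists>k. \<Phi> (?D k x)}"
  proof (intro equalityI subsetI)
    fix x assume "x \<in> \<Union>\<P>"
    then obtain k y where "sel k y" "x \<in> ?D k y" by (auto simp: \<P>_def)
    then show "x \<in> {x \<in> hcube a l. \<exists>k. \<Phi> (?D k x)}"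
      using dcube_subset_hcube[OF l, of y a k] dcube_eqI[of x a l k y]
      by (auto simp: sel_def intro!: exI[of _ k])
  next
    fix x assume "x \<in> {x \<in> hcube a l. \<exists>k. \<Phi> (?D k x)}"
    then have "sel (LEAST k. \<Phi> (?D k x)) x"
      by (auto simp: sel_def intro: LeastI dest: not_less_Least)
    then show "x \<in> \<Union>\<P>" unfolding \<P>_def using dcube_self by blast
  qed
  show thesis
  proof (rule that[of s b])
    show "disjoint_family (\<lambda>j. hcube (b j) (s j))"
      using P_inj unfolding disjoint_family_on_def bs(2)[symmetric] by blast
    show "(\<Union>j. hcube (b j) (s j)) = {x \<in> hcube a l. \<exists>k. \<Phi> (?D k x)}"
      using Un cover by (simp add: bs(2))
    show "\<exists>k x. x \<in> hcube a l \<and> hcube (b j) (s j) = ?D k x \<and> s j = l / 2 ^ k \<and>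
        \<Phi> (?D k x) \<and> (\<forall>m<k. \<not> \<Phi> (?D m x))" if "s j > 0" for j
      using bs(3)[OF that] by (metis bs(2) sel_def)
  qed (use bs in auto)
qed

lemma dcube_in_open:
  fixes a :: "'a::euclidean_space"
  assumes "l > 0" "open U" "x \<in> U"
  obtains k where "dcube a l k x \<subseteq> U"
proof -
  obtain e where e: "e > 0" "ball x e \<subseteq> U"
    using assms openE by blast
  \<comment> \<open>Comparing the norm with the sum of the coordinates bounds the diameter of a cube
    by \<open>DIM('a)\<close> times its side \<open>l / 2 ^ k\<close>; the choice of
    \<open>k\<close> makes this smaller than \<open>e\<close>.\<close>
  obtain k where k: "(1/2::real) ^ k < e / (l * DIM('a))"
    using real_arch_pow_inv[of "e / (l * DIM('a))" "1/2"] e assms by auto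
  have "dcube a l k x \<subseteq> ball x e"
  proof
    fix y assume y: "y \<in> dcube a l k x"
    have "\<bar>(y - x) \<bullet> i\<bar> \<le> l / 2 ^ k" if "i \<in> Basis" for i
    proof -
      have "\<lfloor>2 ^ k * ((y - a) \<bullet> i / l)\<rfloor> = \<lfloor>2 ^ k * ((x - a) \<bullet> i / l)\<rfloor>"
        using y that by (simp add: dcube_def)
      then have "\<bar>2 ^ k * ((y - a) \<bullet> i / l) - 2 ^ k * ((x - a) \<bullet> i / l)\<bar> \<le> 1" by linarith
      also have "2 ^ k * ((y - a) \<bullet> i / l) - 2 ^ k * ((x - a) \<bullet> i / l) = (2 ^ k / l) * ((y - x) \<bullet> i)"
        using assms(1) by (simp add: field_simps inner_diff_left)
      finally have "(2 ^ k / l) * \<bar>(y - x) \<bullet> i\<bar> \<le> 1"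
        using assms(1) by (simp add: abs_mult)
      then show ?thesis using assms(1) by (simp add: field_simps)
    qed
    then have "(\<Sum>i\<in>Basis. \<bar>(y - x) \<bullet> i\<bar>) \<le> of_nat (card (Basis::'a set)) * (l / 2 ^ k)"
      by (intro sum_bounded_above) auto
    then have "norm (y - x) \<le> DIM('a) * (l / 2 ^ k)"
      using norm_le_l1[of "y - x"] by simp
    also have "\<dots> < e"
      using k assms(1) by (simp add: field_simps power_one_over)
    finally show "y \<in> ball x e" by (simp add: dist_norm norm_minus_commute)
  qed
  with e show ?thesis using that by blast
qed

section \<open>Calderon-Zygmund cubes\<close>

lemma hcube_lebesgue [measurable]: "hcube a l \<in> sets lebesgue"
  using hcube_borel by (rule sets_lebesgue_borel)

lemma disjoint_family_emeasure_UN_le: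
  fixes g :: "'a::euclidean_space \<Rightarrow> ennreal"
  assumes g [measurable]: "g \<in> borel_measurable lebesgue" and A: "\<And>j::nat. A j \<in> sets lebesgue"
    and disj: "disjoint_family A" and le: "\<And>j. (\<integral>\<^sup>+y\<in>A j. g y \<partial>lebesgue) \<le> c * emeasure lebesgue (A j)"
  shows "(\<integral>\<^sup>+y\<in>(\<Union>j. A j). g y \<partial>lebesgue) \<le> c * emeasure lebesgue (\<Union>j. A j)"
proof -
  have "(\<integral>\<^sup>+y\<in>(\<Union>j. A j). g y \<partial>lebesgue) = (\<Sum>j. \<integral>\<^sup>+y\<in>A j. g y \<partial>lebesgue)"
    by (rule nn_integral_disjoint_family[OF g A disj])
  also have "\<dots> \<le> (\<Sum>j. c * emeasure lebesgue (A j))"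
    using le by (intro suminf_le) auto
  also have "\<dots> = c * emeasure lebesgue (\<Union>j. A j)"
    using suminf_emeasure[OF image_subsetI[OF A] disj] by simp
  finally show ?thesis .
qed

lemma nn_set_integral_mono_set:
  fixes g :: "'a \<Rightarrow> ennreal"
  assumes "A \<subseteq> B"
  shows "(\<integral>\<^sup>+y\<in>A. g y \<partial>M) \<le> (\<integral>\<^sup>+y\<in>B. g y \<partial>M)"
  using assms by (intro nn_integral_mono) (auto simp: indicator_def)

text \<open>The lower bound is the stopping rule. The upper bound is inherited from the parent,
  which was not selected and has \<open>2 ^ DIM('a)\<close> times the measure; \<open>avg\<close>
  prevents the base cube from stopping, so a parent exists. The bound off the cubes comes from a
  covering argument in place of Lebesgue differentiation: no dyadic cube through such a point has a
  mean above \<open>\<tau>\<close>.\<close>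

proposition calderon_zygmund_cubes:
  fixes g :: "'a::euclidean_space \<Rightarrow> ennreal"
  assumes g [measurable]: "g \<in> borel_measurable lebesgue" and l: "l > 0" and \<tau>: "\<tau> > 0"
    and avg: "(\<integral>\<^sup>+y\<in>hcube a l. g y \<partial>lebesgue) \<le> ennreal (\<tau> * l ^ DIM('a))"
  obtains b :: "nat \<Rightarrow> 'a" and s :: "nat \<Rightarrow> real" where
    "\<And>j. s j \<ge> 0" "disjoint_family (\<lambda>j. hcube (b j) (s j))"
    "\<And>j. hcube (b j) (s j) \<subseteq> hcube a l"
    "\<And>j. ennreal (\<tau> * s j ^ DIM('a)) \<le> (\<integral>\<^sup>+y\<in>hcube (b j) (s j). g y \<partial>lebesgue)"
    "\<And>j. (\<integral>\<^sup>+y\<in>hcube (b j) (s j). g y \<partial>lebesgue) \<le> ennreal (2 ^ DIM('a) * \<tau> * s j ^ DIM('a))"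
    "AE x in lebesgue. x \<in> hcube a l \<longrightarrow> x \<notin> (\<Union>j. hcube (b j) (s j)) \<longrightarrow> g x \<le> ennreal \<tau>"
proof -
  let ?n = "DIM('a)" and ?D = "dcube a l" and ?\<mu> = "emeasure (lebesgue :: 'a measure)"
  define \<Phi> where "\<Phi> P \<longleftrightarrow> ennreal \<tau> * ?\<mu> P < (\<integral>\<^sup>+y\<in>P. g y \<partial>lebesgue)" for P
  obtain b :: "nat \<Rightarrow> 'a" and s where s0: "\<And>j. s j \<ge> 0" and disj: "disjoint_family (\<lambda>j. hcube (b j) (s j))"
    and Un: "(\<Union>j. hcube (b j) (s j)) = {x \<in> hcube a l. \<exists>k. \<Phi> (?D k x)}"
    and bs: "\<And>j. s j > 0 \<Longrightarrow> \<exists>k x. x \<in> hcube a l \<and> hcube (b j) (s j) = ?D k x \<and> s j = l / 2 ^ k \<and>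
        \<Phi> (?D k x) \<and> (\<forall>m<k. \<not> \<Phi> (?D m x))"
    by (rule dyadic_stopping[OF l, of a \<Phi>]) (rule that, assumption+)
  have mu: "?\<mu> (?D k x) = ennreal ((l / 2 ^ k) ^ ?n)" for k x
    by (rule emeasure_dcube[OF l])
  have pos: "s j > 0 \<or> s j = 0" for j using s0[of j] by auto
  have empty: "hcube (b j) (s j) = {}" if "s j = 0" for j
    using that by (simp add: hcube_empty)
  have lower: "ennreal (\<tau> * s j ^ ?n) \<le> (\<integral>\<^sup>+y\<in>hcube (b j) (s j). g y \<partial>lebesgue)" for j
  proof (cases "s j > 0")
    case True
    with bs obtain k x where k: "hcube (b j) (s j) = ?D k x" "s j = l / 2 ^ k" "\<Phi> (?D k x)" by blast
    then show ?thesis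
      using \<tau> unfolding \<Phi>_def mu by (simp add: ennreal_mult' less_imp_le)
  next
    case False then have "s j = 0" using pos by blast
    then show ?thesis by (simp add: zero_power)
  qed
  have upper: "(\<integral>\<^sup>+y\<in>hcube (b j) (s j). g y \<partial>lebesgue) \<le> ennreal (2 ^ ?n * \<tau> * s j ^ ?n)" for j
  proof (cases "s j > 0")
    case True
    with bs obtain k x where k: "x \<in> hcube a l" "hcube (b j) (s j) = ?D k x" "s j = l / 2 ^ k"
        "\<Phi> (?D k x)" "\<forall>m<k. \<not> \<Phi> (?D m x)" by blast
    have "\<not> \<Phi> (?D 0 x)"
      using avg \<tau> l unfolding \<Phi>_def mu by (simp add: dcube_0[OF l k(1)] ennreal_mult' not_less)
    then obtain m where m: "k = Suc m" using k(4) by (cases k) auto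
    have "(\<integral>\<^sup>+y\<in>?D k x. g y \<partial>lebesgue) \<le> (\<integral>\<^sup>+y\<in>?D m x. g y \<partial>lebesgue)"
      unfolding m by (rule nn_set_integral_mono_set[OF dcube_Suc_subset])
    also have "\<dots> \<le> ennreal \<tau> * ennreal ((l / 2 ^ m) ^ ?n)"
      using k(5) m by (auto simp: \<Phi>_def mu not_less)
    also have "\<dots> = ennreal (\<tau> * (l / 2 ^ m) ^ ?n)"
      using \<tau> by (simp add: ennreal_mult')
    also have "\<tau> * (l / 2 ^ m) ^ ?n = 2 ^ ?n * \<tau> * s j ^ ?n"
      by (simp add: k(3) m power_divide power_mult_distrib)
    finally show ?thesis by (simp add: k(2))
  next
    case False then have "s j = 0" using pos by blast
    then show ?thesis by (subst empty) auto
  qed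
  have "AE x in lebesgue. x \<in> hcube a l \<longrightarrow> x \<notin> (\<Union>j. hcube (b j) (s j)) \<longrightarrow> g x \<le> ennreal \<tau>"
  proof -
    \<comment> \<open>The gap \<open>1 / Suc m\<close> above \<open>\<tau>\<close> forces each of
      these sets to be null; their union contains every point off the cubes at which
      \<open>g\<close> exceeds \<open>\<tau>\<close>.\<close>
    define F where "F m = {x \<in> hcube a l - (\<Union>j. hcube (b j) (s j)). ennreal (\<tau> + 1 / Suc m) \<le> g x}" for m
    have F_sets [measurable]: "F m \<in> sets lebesgue" for m
      unfolding F_def by measurable
    have "?\<mu> (F m) = 0" for m
    proof -
      define \<delta> where "\<delta> = 1 / real (Suc m)"
      have \<delta>: "\<delta> > 0" by (simp add: \<delta>_def)
      have "?\<mu> (F m) \<le> ?\<mu> (hcube a l)"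
        by (intro emeasure_mono) (auto simp: F_def)
      then have "?\<mu> (F m) < \<infinity>"
        using emeasure_hcube[of l a] l by (metis ennreal_less_top infinity_ennreal_def less_imp_le order_le_less_trans)
      then obtain M where M: "M \<ge> 0" "?\<mu> (F m) = ennreal M"
        by (metis ennreal_enn2real enn2real_nonneg infinity_ennreal_def)
      \<comment> \<open>Amounts to \<open>(\<tau> + \<delta>) * M \<le> \<tau> * (M + e)\<close>.
        The left side bounds the integral of \<open>g\<close> over \<open>F m\<close> from below;
        the right side bounds it from above, over a cover of \<open>F m\<close> by dyadic cubes
        inside an open set that outer regularity makes almost as small as
        \<open>F m\<close>.\<close>
      have small: "\<delta> * M \<le> \<tau> * e" if "e > 0" for e
      proof -
        obtain U where U: "open U" "F m \<subseteq> U" "emeasure lebesgue (U - F m) < ennreal e"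
          using sets_lebesgue_outer_open[OF F_sets \<open>e > 0\<close>] by metis
        have [measurable]: "U \<in> sets lebesgue" using U(1) by (simp add: borel_open)
        \<comment> \<open>Each such cube contains a point outside all selected cubes, so the mean of
          \<open>g\<close> on it is at most \<open>\<tau>\<close>; openness of \<open>U\<close>
          ensures that the cubes cover \<open>F m\<close>.\<close>
        define \<Psi> where "\<Psi> P \<longleftrightarrow> P \<subseteq> U \<and> P \<inter> F m \<noteq> {}" for P
        obtain b' :: "nat \<Rightarrow> 'a" and s' where s'0: "\<And>j. s' j \<ge> 0" and disj': "disjoint_family (\<lambda>j. hcube (b' j) (s' j))"
          and Un': "(\<Union>j. hcube (b' j) (s' j)) = {x \<in> hcube a l. \<exists>k. \<Psi> (?D k x)}"
          and bs': "\<And>j. s' j > 0 \<Longrightarrow> \<exists>k x. x \<in> hcube a l \<and> hcube (b' j) (s' j) = ?D k x \<and>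
              s' j = l / 2 ^ k \<and> \<Psi> (?D k x) \<and> (\<forall>m<k. \<not> \<Psi> (?D m x))"
          by (rule dyadic_stopping[OF l, of a \<Psi>]) (rule that, assumption+)
        let ?V = "\<Union>j. hcube (b' j) (s' j)"
        have FV: "F m \<subseteq> ?V"
        proof
          fix x assume x: "x \<in> F m"
          then obtain k where "?D k x \<subseteq> U"
            using dcube_in_open[OF l U(1)] U(2) by blast
          then have "\<Psi> (?D k x)" using x dcube_self[of x a l k] unfolding \<Psi>_def by blast
          then show "x \<in> ?V" using x unfolding Un' by (auto simp: F_def)
        qed
        have VU: "?V \<subseteq> U"
          unfolding Un' \<Psi>_def using dcube_self by blast
        have le: "(\<integral>\<^sup>+y\<in>hcube (b' j) (s' j). g y \<partial>lebesgue) \<le> ennreal \<tau> * ?\<mu> (hcube (b' j) (s' j))" for j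
        proof (cases "s' j > 0")
          case True
          with bs' obtain k x where k: "hcube (b' j) (s' j) = ?D k x" "\<Psi> (?D k x)" by blast
          then obtain z where z: "z \<in> ?D k x" "z \<in> F m" by (auto simp: \<Psi>_def)
          have "\<not> \<Phi> (?D k z)" using z(2) unfolding F_def Un by blast
          then show ?thesis
            unfolding k \<Phi>_def by (simp add: dcube_eqI[OF z(1)] not_less)
        next
          case False then have "hcube (b' j) (s' j) = {}" using s'0[of j] by (simp add: hcube_empty)
          then show ?thesis by simp
        qed
        have "ennreal (\<tau> + \<delta>) * ?\<mu> (F m) = (\<integral>\<^sup>+y\<in>F m. ennreal (\<tau> + \<delta>) \<partial>lebesgue)"
          by (simp add: nn_integral_cmult_indicator)
        also have "\<dots> \<le> (\<integral>\<^sup>+y\<in>F m. g y \<partial>lebesgue)"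
          by (intro nn_integral_mono) (auto simp: indicator_def F_def \<delta>_def)
        also have "\<dots> \<le> (\<integral>\<^sup>+y\<in>?V. g y \<partial>lebesgue)"
          by (rule nn_set_integral_mono_set[OF FV])
        also have "\<dots> \<le> ennreal \<tau> * ?\<mu> ?V"
          by (rule disjoint_family_emeasure_UN_le[OF g _ disj' le]) simp
        also have "\<dots> \<le> ennreal \<tau> * ?\<mu> (F m \<union> (U - F m))"
          using VU by (intro mult_left_mono emeasure_mono) auto
        also have "\<dots> \<le> ennreal \<tau> * (?\<mu> (F m) + ?\<mu> (U - F m))"
          by (intro mult_left_mono emeasure_subadditive) auto
        also have "\<dots> \<le> ennreal \<tau> * (ennreal M + ennreal e)"
          using U(3) M by (intro mult_left_mono add_mono) auto
        finally have "ennreal ((\<tau> + \<delta>) * M) \<le> ennreal (\<tau> * (M + e))"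
          using M \<tau> \<delta> that by (simp add: ennreal_mult' ennreal_plus[symmetric] del: ennreal_plus)
        then have "(\<tau> + \<delta>) * M \<le> \<tau> * (M + e)"
          using M \<tau> that by (subst (asm) ennreal_le_iff) auto
        then show ?thesis by (simp add: algebra_simps)
      qed
      have "\<delta> * M / \<tau> \<le> 0 + e" if "e > 0" for e
        using small[OF that] \<tau> by (simp add: field_simps)
      then have "\<delta> * M / \<tau> \<le> 0" by (rule field_le_epsilon)
      then have "\<delta> * M \<le> 0" using \<tau> by (simp add: divide_le_0_iff)
      then have "M = 0" using M \<delta> by (simp add: mult_le_0_iff)
      with M show ?thesis by simp
    qed
    then have "F m \<in> null_sets lebesgue" for m by (simp add: null_setsI)
    then have "(\<Union>m. F m) \<in> null_sets lebesgue" by blast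
    then have "AE x in lebesgue. x \<notin> (\<Union>m. F m)" by (rule AE_not_in)
    then show ?thesis
    proof (rule AE_mp, intro AE_I2 impI)
      fix x assume x: "x \<notin> (\<Union>m. F m)" "x \<in> hcube a l" "x \<notin> (\<Union>j. hcube (b j) (s j))"
      have lt: "g x < ennreal (\<tau> + 1 / Suc m)" for m
      proof (rule ccontr)
        assume "\<not> g x < ennreal (\<tau> + 1 / Suc m)"
        then have "x \<in> F m" using x(2,3) by (auto simp: F_def not_less)
        with x(1) show False by blast
      qed
      then obtain r where r: "g x = ennreal r" "r \<ge> 0"
        by (metis ennreal_less_top order.strict_trans ennreal_cases less_irrefl)
      have "r \<le> \<tau> + e" if "e > 0" for e
      proof -
        obtain m where "1 / real (Suc m) < e" using nat_approx_posE[OF \<open>e > 0\<close>] by auto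
        moreover have "r < \<tau> + 1 / real (Suc m)"
          using lt[of m] r by (simp add: ennreal_less_iff)
        ultimately show ?thesis by simp
      qed
      then have "r \<le> \<tau>" by (rule field_le_epsilon)
      then show "g x \<le> ennreal \<tau>"
        using r by (simp add: ennreal_leI)
    qed
  qed
  moreover have "hcube (b j) (s j) \<subseteq> hcube a l" for j using Un by blast
  ultimately show thesis
    using s0 disj lower upper by (intro that[of s b])
qed

section \<open>The centred maximal function and kernel tails\<close>

lemma emeasure_lebesgue_cball:
  "r \<ge> 0 \<Longrightarrow> emeasure lebesgue (cball (x::'a::euclidean_space) r) = ennreal (unit_ball_vol DIM('a) * r ^ DIM('a))"
  using emeasure_cball[of r x] by (simp add: emeasure_completion)

text \<open>A superlevel set of the centred maximal function over balls, normalised by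
  \<open>r ^ DIM('a)\<close> in place of the volume of the ball. A point outside it satisfies the
  mean bound at all radii at once, which is the form required by the tail estimates.\<close>

definition maximal_set :: "('a::euclidean_space \<Rightarrow> ennreal) \<Rightarrow> real \<Rightarrow> 'a set" where
  "maximal_set g \<tau> = {x. \<exists>r>0. ennreal (\<tau> * r ^ DIM('a)) < (\<integral>\<^sup>+y\<in>cball x r. g y \<partial>lebesgue)}"

lemma not_in_maximal_set:
  "x \<notin> maximal_set g \<tau> \<Longrightarrow> r > 0 \<Longrightarrow> (\<integral>\<^sup>+y\<in>cball (x::'a::euclidean_space) r. g y \<partial>lebesgue) \<le> ennreal (\<tau> * r ^ DIM('a))"
  by (force simp: maximal_set_def not_less)

text \<open>The strict inequality survives a slight enlargement of the radius from \<open>r\<close>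
  to \<open>t\<close>, and the ball of radius \<open>t\<close> about any point within
  \<open>t - r\<close> of \<open>x\<close> still contains the ball of radius \<open>r\<close> about
  \<open>x\<close>. Openness is the source of measurability.\<close>

lemma open_maximal_set: "open (maximal_set g \<tau>)"
proof (rule openI)
  fix x :: 'a assume "x \<in> maximal_set g \<tau>"
  then obtain r where r: "r > 0" "ennreal (\<tau> * r ^ DIM('a)) < (\<integral>\<^sup>+y\<in>cball x r. g y \<partial>lebesgue)"
    by (auto simp: maximal_set_def)
  have "((\<lambda>t. ennreal (\<tau> * t ^ DIM('a))) \<longlongrightarrow> ennreal (\<tau> * r ^ DIM('a))) (at_right r)"
    by (intro tendsto_intros)
  then have "eventually (\<lambda>t. ennreal (\<tau> * t ^ DIM('a)) < (\<integral>\<^sup>+y\<in>cball x r. g y \<partial>lebesgue)) (at_right r)"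
    using r(2) by (rule order_tendstoD)
  then obtain u where u: "u > r"
      "\<And>t. t > r \<Longrightarrow> t < u \<Longrightarrow> ennreal (\<tau> * t ^ DIM('a)) < (\<integral>\<^sup>+y\<in>cball x r. g y \<partial>lebesgue)"
    unfolding eventually_at_right_field by blast
  obtain t where "r < t" "t < u" using dense[OF u(1)] by blast
  then have t: "t > r" "ennreal (\<tau> * t ^ DIM('a)) < (\<integral>\<^sup>+y\<in>cball x r. g y \<partial>lebesgue)"
    using u(2) by blast+
  show "\<exists>e>0. ball x e \<subseteq> maximal_set g \<tau>"
  proof (intro exI conjI subsetI)
    show "t - r > 0" using t by simp
    fix z assume "z \<in> ball x (t - r)"
    then have "cball x r \<subseteq> cball z t"
      by (simp add: cball_subset_cball_iff dist_commute)
    then have "(\<integral>\<^sup>+y\<in>cball x r. g y \<partial>lebesgue) \<le> (\<integral>\<^sup>+y\<in>cball z t. g y \<partial>lebesgue)"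
      by (rule nn_set_integral_mono_set)
    then show "z \<in> maximal_set g \<tau>"
      using t r(1) unfolding maximal_set_def by (auto intro!: exI[of _ t])
  qed
qed

lemma maximal_set_sets [measurable]: "maximal_set g \<tau> \<in> sets lebesgue"
  using borel_open[OF open_maximal_set] by (rule sets_lebesgue_borel)

text \<open>The Vitali covering lemma delivers a countable set of centres and not a sequence, hence
  a sum in the form of an integral over \<open>count_space\<close>.\<close>

lemma emeasure_UN_countable_subadditive:
  assumes A: "\<And>j. j \<in> C \<Longrightarrow> A j \<in> sets M" and C: "countable C"
  shows "emeasure M (\<Union>j\<in>C. A j) \<le> (\<integral>\<^sup>+j. emeasure M (A j) \<partial>count_space C)"
proof -
  have "emeasure M (\<Union>j\<in>C. A j) = (\<integral>\<^sup>+x. indicator (\<Union>j\<in>C. A j) x \<partial>M)"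
    using A C by (intro nn_integral_indicator[symmetric] sets.countable_UN') auto
  also have "\<dots> \<le> (\<integral>\<^sup>+x. (\<integral>\<^sup>+j. indicator (A j) x \<partial>count_space C) \<partial>M)"
  proof (intro nn_integral_mono)
    fix x
    show "indicator (\<Union>j\<in>C. A j) x \<le> (\<integral>\<^sup>+j. indicator (A j) x \<partial>count_space C :: ennreal)"
    proof (cases "x \<in> (\<Union>j\<in>C. A j)")
      case True
      then obtain j where j: "j \<in> C" "x \<in> A j" by blast
      then have "indicator (A j) x \<le> (\<integral>\<^sup>+j. indicator (A j) x \<partial>count_space C :: ennreal)"
        by (intro nn_integral_ge_point)
      with True j show ?thesis by simp
    qed simp
  qed
  also have "\<dots> = (\<integral>\<^sup>+j. (\<integral>\<^sup>+x. indicator (A j) x \<partial>M) \<partial>count_space C)"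
    using A C by (intro nn_integral_count_space_nn_integral) auto
  also have "\<dots> = (\<integral>\<^sup>+j. emeasure M (A j) \<partial>count_space C)"
    using A by (intro nn_integral_cong) auto
  finally show ?thesis .
qed

text \<open>Vitali covering: a disjoint subfamily of the balls, enlarged five times, covers the set.
  The radii have to be bounded for this, which follows from finite total mass; for infinite mass the
  right-hand side is infinite because the constant is positive.\<close>

proposition maximal_set_weak_type:
  fixes g :: "'a::euclidean_space \<Rightarrow> ennreal"
  assumes g [measurable]: "g \<in> borel_measurable lebesgue" and \<tau>: "\<tau> > 0"
  shows "emeasure lebesgue (maximal_set g \<tau>)
    \<le> ennreal (unit_ball_vol DIM('a) * 5 ^ DIM('a) / \<tau>) * (\<integral>\<^sup>+y. g y \<partial>lebesgue)"
proof (cases "(\<integral>\<^sup>+y. g y \<partial>lebesgue) = \<infinity>")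
  case True
  have "unit_ball_vol (real DIM('a)) * 5 ^ DIM('a) / \<tau> > 0" using \<tau> by simp
  then have "ennreal (unit_ball_vol (real DIM('a)) * 5 ^ DIM('a) / \<tau>) \<noteq> 0"
    by (simp only: ennreal_eq_0_iff not_le)
  then show ?thesis unfolding True by (simp add: ennreal_mult_top)
next
  case False
  let ?n = "DIM('a)" and ?w = "unit_ball_vol (real DIM('a))"
  let ?\<mu> = "emeasure (lebesgue :: 'a measure)"
  have w: "?w > 0" by simp
  define I where "I = (\<integral>\<^sup>+y. g y \<partial>lebesgue)"
  obtain i where i: "I = ennreal i" "i \<ge> 0"
    using False unfolding I_def by (metis ennreal_cases infinity_ennreal_def)
  have "\<forall>x\<in>maximal_set g \<tau>. \<exists>r>0. ennreal (\<tau> * r ^ ?n) < (\<integral>\<^sup>+y\<in>cball x r. g y \<partial>lebesgue)"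
    by (auto simp: maximal_set_def)
  then obtain r where r: "\<And>x. x \<in> maximal_set g \<tau> \<Longrightarrow> r x > 0"
    "\<And>x. x \<in> maximal_set g \<tau> \<Longrightarrow> ennreal (\<tau> * r x ^ ?n) < (\<integral>\<^sup>+y\<in>cball x (r x). g y \<partial>lebesgue)"
    by metis
  \<comment> \<open>From \<open>\<tau> * r x ^ DIM('a) < i\<close>, either
    \<open>r x \<le> 1\<close>, or \<open>r x\<close> is at most its own power and hence below
    \<open>i / \<tau>\<close>.\<close>
  define B where "B = max 1 (i / \<tau>)"
  have rB: "0 < r x \<and> r x \<le> B" if "x \<in> maximal_set g \<tau>" for x
  proof -
    have "ennreal (\<tau> * r x ^ ?n) < (\<integral>\<^sup>+y\<in>cball x (r x). g y \<partial>lebesgue)" by (rule r(2)[OF that])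
    also have "\<dots> \<le> I"
      unfolding I_def by (intro nn_integral_mono) (auto simp: indicator_def)
    finally have "\<tau> * r x ^ ?n < i"
      using \<tau> r(1)[OF that] i by (simp add: ennreal_less_iff)
    then have *: "r x ^ ?n < i / \<tau>" using \<tau> by (simp add: field_simps)
    have "r x \<le> B"
    proof (cases "r x \<le> 1")
      case False
      then have "r x \<le> r x ^ ?n" using self_le_power[of "r x" ?n] by simp
      with * show ?thesis by (simp add: B_def)
    qed (simp add: B_def)
    with r(1)[OF that] show ?thesis by blast
  qed
  obtain C where C: "countable C" "C \<subseteq> maximal_set g \<tau>"
     "pairwise (\<lambda>i j. disjnt (cball i (r i)) (cball j (r j))) C"
     "\<And>i. i \<in> maximal_set g \<tau> \<Longrightarrow> \<exists>j. j \<in> C \<and> \<not> disjnt (cball i (r i)) (cball j (r j)) \<and>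
          cball i (r i) \<subseteq> ball j (5 * r j)"
    by (rule Vitali_covering_lemma_cballs_balls[where K = "maximal_set g \<tau>" and a = "\<lambda>x. x" and r = r and B = B,
        OF rB]) (assumption, rule that, assumption+)
  define A where "A x = (if x \<in> C then cball x (r x) else {})" for x
  have "maximal_set g \<tau> \<subseteq> (\<Union>j\<in>C. cball j (5 * r j))"
  proof
    fix x assume x: "x \<in> maximal_set g \<tau>"
    with C(4) obtain j where "j \<in> C" "cball x (r x) \<subseteq> ball j (5 * r j)" by blast
    moreover have "x \<in> cball x (r x)" using r(1)[OF x] by simp
    ultimately show "x \<in> (\<Union>j\<in>C. cball j (5 * r j))"
      using ball_subset_cball by blast
  qed
  then have "?\<mu> (maximal_set g \<tau>) \<le> ?\<mu> (\<Union>j\<in>C. cball j (5 * r j))"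
    using C(1) by (intro emeasure_mono sets.countable_UN') auto
  also have "\<dots> \<le> (\<integral>\<^sup>+j. ?\<mu> (cball j (5 * r j)) \<partial>count_space C)"
    using C(1) by (intro emeasure_UN_countable_subadditive) auto
  also have "\<dots> \<le> (\<integral>\<^sup>+j. ennreal (?w * 5 ^ ?n / \<tau>) * (\<integral>\<^sup>+y\<in>cball j (r j). g y \<partial>lebesgue) \<partial>count_space C)"
  proof (intro nn_integral_mono)
    fix j assume "j \<in> space (count_space C)"
    then have j: "j \<in> maximal_set g \<tau>" using C(2) by auto
    have "?\<mu> (cball j (5 * r j)) = ennreal (?w * 5 ^ ?n / \<tau>) * ennreal (\<tau> * r j ^ ?n)"
      using emeasure_lebesgue_cball[of "5 * r j" j] r(1)[OF j] \<tau> w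
      by (simp add: ennreal_mult[symmetric] power_mult_distrib)
    also have "\<dots> \<le> ennreal (?w * 5 ^ ?n / \<tau>) * (\<integral>\<^sup>+y\<in>cball j (r j). g y \<partial>lebesgue)"
      using r(2)[OF j] by (intro mult_left_mono) auto
    finally show "?\<mu> (cball j (5 * r j)) \<le> ennreal (?w * 5 ^ ?n / \<tau>) * (\<integral>\<^sup>+y\<in>cball j (r j). g y \<partial>lebesgue)" .
  qed
  also have "\<dots> = ennreal (?w * 5 ^ ?n / \<tau>) * (\<integral>\<^sup>+j. (\<integral>\<^sup>+y\<in>cball j (r j). g y \<partial>lebesgue) \<partial>count_space C)"
    by (rule nn_integral_cmult) simp
  \<comment> \<open>In terms of the measure with density \<open>g\<close>, the masses of the
    disjoint balls add up to the mass of their union.\<close>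
  also have "(\<integral>\<^sup>+j. (\<integral>\<^sup>+y\<in>cball j (r j). g y \<partial>lebesgue) \<partial>count_space C)
      = (\<integral>\<^sup>+j. emeasure (density lebesgue g) (cball j (r j)) \<partial>count_space C)"
    by (simp add: emeasure_density)
  also have "\<dots> = emeasure (density lebesgue g) (\<Union>j\<in>C. cball j (r j))"
    using C(1,3) by (intro emeasure_UN_countable[symmetric])
      (auto simp: disjoint_family_on_def pairwise_def disjnt_def)
  also have "\<dots> \<le> emeasure (density lebesgue g) (space (density lebesgue g))"
    by (rule emeasure_space)
  also have "\<dots> = I"
    by (simp add: emeasure_density I_def)
  finally show ?thesis
    unfolding I_def by (simp add: mult_left_mono)
qed

text \<open>The geometric sum of \<open>(2 powr - \<delta>) ^ k\<close> over the dyadic annuli. The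
  factor \<open>2 ^ n\<close> appears because the mass is measured on the outer ball of an annulus
  while the kernel is estimated at its inner radius.\<close>

definition tail_const :: "nat \<Rightarrow> real \<Rightarrow> real" where
  "tail_const n \<delta> = 2 ^ n / (1 - 2 powr - \<delta>)"

lemma tail_const_pos: "\<delta> > 0 \<Longrightarrow> tail_const n \<delta> > 0"
  by (simp add: tail_const_def powr_minus field_simps)

text \<open>The region is cut into the dyadic annuli \<open>2\<^sup>k \<rho> < |x - y| \<le> 2\<^sup>k\<^sup>+\<^sup>1 \<rho>\<close>.\<close>

proposition kernel_tail:
  fixes g :: "'a::euclidean_space \<Rightarrow> ennreal" and \<delta> \<rho> \<tau> :: real
  assumes g [measurable]: "g \<in> borel_measurable lebesgue"
    and \<rho>: "\<rho> > 0" and \<delta>: "\<delta> > 0" and \<tau>: "\<tau> \<ge> 0"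
    and avg: "\<And>r. r > 0 \<Longrightarrow> (\<integral>\<^sup>+y\<in>cball x r. g y \<partial>lebesgue) \<le> ennreal (\<tau> * r ^ DIM('a))"
  shows "(\<integral>\<^sup>+y\<in>{y. norm (x - y) > \<rho>}. ennreal (1 / norm (x - y) powr (DIM('a) + \<delta>)) * g y \<partial>lebesgue)
    \<le> ennreal (tail_const DIM('a) \<delta> * \<tau> / \<rho> powr \<delta>)"
proof -
  let ?n = "DIM('a)"
  define w where "w k = 1 / (2 ^ k * \<rho>) powr (?n + \<delta>)" for k :: nat
  have pt: "ennreal (1 / norm (x - y) powr (?n + \<delta>)) * g y * indicator {y. norm (x - y) > \<rho>} y
      \<le> (\<Sum>k. ennreal (w k) * (g y * indicator (cball x (2 ^ Suc k * \<rho>)) y))" for y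
  proof (cases "norm (x - y) > \<rho>")
    case True
    define q where "q = norm (x - y) / \<rho>"
    have q: "q > 1" "norm (x - y) = q * \<rho>" using True \<rho> by (auto simp: q_def field_simps)
    obtain k where k: "2 ^ k \<le> q" "q < 2 ^ Suc k"
    proof -
      let ?k = "nat \<lfloor>log 2 q\<rfloor>"
      have l0: "log 2 q \<ge> 0" using q by simp
      have "2 powr real ?k \<le> 2 powr (log 2 q)"
        using l0 by (intro powr_mono) (auto simp: of_nat_nat)
      moreover have "2 powr (log 2 q) < 2 powr real (Suc ?k)"
        using l0 by (intro powr_less_mono) (auto simp: of_nat_nat, linarith)
      moreover have "2 powr (log 2 q) = q" using q by simp
      ultimately show ?thesis using that[of ?k] by (simp add: powr_realpow[symmetric] powr_add)
    qed
    have "1 / norm (x - y) powr (?n + \<delta>) \<le> w k"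
      unfolding w_def using k q \<rho> \<delta> by (intro divide_left_mono powr_mono2 mult_pos_pos mult_right_mono) auto
    then have "ennreal (1 / norm (x - y) powr (?n + \<delta>)) * g y \<le> ennreal (w k) * g y"
      by (intro mult_right_mono ennreal_leI) auto
    also have "\<dots> = ennreal (w k) * (g y * indicator (cball x (2 ^ Suc k * \<rho>)) y)"
      using k q \<rho> by (simp add: indicator_def dist_norm)
    also have "\<dots> \<le> (\<Sum>k. ennreal (w k) * (g y * indicator (cball x (2 ^ Suc k * \<rho>)) y))"
      using sum_le_suminf[of "\<lambda>k. ennreal (w k) * (g y * indicator (cball x (2 ^ Suc k * \<rho>)) y)" "{k}"] by simp
    finally show ?thesis using True by simp
  qed simp
  define p where "p = 2 powr - \<delta>"
  have p: "0 < p" "p < 1" using \<delta> by (auto simp: p_def powr_minus field_simps)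
  have wk: "w k * (\<tau> * (2 ^ Suc k * \<rho>) ^ ?n) = 2 ^ ?n * \<tau> / \<rho> powr \<delta> * p ^ k" for k
  proof -
    have *: "(2 ^ k) powr \<delta> = 1 / p ^ k"
      by (simp add: p_def powr_minus powr_realpow[symmetric] powr_powr powr_power mult.commute divide_simps)
    have "(2 ^ k * \<rho>) powr (?n + \<delta>) = (2 ^ k * \<rho>) ^ ?n * ((2 ^ k) powr \<delta> * \<rho> powr \<delta>)"
      using \<rho> by (simp add: powr_add powr_realpow powr_mult power_mult_distrib)
    then show ?thesis
      unfolding w_def using \<rho> p by (simp add: * power_mult_distrib field_simps)
  qed
  have "(\<integral>\<^sup>+y\<in>{y. norm (x - y) > \<rho>}. ennreal (1 / norm (x - y) powr (?n + \<delta>)) * g y \<partial>lebesgue)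
      \<le> (\<integral>\<^sup>+y. (\<Sum>k. ennreal (w k) * (g y * indicator (cball x (2 ^ Suc k * \<rho>)) y)) \<partial>lebesgue)"
    using pt by (rule nn_integral_mono)
  also have "\<dots> = (\<Sum>k. \<integral>\<^sup>+y. ennreal (w k) * (g y * indicator (cball x (2 ^ Suc k * \<rho>)) y) \<partial>lebesgue)"
    by (rule nn_integral_suminf) measurable
  also have "\<dots> = (\<Sum>k. ennreal (w k) * (\<integral>\<^sup>+y\<in>cball x (2 ^ Suc k * \<rho>). g y \<partial>lebesgue))"
    by (intro suminf_cong nn_integral_cmult) measurable
  also have "\<dots> \<le> (\<Sum>k. ennreal (2 ^ ?n * \<tau> / \<rho> powr \<delta> * p ^ k))"
  proof (intro suminf_le allI)
    fix k
    have "ennreal (w k) * (\<integral>\<^sup>+y\<in>cball x (2 ^ Suc k * \<rho>). g y \<partial>lebesgue)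
        \<le> ennreal (w k) * ennreal (\<tau> * (2 ^ Suc k * \<rho>) ^ ?n)"
      using \<rho> by (intro mult_left_mono avg) auto
    also have "\<dots> = ennreal (w k * (\<tau> * (2 ^ Suc k * \<rho>) ^ ?n))"
      using \<rho> \<tau> by (intro ennreal_mult[symmetric]) (auto simp: w_def)
    finally show "ennreal (w k) * (\<integral>\<^sup>+y\<in>cball x (2 ^ Suc k * \<rho>). g y \<partial>lebesgue)
        \<le> ennreal (2 ^ ?n * \<tau> / \<rho> powr \<delta> * p ^ k)"
      unfolding wk .
  qed auto
  also have "\<dots> = ennreal (2 ^ ?n * \<tau> / \<rho> powr \<delta> * (1 / (1 - p)))"
    using p \<tau> by (intro suminf_ennreal_eq sums_mult geometric_sums) auto
  also have "2 ^ ?n * \<tau> / \<rho> powr \<delta> * (1 / (1 - p)) = tail_const ?n \<delta> * \<tau> / \<rho> powr \<delta>"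
    by (simp add: tail_const_def p_def)
  finally show ?thesis .
qed

section \<open>Truncated integrals of a Calderon-Zygmund kernel\<close>

abbreviation mass :: "('a::euclidean_space \<Rightarrow> complex) \<Rightarrow> ennreal" where
  "mass f \<equiv> \<integral>\<^sup>+y. ennreal (norm (f y)) \<partial>lebesgue"

abbreviation mass_on :: "'a::euclidean_space set \<Rightarrow> ('a \<Rightarrow> complex) \<Rightarrow> ennreal" where
  "mass_on A f \<equiv> \<integral>\<^sup>+y\<in>A. ennreal (norm (f y)) \<partial>lebesgue"

text \<open>The Bochner integral of a non-integrable function is 0 by convention, so the bound
  persists in that case.\<close>

lemma norm_integral_le_nn_integral:
  fixes h :: "'a \<Rightarrow> complex"
  shows "ennreal (norm (\<integral>x. h x \<partial>M)) \<le> (\<integral>\<^sup>+x. ennreal (norm (h x)) \<partial>M)"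
proof (cases "integrable M h")
  case True
  then show ?thesis by (rule integral_norm_bound_ennreal)
qed (simp add: not_integrable_integral_eq)

lemma borel_measurable_imp_lebesgue:
  "f \<in> borel_measurable borel \<Longrightarrow> f \<in> borel_measurable (lebesgue :: 'a::euclidean_space measure)"
  by (intro measurable_completion) simp

lemma ident_measurable_lebesgue [measurable]: "(\<lambda>x::'a::euclidean_space. x) \<in> borel_measurable lebesgue"
  by (intro measurable_completion) simp

lemma far_sets [measurable]: "{y. norm (x - y) > \<rho>} \<in> sets (lebesgue :: 'a::euclidean_space measure)"
  by (intro sets_lebesgue_borel borel_open open_Collect_less continuous_intros)

text \<open>The smoothness condition is split because its halves serve different ends:
  \<open>smooth_fst\<close> moves the point at which a truncated integral is evaluated,
  \<open>smooth_snd\<close> exploits the cancellation of a function of mean zero on a small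
  cube.\<close>

locale cz_kernel =
  fixes K :: "'a::euclidean_space \<Rightarrow> 'a \<Rightarrow> complex" and c \<delta> :: real
  assumes c_pos: "c > 0" and delta_pos: "\<delta> > 0"
    and size_bound: "x \<noteq> y \<Longrightarrow> norm (K x y) \<le> c / norm (x - y) ^ DIM('a)"
    and smooth_fst: "2 * norm (x - z) < norm (x - y) \<Longrightarrow>
      norm (K x y - K z y) \<le> c * (norm (x - z) powr \<delta> / norm (x - y) powr (real DIM('a) + \<delta>))"
    and smooth_snd: "2 * norm (x - z) < norm (x - y) \<Longrightarrow>
      norm (K y x - K y z) \<le> c * (norm (x - z) powr \<delta> / norm (x - y) powr (real DIM('a) + \<delta>))"
begin

abbreviation T_max :: "('a \<Rightarrow> complex) \<Rightarrow> 'a \<Rightarrow> ennreal" where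
  "T_max \<equiv> maximal_singular_integral K"

abbreviation T_trunc :: "real \<Rightarrow> ('a \<Rightarrow> complex) \<Rightarrow> 'a \<Rightarrow> complex" where
  "T_trunc \<equiv> truncated_integral K"

section \<open>Continuity of the kernel off the diagonal\<close>

lemma eventually_close: "x \<noteq> y \<Longrightarrow> eventually (\<lambda>z. 2 * norm (x - z) < norm (x - y)) (at x)"
proof -
  assume "x \<noteq> y"
  have "((\<lambda>z. 2 * norm (x - z)) \<longlongrightarrow> 2 * norm (x - x)) (at x)" by (intro tendsto_intros)
  then show ?thesis by (rule order_tendstoD) (use \<open>x \<noteq> y\<close> in simp)
qed

lemma modulus_tendsto_0: "((\<lambda>z. c * (norm (x - z) powr \<delta> / B)) \<longlongrightarrow> 0) (at x)"
proof -
  have "((\<lambda>z. c * (norm (x - z) powr \<delta> / B)) \<longlongrightarrow> c * (norm (x - x) powr \<delta> / B)) (at x)"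
    unfolding divide_inverse using delta_pos
    by (intro tendsto_mult tendsto_const tendsto_powr' tendsto_norm tendsto_diff tendsto_ident_at) auto
  then show ?thesis by simp
qed

text \<open>Read off from the smoothness bound, whose right-hand side tends to 0 with
  \<open>norm (y - z)\<close>. The measurability of the integrands \<open>K x y * f y\<close> away
  from the diagonal rests on it.\<close>

lemma continuous_kernel_snd: "x \<noteq> y \<Longrightarrow> isCont (K x) y"
proof -
  assume "x \<noteq> y"
  have "((\<lambda>z. K x y - K x z) \<longlongrightarrow> 0) (at y)"
    by (rule Lim_null_comparison[OF _ modulus_tendsto_0[of y "norm (y - x) powr (real DIM('a) + \<delta>)"]])
      (use eventually_close[of y x] \<open>x \<noteq> y\<close> smooth_snd in \<open>auto elim!: eventually_mono\<close>)
  then have "((\<lambda>z. K x y - (K x y - K x z)) \<longlongrightarrow> K x y - 0) (at y)"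
    by (intro tendsto_diff tendsto_const)
  then show ?thesis by (simp add: isCont_def)
qed

lemma continuous_kernel_fst: "x \<noteq> y \<Longrightarrow> isCont (\<lambda>z. K z y) x"
proof -
  assume "x \<noteq> y"
  have "((\<lambda>z. K x y - K z y) \<longlongrightarrow> 0) (at x)"
    by (rule Lim_null_comparison[OF _ modulus_tendsto_0[of x "norm (x - y) powr (real DIM('a) + \<delta>)"]])
      (use eventually_close[of x y] \<open>x \<noteq> y\<close> smooth_fst in \<open>auto elim!: eventually_mono\<close>)
  then have "((\<lambda>z. K x y - (K x y - K z y)) \<longlongrightarrow> K x y - 0) (at x)"
    by (intro tendsto_diff tendsto_const)
  then show ?thesis by (simp add: isCont_def)
qed

text \<open>Truncating the kernel instead of the domain of integration yields, for
  \<open>\<epsilon> > 0\<close>, a measurable function bounded by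
  \<open>c / \<epsilon> ^ DIM('a)\<close>, so that truncated integrals of integrable functions
  converge absolutely and are additive.\<close>

definition Ktr :: "real \<Rightarrow> 'a \<Rightarrow> 'a \<Rightarrow> complex" where
  "Ktr \<epsilon> x y = indicator {y. norm (x - y) > \<epsilon>} y *\<^sub>R K x y"

lemma Ktr_eq: "Ktr \<epsilon> x y = (if norm (x - y) > \<epsilon> then K x y else 0)"
  by (simp add: Ktr_def)

lemma kernel_off_measurable: "(\<lambda>y. indicator (- {x}) y *\<^sub>R K x y) \<in> borel_measurable lebesgue"
proof -
  have "(\<lambda>y. indicator (- {x}) y *\<^sub>R K x y) \<in> borel_measurable borel"
    by (intro borel_measurable_continuous_on_indicator)
      (auto intro!: continuous_at_imp_continuous_on continuous_kernel_snd)
  then show ?thesis by (rule borel_measurable_imp_lebesgue)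
qed

lemma Ktr_measurable [measurable]:
  assumes "\<epsilon> > 0"
  shows "Ktr \<epsilon> x \<in> borel_measurable lebesgue"
proof -
  have "(\<lambda>y. indicator {y. norm (x - y) > \<epsilon>} y *\<^sub>R (indicator (- {x}) y *\<^sub>R K x y)) \<in> borel_measurable lebesgue"
    using kernel_off_measurable by measurable
  also have "(\<lambda>y. indicator {y. norm (x - y) > \<epsilon>} y *\<^sub>R (indicator (- {x}) y *\<^sub>R K x y)) = Ktr \<epsilon> x"
    using assms by (auto simp: Ktr_def fun_eq_iff split: split_indicator)
  finally show ?thesis .
qed

lemma norm_Ktr: "\<epsilon> > 0 \<Longrightarrow> norm (Ktr \<epsilon> x y) \<le> c / \<epsilon> ^ DIM('a)"
proof (cases "norm (x - y) > \<epsilon>")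
  case True
  assume e: "\<epsilon> > 0"
  have "norm (K x y) \<le> c / norm (x - y) ^ DIM('a)" using True e by (intro size_bound) auto
  also have "\<dots> \<le> c / \<epsilon> ^ DIM('a)"
    using True e c_pos by (intro divide_left_mono power_mono mult_pos_pos zero_less_power) auto
  finally show ?thesis using True by (simp add: Ktr_eq)
qed (use c_pos in \<open>auto simp: Ktr_eq\<close>)

lemma norm_Ktr_mult: "\<epsilon> > 0 \<Longrightarrow> norm (Ktr \<epsilon> x y * w) \<le> c / \<epsilon> ^ DIM('a) * norm w"
  unfolding norm_mult by (intro mult_right_mono norm_Ktr) auto

lemma truncated_integral_Ktr: "T_trunc \<epsilon> f x = (\<integral>y. Ktr \<epsilon> x y * f y \<partial>lebesgue)"
  by (simp add: truncated_integral_def set_lebesgue_integral_def Ktr_def)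

lemma integrable_Ktr:
  assumes "\<epsilon> > 0" "integrable lebesgue f"
  shows "integrable lebesgue (\<lambda>y. Ktr \<epsilon> x y * f y)"
proof (rule Bochner_Integration.integrable_bound)
  show "integrable lebesgue (\<lambda>y. (c / \<epsilon> ^ DIM('a)) *\<^sub>R f y)"
    using assms by (intro integrable_scaleR_right) auto
  show "(\<lambda>y. Ktr \<epsilon> x y * f y) \<in> borel_measurable lebesgue"
    using assms by (intro borel_measurable_times Ktr_measurable borel_measurable_integrable)
  have "norm (Ktr \<epsilon> x y * f y) \<le> norm ((c / \<epsilon> ^ DIM('a)) *\<^sub>R f y)" for y
    using mult_right_mono[OF norm_Ktr[OF assms(1), of x y], of "norm (f y)"] c_pos assms(1)
    by (simp add: norm_mult)
  then show "AE y in lebesgue. norm (Ktr \<epsilon> x y * f y) \<le> norm ((c / \<epsilon> ^ DIM('a)) *\<^sub>R f y)"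
    by simp
qed

text \<open>Dominated convergence with the bound
  \<open>c / \<epsilon> ^ DIM('a) * norm (f y)\<close>. At \<open>x\<close> the truncated kernel can
  jump only for \<open>y\<close> on the sphere of radius \<open>\<epsilon>\<close> about
  \<open>x\<close>, which is a null set.\<close>

lemma continuous_truncated_integral:
  assumes e: "\<epsilon> > 0" and f: "integrable lebesgue f"
  shows "continuous_on UNIV (T_trunc \<epsilon> f)"
proof (rule continuous_at_imp_continuous_on, rule ballI)
  fix x :: 'a
  show "isCont (T_trunc \<epsilon> f) x"
    unfolding continuous_at_sequentially
  proof (intro allI impI)
    fix X assume X: "X \<longlonglongrightarrow> x"
    have "AE y in lebesgue. y \<notin> sphere x \<epsilon>"
      using negligible_sphere[of x \<epsilon>] by (intro AE_not_in) (simp add: negligible_iff_null_sets)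
    then have ae: "AE y in lebesgue. (\<lambda>i. Ktr \<epsilon> (X i) y * f y) \<longlonglongrightarrow> Ktr \<epsilon> x y * f y"
    proof (rule AE_mp, intro AE_I2 impI)
      fix y assume "y \<notin> sphere x \<epsilon>"
      then consider "norm (x - y) > \<epsilon>" | "norm (x - y) < \<epsilon>"
        by (fastforce simp: dist_norm)
      then have "(\<lambda>i. Ktr \<epsilon> (X i) y) \<longlonglongrightarrow> Ktr \<epsilon> x y"
      proof cases
        case 1
        have "(\<lambda>i. norm (X i - y)) \<longlonglongrightarrow> norm (x - y)" by (intro tendsto_intros X)
        then have "eventually (\<lambda>i. norm (X i - y) > \<epsilon>) sequentially" using 1 by (rule order_tendstoD)
        then have ev: "eventually (\<lambda>i. Ktr \<epsilon> (X i) y = K (X i) y) sequentially"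
          by eventually_elim (simp add: Ktr_eq)
        have "(\<lambda>i. K (X i) y) \<longlonglongrightarrow> K x y"
          using 1 e by (intro isCont_tendsto_compose[OF continuous_kernel_fst X]) auto
        moreover have "Ktr \<epsilon> x y = K x y" using 1 by (simp add: Ktr_eq)
        ultimately show ?thesis by (simp only: tendsto_cong[OF ev])
      next
        case 2
        have "(\<lambda>i. norm (X i - y)) \<longlonglongrightarrow> norm (x - y)" by (intro tendsto_intros X)
        then have "eventually (\<lambda>i. norm (X i - y) < \<epsilon>) sequentially" using 2 by (rule order_tendstoD)
        then have ev: "eventually (\<lambda>i. Ktr \<epsilon> (X i) y = 0) sequentially"
          by eventually_elim (simp add: Ktr_eq)
        moreover have "Ktr \<epsilon> x y = 0" using 2 by (simp add: Ktr_eq)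
        ultimately show ?thesis by (simp add: tendsto_cong[OF ev])
      qed
      then show "(\<lambda>i. Ktr \<epsilon> (X i) y * f y) \<longlonglongrightarrow> Ktr \<epsilon> x y * f y" by (intro tendsto_intros)
    qed
    have "(\<lambda>i. \<integral>y. Ktr \<epsilon> (X i) y * f y \<partial>lebesgue) \<longlonglongrightarrow> (\<integral>y. Ktr \<epsilon> x y * f y \<partial>lebesgue)"
    proof (rule integral_dominated_convergence[OF _ _ _ ae])
      show "integrable lebesgue (\<lambda>y. (c / \<epsilon> ^ DIM('a)) * norm (f y))"
        using f by (intro integrable_mult_right integrable_norm)
      show "AE y in lebesgue. norm (Ktr \<epsilon> (X i) y * f y) \<le> c / \<epsilon> ^ DIM('a) * norm (f y)" for i
        using norm_Ktr_mult[OF e] by (intro AE_I2)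
    qed (use e f in \<open>auto intro!: borel_measurable_times Ktr_measurable borel_measurable_integrable\<close>)
    then show "(T_trunc \<epsilon> f \<circ> X) \<longlonglongrightarrow> T_trunc \<epsilon> f x"
      by (simp add: truncated_integral_Ktr comp_def)
  qed
qed

text \<open>A supremum of continuous functions is lower semicontinuous; this yields measurability
  although the supremum runs over uncountably many \<open>\<epsilon>\<close>.\<close>

lemma open_maximal_singular_integral:
  assumes "integrable lebesgue f"
  shows "open {x. s < T_max f x}"
proof -
  have "{x. s < T_max f x} =
      (\<Union>\<epsilon>\<in>{0<..}. {x. s < ennreal (norm (T_trunc \<epsilon> f x))})"
    by (auto simp: maximal_singular_integral_def less_SUP_iff)
  also have "open \<dots>"
    using assms
    by (intro open_UN ballI open_Collect_less continuous_intros continuous_on_ennreal continuous_truncated_integral) auto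
  finally show ?thesis .
qed

lemma maximal_singular_integral_measurable:
  assumes "integrable lebesgue f"
  shows "T_max f \<in> borel_measurable lebesgue"
proof -
  have "T_max f \<in> borel_measurable borel"
    using open_maximal_singular_integral[OF assms]
    by (intro borel_measurableI_greater) (simp add: borel_open)
  then show ?thesis by (rule borel_measurable_imp_lebesgue)
qed

lemma maximal_singular_integral_le:
  assumes "\<And>\<epsilon>. \<epsilon> > 0 \<Longrightarrow> ennreal (norm (T_trunc \<epsilon> f x)) \<le> B"
  shows "T_max f x \<le> B"
  using assms by (auto simp: maximal_singular_integral_def intro!: SUP_least)

lemma truncated_integral_le_maximal:
  "\<epsilon> > 0 \<Longrightarrow> ennreal (norm (T_trunc \<epsilon> f x)) \<le> T_max f x"
  by (auto simp: maximal_singular_integral_def intro!: SUP_upper)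

section \<open>Sublinearity and invariance under changes on null sets\<close>

lemma truncated_integral_add:
  assumes "\<epsilon> > 0" "integrable lebesgue f" "integrable lebesgue g"
  shows "T_trunc \<epsilon> (\<lambda>y. f y + g y) x = T_trunc \<epsilon> f x + T_trunc \<epsilon> g x"
  using integrable_Ktr[OF assms(1,2)] integrable_Ktr[OF assms(1,3)]
  by (simp add: truncated_integral_Ktr distrib_left)

lemma maximal_singular_integral_add_le:
  assumes "integrable lebesgue f" "integrable lebesgue g"
  shows "T_max (\<lambda>y. f y + g y) x
    \<le> T_max f x + T_max g x"
proof (rule maximal_singular_integral_le)
  fix \<epsilon> :: real assume e: "\<epsilon> > 0"
  have "ennreal (norm (T_trunc \<epsilon> (\<lambda>y. f y + g y) x))
      \<le> ennreal (norm (T_trunc \<epsilon> f x) + norm (T_trunc \<epsilon> g x))"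
    unfolding truncated_integral_add[OF e assms] by (intro ennreal_leI norm_triangle_ineq)
  also have "\<dots> \<le> T_max f x + T_max g x"
    using truncated_integral_le_maximal[OF e, of f x] truncated_integral_le_maximal[OF e, of g x]
    by (simp add: add_mono)
  finally show "ennreal (norm (T_trunc \<epsilon> (\<lambda>y. f y + g y) x))
    \<le> T_max f x + T_max g x" .
qed

lemma truncated_integral_cong_AE:
  assumes "AE y in lebesgue. f y = g y" "f \<in> borel_measurable lebesgue" "g \<in> borel_measurable lebesgue" "\<epsilon> > 0"
  shows "T_trunc \<epsilon> f x = T_trunc \<epsilon> g x"
  unfolding truncated_integral_Ktr using assms
  by (intro integral_cong_AE borel_measurable_times Ktr_measurable) auto

lemma maximal_singular_integral_cong_AE:
  assumes "AE y in lebesgue. f y = g y" "f \<in> borel_measurable lebesgue" "g \<in> borel_measurable lebesgue"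
  shows "T_max f x = T_max g x"
  unfolding maximal_singular_integral_def
  using truncated_integral_cong_AE[OF assms] by (intro SUP_cong) auto

text \<open>The factor \<open>norm (x - z) powr \<delta>\<close> is at most
  \<open>\<rho> powr \<delta>\<close> and cancels the decay of the tail beyond
  \<open>\<rho>\<close>, so the bound is independent of the scale. Both Cotlar's inequality and the
  localisation rest on this estimate.\<close>

lemma smooth_difference:
  fixes f :: "'a \<Rightarrow> complex"
  assumes f [measurable]: "f \<in> borel_measurable lebesgue" and \<rho>: "\<rho> > 0" "2 * norm (x - z) \<le> \<rho>" and \<tau>: "\<tau> \<ge> 0"
    and avg: "\<And>r. r > 0 \<Longrightarrow> mass_on (cball x r) f \<le> ennreal (\<tau> * r ^ DIM('a))"
  shows "(\<integral>\<^sup>+y\<in>{y. norm (x - y) > \<rho>}. ennreal (norm (K x y - K z y) * norm (f y)) \<partial>lebesgue)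
    \<le> ennreal (c * tail_const DIM('a) \<delta> * \<tau>)"
proof -
  let ?n = "DIM('a)" and ?A = "{y. norm (x - y) > \<rho>}"
  let ?d = "norm (x - z) powr \<delta>"
  have d: "?d \<le> \<rho> powr \<delta>"
    using \<rho> delta_pos by (intro powr_mono2) auto
  have pt: "ennreal (norm (K x y - K z y) * norm (f y)) * indicator ?A y \<le>
      ennreal (c * ?d) * (ennreal (1 / norm (x - y) powr (?n + \<delta>)) * ennreal (norm (f y)) * indicator ?A y)" for y
  proof (cases "y \<in> ?A")
    case True
    have "norm (K x y - K z y) * norm (f y) \<le> (c * (?d / norm (x - y) powr (?n + \<delta>))) * norm (f y)"
      using True \<rho> by (intro mult_right_mono smooth_fst) auto
    also have "\<dots> = (c * ?d) * ((1 / norm (x - y) powr (?n + \<delta>)) * norm (f y))" by simp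
    finally show ?thesis
      using True c_pos by (simp add: ennreal_mult'[symmetric])
  qed simp
  have "(\<integral>\<^sup>+y\<in>?A. ennreal (norm (K x y - K z y) * norm (f y)) \<partial>lebesgue)
      \<le> (\<integral>\<^sup>+y. ennreal (c * ?d) * (ennreal (1 / norm (x - y) powr (?n + \<delta>)) * ennreal (norm (f y)) * indicator ?A y) \<partial>lebesgue)"
    using pt by (rule nn_integral_mono)
  also have "\<dots> = ennreal (c * ?d) * (\<integral>\<^sup>+y\<in>?A. ennreal (1 / norm (x - y) powr (?n + \<delta>)) * ennreal (norm (f y)) \<partial>lebesgue)"
    by (intro nn_integral_cmult borel_measurable_times_ennreal borel_measurable_indicator far_sets) measurable
  also have "\<dots> \<le> ennreal (c * ?d) * ennreal (tail_const ?n \<delta> * \<tau> / \<rho> powr \<delta>)"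
    using f by (intro mult_left_mono kernel_tail \<rho> delta_pos \<tau> avg) auto
  also have "\<dots> = ennreal ((c * ?d) * (tail_const ?n \<delta> * \<tau> / \<rho> powr \<delta>))"
    using c_pos by (intro ennreal_mult'[symmetric]) auto
  also have "\<dots> \<le> ennreal (c * tail_const ?n \<delta> * \<tau>)"
  proof (intro ennreal_leI)
    have "(c * ?d) * (tail_const ?n \<delta> * \<tau> / \<rho> powr \<delta>) = (c * tail_const ?n \<delta> * \<tau>) * (?d / \<rho> powr \<delta>)"
      by simp
    also have "\<dots> \<le> (c * tail_const ?n \<delta> * \<tau>) * 1"
      using d \<rho> c_pos \<tau> tail_const_pos[OF delta_pos, of ?n]
      by (intro mult_left_mono) (auto simp: divide_le_eq)
    finally show "(c * ?d) * (tail_const ?n \<delta> * \<tau> / \<rho> powr \<delta>) \<le> c * tail_const ?n \<delta> * \<tau>" by simp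
  qed
  finally show ?thesis .
qed

end

section \<open>Approximation by smooth functions\<close>

text \<open>The flat function \<open>exp (- (1 / t))\<close>, extended by zero, with a polynomial
  factor in \<open>1 / t\<close>: carrying the polynomial along keeps the family closed under
  differentiation.\<close>

definition flat_exp :: "real poly \<Rightarrow> real \<Rightarrow> real" where
  "flat_exp p t = (if t > 0 then poly p (1 / t) * exp (- (1 / t)) else 0)"

lemma poly_mult_exp_minus_tendsto_0: "((\<lambda>s::real. poly p s * exp (- s)) \<longlongrightarrow> 0) at_top"
proof -
  have "((\<lambda>s::real. \<Sum>i\<le>degree p. coeff p i * (s ^ i / exp s)) \<longlongrightarrow> (\<Sum>i\<le>degree p. coeff p i * 0)) at_top"
    by (intro tendsto_sum tendsto_mult tendsto_const tendsto_power_div_exp_0)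
  then show ?thesis
    by (simp add: poly_altdef exp_minus divide_inverse sum_distrib_right mult.assoc)
qed

text \<open>For \<open>t > 0\<close> the chain rule produces \<open>p - pderiv p\<close> at
  \<open>1 / t\<close> and a factor \<open>1 / t\<^sup>2\<close>, which is the polynomial
  \<open>[:0, 0, 1:]\<close> in \<open>1 / t\<close>. At 0 the difference quotient from the right is
  again a polynomial in \<open>1 / h\<close> times the exponential, so it tends to 0.\<close>

lemma flat_exp_deriv:
  "(flat_exp p has_real_derivative flat_exp ((p - pderiv p) * [:0, 0, 1:]) t) (at t)"
proof (cases t "0::real" rule: linorder_cases)
  case greater
  have "((\<lambda>t. poly p (1 / t) * exp (- (1 / t))) has_real_derivative
      poly (pderiv p) (1 / t) * (- (1 / t\<^sup>2)) * exp (- (1 / t)) + poly p (1 / t) * (exp (- (1 / t)) * (1 / t\<^sup>2))) (at t)"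
    using greater
    by (auto intro!: derivative_eq_intros DERIV_chain2[OF poly_DERIV] simp: power2_eq_square)
  also have "poly (pderiv p) (1 / t) * (- (1 / t\<^sup>2)) * exp (- (1 / t)) + poly p (1 / t) * (exp (- (1 / t)) * (1 / t\<^sup>2))
      = flat_exp ((p - pderiv p) * [:0, 0, 1:]) t"
    using greater by (simp add: flat_exp_def algebra_simps power2_eq_square)
  finally show ?thesis
    by (rule has_field_derivative_transform_within_open[where S = "{0<..}"])
      (use greater in \<open>auto simp: flat_exp_def\<close>)
next
  case less
  have "((\<lambda>t. 0) has_real_derivative 0) (at t)" by simp
  then have "(flat_exp p has_real_derivative 0) (at t)"
    by (rule has_field_derivative_transform_within_open[where S = "{..<0}"])
      (use less in \<open>auto simp: flat_exp_def\<close>)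
  then show ?thesis using less by (simp add: flat_exp_def)
next
  case equal
  have "((\<lambda>h. flat_exp p h / h) \<longlongrightarrow> 0) (at 0)"
  proof (rule filterlim_split_at_real)
    have "((\<lambda>h. 0::real) \<longlongrightarrow> 0) (at_left 0)" by simp
    then show "((\<lambda>h. flat_exp p h / h) \<longlongrightarrow> 0) (at_left 0)"
      by (rule tendsto_cong[THEN iffD1, rotated])
        (auto simp: eventually_at_left_field flat_exp_def intro!: exI[of _ "-1"])
    have "((\<lambda>h. poly (p * [:0, 1:]) (inverse h) * exp (- inverse h)) \<longlongrightarrow> 0) (at_right (0::real))"
      by (rule filterlim_compose[OF poly_mult_exp_minus_tendsto_0 filterlim_inverse_at_top_right])
    then show "((\<lambda>h. flat_exp p h / h) \<longlongrightarrow> 0) (at_right 0)"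
      by (rule tendsto_cong[THEN iffD1, rotated])
        (auto simp: eventually_at_right_field flat_exp_def divide_inverse intro!: exI[of _ 1])
  qed
  then have "(flat_exp p has_real_derivative 0) (at 0)"
    by (simp add: DERIV_def flat_exp_def)
  then show ?thesis using equal by (simp add: flat_exp_def)
qed

text \<open>A class of smooth functions that is visibly closed under directional derivatives and contains the
  cut-off functions built from \<open>exp (- 1 / t)\<close>.\<close>

inductive smooth_fun :: "('a::euclidean_space \<Rightarrow> real) \<Rightarrow> bool" where
  linear: "bounded_linear f \<Longrightarrow> smooth_fun f"
| const: "smooth_fun (\<lambda>x. a)"
| add: "smooth_fun f \<Longrightarrow> smooth_fun g \<Longrightarrow> smooth_fun (\<lambda>x. f x + g x)"
| mult: "smooth_fun f \<Longrightarrow> smooth_fun g \<Longrightarrow> smooth_fun (\<lambda>x. f x * g x)"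
| flat_exp: "smooth_fun f \<Longrightarrow> smooth_fun (\<lambda>x. flat_exp p (f x))"

lemma smooth_fun_derivative:
  "smooth_fun f \<Longrightarrow> \<exists>D. (\<forall>x. (f has_derivative D x) (at x)) \<and> (\<forall>v. smooth_fun (\<lambda>x. D x v))"
proof (induction rule: smooth_fun.induct)
  case (linear f)
  then show ?case
    by (intro exI[of _ "\<lambda>x. f"]) (auto intro: bounded_linear_imp_has_derivative smooth_fun.const)
next
  case (const a)
  then show ?case by (intro exI[of _ "\<lambda>x v. 0"]) (auto intro: smooth_fun.const)
next
  case (add f g)
  then obtain D E where "\<forall>x. (f has_derivative D x) (at x)" "\<forall>v. smooth_fun (\<lambda>x. D x v)"
    "\<forall>x. (g has_derivative E x) (at x)" "\<forall>v. smooth_fun (\<lambda>x. E x v)" by blast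
  then show ?case
    by (intro exI[of _ "\<lambda>x v. D x v + E x v"]) (auto intro: has_derivative_add smooth_fun.add)
next
  case (mult f g)
  then obtain D E where "\<forall>x. (f has_derivative D x) (at x)" "\<forall>v. smooth_fun (\<lambda>x. D x v)"
    "\<forall>x. (g has_derivative E x) (at x)" "\<forall>v. smooth_fun (\<lambda>x. E x v)" by blast
  with mult.hyps show ?case
    by (intro exI[of _ "\<lambda>x v. f x * E x v + D x v * g x"])
      (intro conjI allI has_derivative_mult smooth_fun.add[of "\<lambda>x. f x * E x _"] smooth_fun.mult; simp)
next
  case (flat_exp f p)
  then obtain D where D: "\<forall>x. (f has_derivative D x) (at x)" "\<forall>v. smooth_fun (\<lambda>x. D x v)" by blast
  have "((\<lambda>x. flat_exp p (f x)) has_derivative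
      (\<lambda>v. flat_exp ((p - pderiv p) * [:0, 0, 1:]) (f x) * D x v)) (at x)" for x
    using has_derivative_compose[OF D(1)[rule_format, of x]
        flat_exp_deriv[of p "f x", unfolded has_field_derivative_def]] .
  with flat_exp.hyps D(2) show ?case
    by (intro exI[of _ "\<lambda>x v. flat_exp ((p - pderiv p) * [:0, 0, 1:]) (f x) * D x v"])
      (intro conjI allI smooth_fun.mult smooth_fun.flat_exp; simp)
qed

lemma smooth_fun_continuous: "smooth_fun f \<Longrightarrow> continuous_on UNIV f"
  using smooth_fun_derivative[of f] has_derivative_continuous
  by (intro continuous_at_imp_continuous_on) blast

lemma real_polynomial_smooth_fun: "real_polynomial_function f \<Longrightarrow> smooth_fun f"
  by (induction rule: real_polynomial_function.induct) (auto intro: smooth_fun.intros)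

lemma smooth_fun_sum: "(\<And>i. i \<in> I \<Longrightarrow> smooth_fun (f i)) \<Longrightarrow> smooth_fun (\<lambda>x. \<Sum>i\<in>I. f i x)"
  by (induction I rule: infinite_finite_induct) (auto intro: smooth_fun.const smooth_fun.add)

lemma smooth_fun_norm_square: "smooth_fun (\<lambda>y::'a::euclidean_space. (norm (y - x))\<^sup>2)"
proof -
  have "smooth_fun (\<lambda>y. y \<bullet> i + - (x \<bullet> i))" for i
    by (intro smooth_fun.add smooth_fun.const smooth_fun.linear bounded_linear_inner_left)
  then have "smooth_fun (\<lambda>y. \<Sum>i\<in>Basis. (y \<bullet> i + - (x \<bullet> i)) * (y \<bullet> i + - (x \<bullet> i)))"
    by (intro smooth_fun_sum smooth_fun.mult)
  also have "(\<lambda>y. \<Sum>i\<in>Basis. (y \<bullet> i + - (x \<bullet> i)) * (y \<bullet> i + - (x \<bullet> i))) = (\<lambda>y. (norm (y - x))\<^sup>2)"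
  proof
    fix y
    have "(norm (y - x))\<^sup>2 = (\<Sum>i\<in>Basis. ((y - x) \<bullet> i) * ((y - x) \<bullet> i))"
      unfolding power2_norm_eq_inner by (rule euclidean_inner)
    then show "(\<Sum>i\<in>Basis. (y \<bullet> i + - (x \<bullet> i)) * (y \<bullet> i + - (x \<bullet> i))) = (norm (y - x))\<^sup>2"
      by (simp add: inner_diff_left)
  qed
  finally show ?thesis .
qed

lemma smooth_fun_C_k:
  "smooth_fun f \<Longrightarrow> smooth_fun g \<Longrightarrow> C_k k (\<lambda>x. of_real (f x) + \<i> * of_real (g x))"
proof (induction k arbitrary: f g)
  case 0
  then show ?case by (auto intro!: continuous_intros smooth_fun_continuous)
next
  case (Suc k)
  obtain D E where D: "\<And>x. (f has_derivative D x) (at x)" "\<And>v. smooth_fun (\<lambda>x. D x v)"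
    and E: "\<And>x. (g has_derivative E x) (at x)" "\<And>v. smooth_fun (\<lambda>x. E x v)"
    using smooth_fun_derivative[OF Suc.prems(1)] smooth_fun_derivative[OF Suc.prems(2)] by blast
  have der: "((\<lambda>x. complex_of_real (f x) + \<i> * of_real (g x)) has_derivative
      (\<lambda>v. of_real (D x v) + \<i> * of_real (E x v))) (at x)" for x
    by (intro has_derivative_add has_derivative_mult_right has_derivative_of_real D E)
  then have "frechet_derivative (\<lambda>x. complex_of_real (f x) + \<i> * of_real (g x)) (at x)
      = (\<lambda>v. of_real (D x v) + \<i> * of_real (E x v))" for x
    using frechet_derivative_at by metis
  then show ?case
    using der Suc.IH[OF D(2) E(2)] by (auto simp: differentiable_def)
qed

section \<open>Bounded pointwise approximation by polynomials and test functions\<close>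

lemma measurable_limit_continuous:
  fixes q :: "'a::euclidean_space \<Rightarrow> complex"
  assumes "q \<in> borel_measurable lebesgue"
  obtains g where "\<And>m::nat. continuous_on UNIV (g m)" "AE y in lebesgue. (\<lambda>m. g m y) \<longlonglongrightarrow> q y"
proof -
  have "q measurable_on UNIV"
    using assms by (intro lebesgue_measurable_imp_measurable_on) auto
  then obtain N g where "negligible N" "\<And>m. continuous_on UNIV (g m)"
      "\<And>x. x \<notin> N \<Longrightarrow> (\<lambda>m. g m x) \<longlonglongrightarrow> q x"
    unfolding measurable_on_def by auto
  moreover from this have "AE y in lebesgue. (\<lambda>m. g m y) \<longlonglongrightarrow> q y"
    by (intro AE_I'[of N]) (auto simp: negligible_iff_null_sets)
  ultimately show ?thesis using that by blast
qed

text \<open>Continuous approximants of \<open>q\<close> are retracted radially onto the ball of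
  radius \<open>B\<close>, which contains the values of \<open>q\<close>, so the limit is unchanged;
  Stone-Weierstrass on \<open>S\<close> with error \<open>1 / Suc m\<close> then gives polynomials.
  The retraction provides the bound uniform in \<open>m\<close> that dominated convergence
  requires.\<close>

lemma bounded_approximation_by_polynomials:
  fixes q :: "'a::euclidean_space \<Rightarrow> complex"
  assumes q: "q \<in> borel_measurable lebesgue" and B: "B > 0" "\<And>y. norm (q y) \<le> B" and S: "compact S"
  obtains p where "\<And>m::nat. polynomial_function (p m)" "\<And>m y. y \<in> S \<Longrightarrow> norm (p m y) \<le> B + 1"
    "AE y in lebesgue. y \<in> S \<longrightarrow> (\<lambda>m. p m y) \<longlonglongrightarrow> q y"
proof -
  obtain g where g: "\<And>m::nat. continuous_on UNIV (g m)" "AE y in lebesgue. (\<lambda>m. g m y) \<longlonglongrightarrow> q y"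
    by (rule measurable_limit_continuous[OF q]) (rule that, assumption+)
  define cl where "cl w = w /\<^sub>R max 1 (norm w / B)" for w :: complex
  have cl_cont: "continuous_on UNIV cl"
    unfolding cl_def using B(1) by (intro continuous_intros) (auto simp: max_def)
  have cl_norm: "norm (cl w) \<le> B" for w
    using B(1) by (auto simp: cl_def max_def field_simps)
  have cl_q: "cl (q y) = q y" for y
    using B(2)[of y] B(1) by (simp add: cl_def max_def field_simps)
  have "\<exists>p. polynomial_function p \<and> (\<forall>y\<in>S. norm (cl (g m y) - p y) < 1 / Suc m)" for m
    using continuous_on_compose[OF g(1) continuous_on_subset[OF cl_cont]]
    by (intro Stone_Weierstrass_polynomial_function S)
      (auto intro: continuous_on_subset simp: comp_def)
  then obtain p where p: "\<And>m. polynomial_function (p m)" "\<And>m y. y \<in> S \<Longrightarrow> norm (cl (g m y) - p m y) < 1 / Suc m"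
    by metis
  have "norm (p m y) \<le> B + 1" if "y \<in> S" for m y
  proof -
    have "norm (p m y) \<le> norm (cl (g m y)) + norm (cl (g m y) - p m y)"
      by (metis norm_minus_commute norm_triangle_sub)
    moreover have "1 / real (Suc m) \<le> 1" by simp
    ultimately show ?thesis using p(2)[OF that, of m] cl_norm[of "g m y"] by linarith
  qed
  moreover have "AE y in lebesgue. y \<in> S \<longrightarrow> (\<lambda>m. p m y) \<longlonglongrightarrow> q y"
    using g(2)
  proof (rule AE_mp, intro AE_I2 impI)
    fix y assume y: "(\<lambda>m. g m y) \<longlonglongrightarrow> q y" "y \<in> S"
    have "(\<lambda>m. cl (g m y)) \<longlonglongrightarrow> cl (q y)"
      using cl_cont by (intro isCont_tendsto_compose[OF _ y(1)]) (simp add: continuous_on_eq_continuous_at)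
    moreover have "(\<lambda>m. cl (g m y) - p m y) \<longlonglongrightarrow> 0"
      by (rule Lim_null_comparison[OF _ LIMSEQ_Suc[OF lim_1_over_n]])
        (use p(2)[OF y(2)] in \<open>auto intro!: always_eventually less_imp_le\<close>)
    ultimately have "(\<lambda>m. cl (g m y) - (cl (g m y) - p m y)) \<longlonglongrightarrow> cl (q y) - 0"
      by (rule tendsto_diff)
    then show "(\<lambda>m. p m y) \<longlonglongrightarrow> q y" by (simp add: cl_q)
  qed
  ultimately show ?thesis using p(1) that by blast
qed

text \<open>The polynomials approximate \<open>h / \<eta>\<close> for a smooth cut-off \<open>\<eta>\<close> that is merely positive where
  \<open>h\<close> lives, so that no cut-off equal to one is needed.\<close>

lemma annulus_approximation:
  fixes h :: "'a::euclidean_space \<Rightarrow> complex"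
  assumes h: "h \<in> borel_measurable lebesgue" and B: "\<And>y. norm (h y) \<le> B"
    and supp_h: "\<And>y. h y \<noteq> 0 \<Longrightarrow> \<rho> \<le> norm (y - x) \<and> norm (y - x) \<le> R"
    and \<rho>: "0 < \<rho>'" "\<rho>' < \<rho>" and R: "R > 0"
  obtains \<phi> B' where "\<And>m::nat. \<phi> m \<in> Cc_infinity" "\<And>m y. norm (\<phi> m y) \<le> B'"
    "\<And>m y. \<phi> m y \<noteq> 0 \<Longrightarrow> \<rho>' \<le> norm (y - x) \<and> norm (y - x) \<le> R + 1"
    "AE y in lebesgue. (\<lambda>m. \<phi> m y) \<longlonglongrightarrow> h y"
proof -
  define e where "e = flat_exp 1"
  have e: "e t = (if t > 0 then exp (- (1 / t)) else 0)" for t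
    by (simp add: e_def flat_exp_def)
  \<comment> \<open>Squared distances keep \<open>\<eta>\<close> smooth at \<open>x\<close>. Its two
    factors vanish within radius \<open>\<rho>'\<close> and beyond radius \<open>R + 1\<close>
    respectively, which leaves a margin on both sides of the annulus that carries
    \<open>h\<close>.\<close>
  define \<eta> where "\<eta> y = e ((norm (y - x))\<^sup>2 + - \<rho>'\<^sup>2) * e ((R + 1)\<^sup>2 + - 1 * (norm (y - x))\<^sup>2)" for y
  have \<eta>_smooth: "smooth_fun \<eta>"
    unfolding \<eta>_def e_def
    by (intro smooth_fun.mult smooth_fun.flat_exp smooth_fun.add smooth_fun.const smooth_fun_norm_square)
  have e01: "0 \<le> e t" "e t \<le> 1" for t
    by (auto simp: e)
  have \<eta>01: "0 \<le> \<eta> y" "\<eta> y \<le> 1" for y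
    unfolding \<eta>_def using e01 by (auto intro: mult_le_one)
  have \<eta>_supp: "\<rho>' \<le> norm (y - x) \<and> norm (y - x) \<le> R + 1" if "\<eta> y \<noteq> 0" for y
  proof -
    have "\<rho>'\<^sup>2 < (norm (y - x))\<^sup>2" "(norm (y - x))\<^sup>2 < (R + 1)\<^sup>2"
      using that by (auto simp: \<eta>_def e split: if_splits)
    then show ?thesis
      using \<rho> R by (auto intro: power2_less_imp_less less_imp_le dest!: power2_less_imp_less)
  qed
  have e_mono: "e s \<le> e t" if "s \<le> t" for s t
    using that by (auto simp: e frac_le)
  \<comment> \<open>The two factors taken at the extreme radii \<open>\<rho>\<close> and
    \<open>R\<close>: a positive lower bound for \<open>\<eta>\<close> wherever \<open>h\<close>
    does not vanish, which keeps \<open>h / \<eta>\<close> bounded.\<close>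
  define \<kappa> where "\<kappa> = e (\<rho>\<^sup>2 + - \<rho>'\<^sup>2) * e ((R + 1)\<^sup>2 + - 1 * R\<^sup>2)"
  have \<kappa>: "\<kappa> > 0"
  proof -
    have "\<rho>'\<^sup>2 < \<rho>\<^sup>2" "R\<^sup>2 < (R + 1)\<^sup>2" using \<rho> R by (auto intro!: power_strict_mono)
    then show ?thesis by (simp add: \<kappa>_def e)
  qed
  have \<eta>_ge: "\<kappa> \<le> \<eta> y" if "h y \<noteq> 0" for y
  proof -
    have "\<rho>\<^sup>2 \<le> (norm (y - x))\<^sup>2" "(norm (y - x))\<^sup>2 \<le> R\<^sup>2"
      using supp_h[OF that] \<rho> by (auto intro!: power_mono)
    then show ?thesis
      unfolding \<kappa>_def \<eta>_def using e01 by (intro mult_mono e_mono) auto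
  qed
  define q where "q y = h y / of_real (\<eta> y)" for y
  have "\<eta> \<in> borel_measurable lebesgue"
    using smooth_fun_continuous[OF \<eta>_smooth]
    by (intro borel_measurable_imp_lebesgue borel_measurable_continuous_onI)
  then have q_meas: "q \<in> borel_measurable lebesgue"
    unfolding q_def using h by measurable
  define B1 where "B1 = B / \<kappa> + 1"
  have B0: "B \<ge> 0" using B norm_ge_zero order_trans by blast
  have B1: "B1 > 0" using B0 \<kappa> by (simp add: B1_def add_nonneg_pos)
  have q_norm: "norm (q y) \<le> B1" for y
  proof (cases "h y = 0")
    case True
    then show ?thesis using B1 by (simp add: q_def)
  next
    case False
    have "norm (q y) = norm (h y) / \<eta> y" using \<eta>01 by (simp add: q_def norm_divide)
    also have "\<dots> \<le> B / \<kappa>"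
      using B[of y] \<eta>_ge[OF False] \<kappa> B0 by (intro frac_le) auto
    finally show ?thesis by (simp add: B1_def)
  qed
  obtain p where p: "\<And>m::nat. polynomial_function (p m)"
    "\<And>m y. y \<in> cball x (R + 1) \<Longrightarrow> norm (p m y) \<le> B1 + 1"
    "AE y in lebesgue. y \<in> cball x (R + 1) \<longrightarrow> (\<lambda>m. p m y) \<longlonglongrightarrow> q y"
    by (rule bounded_approximation_by_polynomials[OF q_meas B1 q_norm compact_cball]) (rule that, assumption+)
  define \<phi> where "\<phi> m y = of_real (\<eta> y) * p m y" for m y
  have \<phi>_supp: "\<rho>' \<le> norm (y - x) \<and> norm (y - x) \<le> R + 1" if "\<phi> m y \<noteq> 0" for m y
    using that \<eta>_supp[of y] by (auto simp: \<phi>_def)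
  have "\<phi> m \<in> Cc_infinity" for m
  proof -
    have "smooth_fun (\<lambda>y. \<eta> y * Re (p m y))" "smooth_fun (\<lambda>y. \<eta> y * Im (p m y))"
      using p(1)[of m] bounded_linear_Re bounded_linear_Im
      unfolding polynomial_function_def comp_def
      by (intro smooth_fun.mult \<eta>_smooth real_polynomial_smooth_fun; simp)+
    then have "C_k k (\<lambda>y. of_real (\<eta> y * Re (p m y)) + \<i> * of_real (\<eta> y * Im (p m y)))" for k
      by (rule smooth_fun_C_k)
    moreover have "(\<lambda>y. of_real (\<eta> y * Re (p m y)) + \<i> * of_real (\<eta> y * Im (p m y))) = \<phi> m"
      by (auto simp: \<phi>_def complex_eq_iff)
    ultimately have "C_k k (\<phi> m)" for k by simp
    moreover have "{y. \<phi> m y \<noteq> 0} \<subseteq> cball x (R + 1)"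
      using \<phi>_supp by (auto simp: dist_norm norm_minus_commute)
    then have "compact (supp (\<phi> m))"
      unfolding supp_def by (meson bounded_cball bounded_subset compact_closure)
    ultimately show ?thesis by (simp add: Cc_infinity_def)
  qed
  moreover have "norm (\<phi> m y) \<le> B1 + 1" for m y
  proof (cases "\<eta> y = 0")
    case False
    then have "norm (p m y) \<le> B1 + 1"
      using \<eta>_supp[of y] by (intro p(2)) (auto simp: dist_norm norm_minus_commute)
    then have "\<eta> y * norm (p m y) \<le> 1 * (B1 + 1)"
      using \<eta>01 by (intro mult_mono) auto
    then show ?thesis using \<eta>01 by (simp add: \<phi>_def norm_mult)
  qed (use B1 in \<open>simp add: \<phi>_def\<close>)
  moreover have "AE y in lebesgue. (\<lambda>m. \<phi> m y) \<longlonglongrightarrow> h y"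
    using p(3)
  proof (rule AE_mp, intro AE_I2 impI)
    fix y assume y: "y \<in> cball x (R + 1) \<longrightarrow> (\<lambda>m. p m y) \<longlonglongrightarrow> q y"
    show "(\<lambda>m. \<phi> m y) \<longlonglongrightarrow> h y"
    proof (cases "\<eta> y = 0")
      case True
      then have "h y = 0" using \<eta>_ge[of y] \<kappa> by auto
      with True show ?thesis by (simp add: \<phi>_def)
    next
      case False
      then have "y \<in> cball x (R + 1)" using \<eta>_supp[of y] by (auto simp: dist_norm norm_minus_commute)
      with y have "(\<lambda>m. \<phi> m y) \<longlonglongrightarrow> of_real (\<eta> y) * q y"
        unfolding \<phi>_def by (intro tendsto_intros) auto
      then show ?thesis using False by (simp add: q_def)
    qed
  qed
  ultimately show ?thesis using that \<phi>_supp by blast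
qed

section \<open>The kernel representation of the bounded extension\<close>

lemma lebesgue_set_greater [measurable]:
  fixes f :: "'a::euclidean_space \<Rightarrow> ennreal"
  assumes "f \<in> borel_measurable lebesgue"
  shows "{x. t < f x} \<in> sets lebesgue"
proof -
  have "{x. t < f x} = f -` {t<..} \<inter> space lebesgue" by auto
  then show ?thesis using measurable_sets[OF assms, of "{t<..}"] by (simp only: borel_open open_greaterThan)
qed

lemma emeasure_greater_le:
  fixes f :: "'a::euclidean_space \<Rightarrow> ennreal"
  assumes [measurable]: "f \<in> borel_measurable lebesgue" and t: "t > 0"
  shows "emeasure lebesgue {x. ennreal t < f x} \<le> ennreal (1 / t) * (\<integral>\<^sup>+x. f x \<partial>lebesgue)"
proof -
  have m: "{x. ennreal t < f x} \<in> sets lebesgue" by (rule lebesgue_set_greater) measurable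
  have "emeasure lebesgue {x. ennreal t < f x}
      = ennreal (1 / t) * (ennreal t * emeasure lebesgue {x. ennreal t < f x})"
    using t by (simp add: mult.assoc[symmetric] ennreal_mult[symmetric])
  also have "ennreal t * emeasure lebesgue {x. ennreal t < f x}
      = (\<integral>\<^sup>+x. ennreal t * indicator {x. ennreal t < f x} x \<partial>lebesgue)"
    by (rule nn_integral_cmult_indicator[OF m, symmetric])
  also have "\<dots> \<le> (\<integral>\<^sup>+x. f x \<partial>lebesgue)"
    by (intro nn_integral_mono) (auto split: split_indicator)
  finally show ?thesis by (simp add: mult_left_mono)
qed

lemma nn_integral_bounded_on:
  fixes f :: "'a::euclidean_space \<Rightarrow> ennreal"
  assumes "\<And>y. f y \<le> ennreal B * indicator (cball x R) y" "B \<ge> 0" "R \<ge> 0"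
  shows "(\<integral>\<^sup>+y. f y \<partial>lebesgue) \<le> ennreal (B * (unit_ball_vol DIM('a) * R ^ DIM('a)))"
proof -
  have "(\<integral>\<^sup>+y. f y \<partial>lebesgue) \<le> (\<integral>\<^sup>+y. ennreal B * indicator (cball x R) y \<partial>lebesgue)"
    using assms(1) by (rule nn_integral_mono)
  also have "\<dots> = ennreal B * ennreal (unit_ball_vol DIM('a) * R ^ DIM('a))"
    using assms(3) by (simp add: nn_integral_cmult_indicator emeasure_lebesgue_cball)
  finally show ?thesis using assms by (simp add: ennreal_mult)
qed

text \<open>The squared norm with values in \<open>ennreal\<close>, the form to which dominated
  convergence, Fatou's lemma and Chebyshev's inequality apply directly.\<close>

definition L2_sq :: "('a::euclidean_space \<Rightarrow> complex) \<Rightarrow> ennreal" where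
  "L2_sq f = (\<integral>\<^sup>+x. ennreal ((norm (f x))\<^sup>2) \<partial>lebesgue)"

lemma L2_sq_eq: "f \<in> L2 \<Longrightarrow> L2_sq f = ennreal ((L2_norm f)\<^sup>2)"
  unfolding L2_sq_def L2_norm_def L2_def by (subst nn_integral_eq_integral) auto

lemma bounded_support_L2:
  fixes f :: "'a::euclidean_space \<Rightarrow> complex"
  assumes f: "f \<in> borel_measurable lebesgue" and B: "\<And>y. norm (f y) \<le> B" and R: "\<And>y. f y \<noteq> 0 \<Longrightarrow> norm (y - x) \<le> R" "R \<ge> 0"
  shows "f \<in> L2" "integrable lebesgue f"
    "L2_sq f \<le> ennreal (B\<^sup>2 * (unit_ball_vol DIM('a) * R ^ DIM('a)))"
proof -
  have B0: "B \<ge> 0" using B norm_ge_zero order_trans by blast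
  have "ennreal ((norm (f y))\<^sup>2) \<le> ennreal (B\<^sup>2) * indicator (cball x R) y" for y
    using B[of y] R(1)[of y] by (cases "f y = 0") (auto simp: dist_norm norm_minus_commute intro!: ennreal_leI power_mono)
  then show L: "L2_sq f \<le> ennreal (B\<^sup>2 * (unit_ball_vol DIM('a) * R ^ DIM('a)))"
    unfolding L2_sq_def using B0 R(2) by (intro nn_integral_bounded_on) auto
  have "L2_sq f < \<infinity>" using L by (rule order_le_less_trans) simp
  then show "f \<in> L2"
    unfolding L2_def L2_sq_def using f by (auto intro!: integrableI_bounded)
  have "ennreal (norm (f y)) \<le> ennreal B * indicator (cball x R) y" for y
    using B[of y] R(1)[of y] by (cases "f y = 0") (auto simp: dist_norm norm_minus_commute intro!: ennreal_leI)
  then have "mass f \<le> ennreal (B * (unit_ball_vol DIM('a) * R ^ DIM('a)))"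
    using B0 R(2) by (rule nn_integral_bounded_on)
  then have "mass f < \<infinity>" by (rule order_le_less_trans) simp
  then show "integrable lebesgue f" using f by (intro integrableI_bounded)
qed

lemma L2_diff:
  assumes "f \<in> L2" "g \<in> L2"
  shows "(\<lambda>y. f y - g y) \<in> L2"
proof -
  have [measurable]: "f \<in> borel_measurable lebesgue" "g \<in> borel_measurable lebesgue"
    using assms by (auto simp: L2_def)
  have "integrable lebesgue (\<lambda>y. 2 * (norm (f y))\<^sup>2 + 2 * (norm (g y))\<^sup>2)"
    using assms by (auto simp: L2_def)
  then have "integrable lebesgue (\<lambda>y. (norm (f y - g y))\<^sup>2)"
  proof (rule Bochner_Integration.integrable_bound)
    have "(norm (f y - g y))\<^sup>2 \<le> 2 * (norm (f y))\<^sup>2 + 2 * (norm (g y))\<^sup>2" for y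
    proof -
      have "(norm (f y - g y))\<^sup>2 \<le> (norm (f y) + norm (g y))\<^sup>2"
        by (intro power_mono norm_triangle_ineq4) auto
      also have "\<dots> \<le> 2 * (norm (f y))\<^sup>2 + 2 * (norm (g y))\<^sup>2"
        using sum_squares_bound[of "norm (f y)" "norm (g y)"] by (simp add: power2_sum)
      finally show ?thesis .
    qed
    then show "AE y in lebesgue. norm ((norm (f y - g y))\<^sup>2) \<le> norm (2 * (norm (f y))\<^sup>2 + 2 * (norm (g y))\<^sup>2)"
      by simp
  qed measurable
  then show ?thesis by (simp add: L2_def)
qed

text \<open>The operator on test functions is absorbed into \<open>S\<close>: there it agrees almost
  everywhere with its bounded extension, so \<open>S\<close> inherits the kernel formula off the
  support.\<close>

locale cz_operator = cz_kernel K c \<delta> for K :: "'a::euclidean_space \<Rightarrow> 'a \<Rightarrow> complex" and c \<delta> +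
  fixes S :: "('a \<Rightarrow> complex) \<Rightarrow> 'a \<Rightarrow> complex" and CS :: real
  assumes CS_pos: "CS > 0" and S_linear: "ae_linear_on L2 S" and S_L2: "f \<in> L2 \<Longrightarrow> S f \<in> L2"
    and S_bound: "f \<in> L2 \<Longrightarrow> L2_norm (S f) \<le> CS * L2_norm f"
    and S_kernel: "\<phi> \<in> Cc_infinity \<Longrightarrow>
      AE x in lebesgue. x \<notin> supp \<phi> \<longrightarrow> S \<phi> x = (\<integral>y. K x y * \<phi> y \<partial>lebesgue)"
begin

lemma S_measurable: "f \<in> L2 \<Longrightarrow> S f \<in> borel_measurable lebesgue"
  using S_L2 by (auto simp: L2_def)

lemma S_L2_sq: "f \<in> L2 \<Longrightarrow> L2_sq (S f) \<le> ennreal (CS\<^sup>2) * L2_sq f"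
proof -
  assume f: "f \<in> L2"
  have "0 \<le> L2_norm (S f)" by (simp add: L2_norm_def)
  then have "(L2_norm (S f))\<^sup>2 \<le> (CS * L2_norm f)\<^sup>2"
    using S_bound[OF f] by (intro power_mono)
  then show ?thesis
    using f S_L2[OF f] by (simp add: L2_sq_eq power_mult_distrib ennreal_mult[symmetric] ennreal_leI)
qed

lemma S_diff: "f \<in> L2 \<Longrightarrow> g \<in> L2 \<Longrightarrow> AE x in lebesgue. S (\<lambda>y. f y - g y) x = S f x - S g x"
proof -
  assume "f \<in> L2" "g \<in> L2"
  then have "AE x in lebesgue. S (\<lambda>y. 1 * f y + (- 1) * g y) x = 1 * S f x + (- 1) * S g x"
    using S_linear unfolding ae_linear_on_def by blast
  then show ?thesis by simp
qed

text \<open>If \<open>z\<close> keeps a distance greater than \<open>d\<close> from where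
  \<open>h\<close> is nonzero, the singular kernel may be replaced by its truncation, which is
  bounded and measurable.\<close>

lemma Ktr_eq_kernel_on:
  assumes "norm (z - x) \<le> s" "h y \<noteq> 0 \<Longrightarrow> norm (y - x) > s + d" 
  shows "K z y * h y = Ktr d z y * h y"
proof (cases "h y = 0")
  case False
  have "norm (y - x) \<le> norm (z - y) + norm (z - x)"
    using norm_triangle_ineq[of "y - z" "z - x"] by (simp add: norm_minus_commute)
  with assms(1) assms(2)[OF False] have "norm (z - y) > d" by linarith
  then show ?thesis by (simp add: Ktr_eq)
qed simp

text \<open>Fatou's lemma replaces the passage to an almost everywhere convergent subsequence of
  \<open>S \<phi>\<^sub>m\<close>.\<close>

proposition S_kernel_representation:
  assumes h: "h \<in> borel_measurable lebesgue" and B: "\<And>y. norm (h y) \<le> B"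
    and supp_h: "\<And>y. h y \<noteq> 0 \<Longrightarrow> \<rho> \<le> norm (y - x) \<and> norm (y - x) \<le> R"
    and \<rho>: "0 < \<rho>'" "\<rho>' < \<rho>" and R: "R > 0"
  shows "AE z in lebesgue. norm (z - x) < \<rho>' \<longrightarrow> S h z = (\<integral>y. K z y * h y \<partial>lebesgue)"
proof -
  \<comment> \<open>The test functions live outside radius \<open>\<rho>1\<close>, strictly between
    \<open>\<rho>'\<close> and \<open>\<rho>\<close>. The leftover gap gives a distance
    \<open>d\<close> between every admissible \<open>z\<close> and all their supports, uniform in
    \<open>m\<close>.\<close>
  define \<rho>1 where "\<rho>1 = (\<rho>' + \<rho>) / 2"
  define d where "d = (\<rho>1 - \<rho>') / 2"
  have \<rho>1: "0 < \<rho>1" "\<rho>' < \<rho>1" "\<rho>1 < \<rho>" and d: "d > 0" "\<rho>' + d < \<rho>1"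
    using \<rho> by (auto simp: \<rho>1_def d_def field_simps)
  obtain \<phi> B' where \<phi>: "\<And>m::nat. \<phi> m \<in> Cc_infinity" and B': "\<And>m y. norm (\<phi> m y) \<le> B'"
    and \<phi>_supp: "\<And>m y. \<phi> m y \<noteq> 0 \<Longrightarrow> \<rho>1 \<le> norm (y - x) \<and> norm (y - x) \<le> R + 1"
    and \<phi>_lim: "AE y in lebesgue. (\<lambda>m. \<phi> m y) \<longlonglongrightarrow> h y"
    by (rule annulus_approximation[OF h B supp_h \<rho>1(1,3) R]) (assumption, rule that, assumption+)
  have \<phi>_meas: "\<phi> m \<in> borel_measurable lebesgue" for m
  proof -
    have "C_k 0 (\<phi> m)" using \<phi>[of m] unfolding Cc_infinity_def by blast
    then show ?thesis
      by (intro borel_measurable_imp_lebesgue borel_measurable_continuous_onI) simp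
  qed
  have \<phi>_L2: "\<phi> m \<in> L2" "integrable lebesgue (\<phi> m)" for m
    using bounded_support_L2(1,2)[OF \<phi>_meas B', of m x "R + 1"] \<phi>_supp R by auto
  have h_L2: "h \<in> L2" "integrable lebesgue h"
    using bounded_support_L2(1,2)[OF h B, of x R] supp_h R by auto
  have BB: "B \<ge> 0" "B' \<ge> 0" using B B' norm_ge_zero order_trans by blast+
  have near: "z \<notin> supp (\<phi> m)" if "norm (z - x) < \<rho>'" for z m
  proof -
    have "supp (\<phi> m) \<subseteq> {y. \<rho>1 \<le> norm (y - x)}"
      unfolding supp_def
      by (rule closure_minimal) (use \<phi>_supp in \<open>auto intro!: closed_Collect_le continuous_intros\<close>)
    then show ?thesis using that \<rho>1 by force
  qed
  have repr: "AE z in lebesgue. \<forall>m. z \<notin> supp (\<phi> m) \<longrightarrow> S (\<phi> m) z = (\<integral>y. K z y * \<phi> m y \<partial>lebesgue)"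
    using S_kernel[OF \<phi>] by (simp add: AE_all_countable)
  have conv: "(\<lambda>m. \<integral>y. K z y * \<phi> m y \<partial>lebesgue) \<longlonglongrightarrow> (\<integral>y. K z y * h y \<partial>lebesgue)" if z: "norm (z - x) < \<rho>'" for z
  proof -
    have eq: "K z y * \<phi> m y = Ktr d z y * \<phi> m y" "K z y * h y = Ktr d z y * h y" for m y
    proof -
      show "K z y * \<phi> m y = Ktr d z y * \<phi> m y"
        by (rule Ktr_eq_kernel_on[of z x \<rho>' "\<phi> m"]) (use z \<phi>_supp[of m y] d in linarith)+
      show "K z y * h y = Ktr d z y * h y"
        by (rule Ktr_eq_kernel_on[of z x \<rho>' h]) (use z supp_h[of y] d \<rho>1 in linarith)+
    qed
    show ?thesis
      unfolding eq
    proof (rule integral_dominated_convergence)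
      show "AE y in lebesgue. (\<lambda>m. Ktr d z y * \<phi> m y) \<longlonglongrightarrow> Ktr d z y * h y"
        using \<phi>_lim by (rule AE_mp) (auto intro!: AE_I2 tendsto_intros)
      have "integrable lebesgue (indicator (cball x (R + 1)) :: 'a \<Rightarrow> real)"
        using emeasure_lebesgue_cball[of "R + 1" x] R by (intro integrable_real_indicator) auto
      then show "integrable lebesgue (\<lambda>y. c / d ^ DIM('a) * (B' * indicator (cball x (R + 1)) y))"
        by (intro integrable_mult_right) auto
      fix m
      have "norm (Ktr d z y * \<phi> m y) \<le> c / d ^ DIM('a) * (B' * indicator (cball x (R + 1)) y)" for y
      proof -
        have "norm (\<phi> m y) \<le> B' * indicator (cball x (R + 1)) y"
          using \<phi>_supp[of m y] B'[of m y] by (cases "\<phi> m y = 0") (auto simp: BB dist_norm norm_minus_commute)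
        then show ?thesis
          using norm_Ktr_mult[OF d(1), of z y "\<phi> m y"] c_pos d
          by (meson divide_nonneg_nonneg less_imp_le mult_left_mono order_trans zero_le_power)
      qed
      then show "AE y in lebesgue. norm (Ktr d z y * \<phi> m y) \<le> c / d ^ DIM('a) * (B' * indicator (cball x (R + 1)) y)"
        by simp
    qed (use h \<phi>_meas d in \<open>auto intro!: borel_measurable_times Ktr_measurable\<close>)
  qed
  have "(\<lambda>m. L2_sq (\<lambda>y. \<phi> m y - h y)) \<longlonglongrightarrow> L2_sq (\<lambda>y::'a. 0)"
    unfolding L2_sq_def
  proof (rule nn_integral_dominated_convergence)
    show "(\<lambda>y. ennreal ((norm (\<phi> m y - h y))\<^sup>2)) \<in> borel_measurable lebesgue" for m
      using h \<phi>_meas[of m] by measurable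
    show "(\<lambda>y. ennreal ((B' + B)\<^sup>2) * indicator (cball x (R + 1)) y) \<in> borel_measurable lebesgue"
      by (intro borel_measurable_times_ennreal borel_measurable_indicator) auto
    show "(\<integral>\<^sup>+y. ennreal ((B' + B)\<^sup>2) * indicator (cball x (R + 1)) y \<partial>lebesgue) < \<infinity>"
      using R by (simp add: nn_integral_cmult_indicator emeasure_lebesgue_cball ennreal_mult_less_top)
    show "AE y in lebesgue. (\<lambda>m. ennreal ((norm (\<phi> m y - h y))\<^sup>2)) \<longlonglongrightarrow> ennreal ((norm (0::complex))\<^sup>2)"
      using \<phi>_lim
    proof (rule AE_mp, intro AE_I2 impI)
      fix y assume y: "(\<lambda>m. \<phi> m y) \<longlonglongrightarrow> h y"
      have "(\<lambda>m. ennreal ((norm (\<phi> m y - h y))\<^sup>2)) \<longlonglongrightarrow> ennreal ((norm (h y - h y))\<^sup>2)"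
        by (intro tendsto_intros y)
      then show "(\<lambda>m. ennreal ((norm (\<phi> m y - h y))\<^sup>2)) \<longlonglongrightarrow> ennreal ((norm (0::complex))\<^sup>2)" by simp
    qed
    fix m
    have "ennreal ((norm (\<phi> m y - h y))\<^sup>2) \<le> ennreal ((B' + B)\<^sup>2) * indicator (cball x (R + 1)) y" for y
    proof (cases "\<phi> m y = 0 \<and> h y = 0")
      case False
      then have "y \<in> cball x (R + 1)"
        using \<phi>_supp[of m y] supp_h[of y] by (auto simp: dist_norm norm_minus_commute)
      moreover have "norm (\<phi> m y - h y) \<le> B' + B"
        using B[of y] B'[of m y] norm_triangle_ineq4[of "\<phi> m y" "h y"] by linarith
      ultimately show ?thesis by (auto intro!: ennreal_leI power_mono)
    qed simp
    then show "AE y in lebesgue. ennreal ((norm (\<phi> m y - h y))\<^sup>2) \<le> ennreal ((B' + B)\<^sup>2) * indicator (cball x (R + 1)) y"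
      by simp
  qed simp
  then have lim0: "(\<lambda>m. ennreal (CS\<^sup>2) * L2_sq (\<lambda>y. \<phi> m y - h y)) \<longlonglongrightarrow> ennreal (CS\<^sup>2) * 0"
    by (intro ennreal_tendsto_cmult) (simp_all add: L2_sq_def)
  have le: "L2_sq (\<lambda>z. S (\<phi> m) z - S h z) \<le> ennreal (CS\<^sup>2) * L2_sq (\<lambda>y. \<phi> m y - h y)" for m
  proof -
    have "L2_sq (\<lambda>z. S (\<phi> m) z - S h z) = L2_sq (S (\<lambda>y. \<phi> m y - h y))"
      unfolding L2_sq_def using S_diff[OF \<phi>_L2(1)[of m] h_L2(1)]
      by (intro nn_integral_cong_AE) auto
    also have "\<dots> \<le> ennreal (CS\<^sup>2) * L2_sq (\<lambda>y. \<phi> m y - h y)"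
      by (intro S_L2_sq L2_diff \<phi>_L2 h_L2)
    finally show ?thesis .
  qed
  define u where "u m z = ennreal ((norm (S (\<phi> m) z - S h z))\<^sup>2)" for m z
  have [measurable]: "S h \<in> borel_measurable lebesgue" "\<And>m. S (\<phi> m) \<in> borel_measurable lebesgue"
    using S_measurable h_L2 \<phi>_L2 by auto
  have u_meas [measurable]: "u m \<in> borel_measurable lebesgue" for m unfolding u_def by measurable
  have u_int: "(\<integral>\<^sup>+z. u m z \<partial>lebesgue) = L2_sq (\<lambda>z. S (\<phi> m) z - S h z)" for m
    by (simp add: u_def L2_sq_def)
  have "(\<lambda>m. \<integral>\<^sup>+z. u m z \<partial>lebesgue) \<longlonglongrightarrow> 0"
    by (rule tendsto_sandwich[OF _ _ tendsto_const lim0[simplified]]) (use le in \<open>auto simp: u_int\<close>)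
  then have "liminf (\<lambda>m. \<integral>\<^sup>+z. u m z \<partial>lebesgue) = 0"
    by (intro lim_imp_Liminf) auto
  then have "(\<integral>\<^sup>+z. liminf (\<lambda>m. u m z) \<partial>lebesgue) = 0"
    using nn_integral_liminf[of u lebesgue] u_meas by (metis le_zero_eq)
  then have "AE z in lebesgue. liminf (\<lambda>m. u m z) = 0"
    by (subst (asm) nn_integral_0_iff_AE) measurable
  with repr show ?thesis
  proof eventually_elim
    case (elim z)
    show ?case
    proof
      assume z: "norm (z - x) < \<rho>'"
      \<comment> \<open>The kernel integrals converge at this \<open>z\<close>, so
        \<open>u m z\<close> has a limit; since the lower limit is 0, so is the limit.\<close>
      have "(\<lambda>m. S (\<phi> m) z) \<longlonglongrightarrow> (\<integral>y. K z y * h y \<partial>lebesgue)"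
        using conv[OF z] elim(1) near[OF z] by simp
      then have "(\<lambda>m. u m z) \<longlonglongrightarrow> ennreal ((norm ((\<integral>y. K z y * h y \<partial>lebesgue) - S h z))\<^sup>2)"
        unfolding u_def by (intro tendsto_intros)
      then have "liminf (\<lambda>m. u m z) = ennreal ((norm ((\<integral>y. K z y * h y \<partial>lebesgue) - S h z))\<^sup>2)"
        by (intro lim_imp_Liminf) auto
      with elim(2) have "(norm ((\<integral>y. K z y * h y \<partial>lebesgue) - S h z))\<^sup>2 \<le> 0"
        by (simp add: ennreal_eq_0_iff)
      then show "S h z = (\<integral>y. K z y * h y \<partial>lebesgue)" by simp
    qed
  qed
qed

end

section \<open>Cotlar's inequality for bounded functions\<close>

lemma lebesgue_set_greater_real:
  fixes f :: "'a::euclidean_space \<Rightarrow> real"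
  assumes "f \<in> borel_measurable lebesgue"
  shows "{x. t < f x} \<in> sets lebesgue"
proof -
  have "{x. t < f x} = f -` {t<..} \<inter> space lebesgue" by auto
  then show ?thesis using measurable_sets[OF assms, of "{t<..}"] by (simp only: borel_open open_greaterThan)
qed

context cz_operator begin

definition C_smooth :: real where "C_smooth = c * tail_const DIM('a) \<delta> * unit_ball_vol DIM('a)"

text \<open>Three contributions, in units of \<open>B\<close>: \<open>C_smooth\<close> for moving
  the evaluation point, \<open>CS * 2 ^ DIM('a) * 2 + 1\<close> for \<open>S g1\<close> outside a
  set filling at most half of the ball, and 1 for \<open>S g\<close> itself.\<close>

definition C_cotlar :: real where "C_cotlar = C_smooth + (CS * 2 ^ DIM('a) * 2 + 2)"

lemma C_smooth_pos: "C_smooth > 0"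
  using c_pos tail_const_pos[OF delta_pos, of "DIM('a)"] by (simp add: C_smooth_def)

lemma C_cotlar_pos: "C_cotlar > 0"
  using C_smooth_pos CS_pos by (simp add: C_cotlar_def add_pos_pos)

lemma bounded_ball_average:
  assumes "\<And>y. norm (g y) \<le> B" "r > 0"
  shows "mass_on (cball (x::'a) r) g
    \<le> ennreal (unit_ball_vol DIM('a) * B * r ^ DIM('a))"
proof -
  have B: "B \<ge> 0" using assms(1) norm_ge_zero order_trans by blast
  have "ennreal (norm (g y)) * indicator (cball x r) y \<le> ennreal B * indicator (cball x r) y" for y
    using assms(1) by (intro mult_right_mono ennreal_leI) auto
  then have "mass_on (cball x r) g
      \<le> ennreal (B * (unit_ball_vol DIM('a) * r ^ DIM('a)))"
    using B assms(2) by (intro nn_integral_bounded_on) auto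
  then show ?thesis by (simp add: mult_ac)
qed

text \<open>Cotlar's inequality for bounded \<open>g\<close>: on a small ball around \<open>x\<close> the truncation is compared with
  \<open>S g - S g1\<close>, where \<open>g1\<close> is the local part, and \<open>S g1\<close> is small on half of the ball by the
  \<open>L\<^sup>2\<close> bound.\<close>

proposition cotlar_bounded:
  assumes g: "g \<in> borel_measurable lebesgue" and B: "B > 0" "\<And>y. norm (g y) \<le> B"
    and supp_g: "\<And>y. g y \<noteq> 0 \<Longrightarrow> norm (y - x0) \<le> R0"
    and big: "ennreal (C_cotlar * B) < T_max g x"
  shows "x \<in> maximal_set (indicator {z. norm (S g z) > B}) (unit_ball_vol DIM('a) / 3)"
proof -
  let ?n = "DIM('a)" and ?w = "unit_ball_vol (real DIM('a))"
  have w: "?w > 0" by simp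
  obtain \<epsilon> where e: "\<epsilon> > 0" and "ennreal (C_cotlar * B) < ennreal (norm (T_trunc \<epsilon> g x))"
    using big by (auto simp: maximal_singular_integral_def less_SUP_iff)
  then have big_e: "C_cotlar * B < norm (T_trunc \<epsilon> g x)"
    using C_cotlar_pos B by (simp add: ennreal_less_iff)
  \<comment> \<open>Chosen so that \<open>CS\<^sup>2 * 2 ^ DIM('a) / s\<^sup>2 \<le> 1 / 2\<close>:
    by Chebyshev the set where \<open>S g1\<close> exceeds \<open>s * B\<close> then has at most
    half the measure of the ball of radius \<open>r\<close>. The power of 2 is the volume ratio of
    the balls of radii \<open>\<epsilon>\<close> and \<open>r\<close>.\<close>
  define s where "s = CS * 2 ^ ?n * 2 + 1"
  have s: "s > 0" using CS_pos by (simp add: s_def add_pos_pos)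
  \<comment> \<open>Half the truncation radius: \<open>g2\<close> vanishes within
    \<open>\<epsilon>\<close> of \<open>x\<close>, so for \<open>z\<close> within \<open>r\<close>
    the smoothness of the kernel applies on all of its support.\<close>
  define r where "r = \<epsilon> / 2"
  have r: "r > 0" using e by (simp add: r_def)
  define R where "R = \<bar>R0\<bar> + norm (x0 - x) + 1"
  have R: "R > 0" by (simp add: R_def add_nonneg_pos)
  have gR: "norm (y - x) \<le> R" if "g y \<noteq> 0" for y
    using supp_g[OF that] norm_triangle_ineq[of "y - x0" "x0 - x"] by (simp add: R_def)
  define g2 where "g2 y = (if norm (x - y) > \<epsilon> then g y else 0)" for y
  define g1 where "g1 y = g y - g2 y" for y
  have g2_ind: "g2 = (\<lambda>y. indicator {y. norm (x - y) > \<epsilon>} y *\<^sub>R g y)"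
    by (auto simp: g2_def)
  have g2_meas: "g2 \<in> borel_measurable lebesgue"
    unfolding g2_ind using g by (intro borel_measurable_scaleR borel_measurable_indicator far_sets)
  have g1_meas: "g1 \<in> borel_measurable lebesgue"
    unfolding g1_def using g g2_meas by (intro borel_measurable_diff)
  have g1_eq: "g1 y = (if norm (x - y) > \<epsilon> then 0 else g y)" for y by (simp add: g1_def g2_def)
  have g2_B: "norm (g2 y) \<le> B" and g1_B: "norm (g1 y) \<le> B" for y
    using B by (auto simp: g2_def g1_eq less_imp_le)
  have g2_supp: "\<epsilon> \<le> norm (y - x) \<and> norm (y - x) \<le> R" if "g2 y \<noteq> 0" for y
    using that gR[of y] by (auto simp: g2_def norm_minus_commute split: if_splits)
  have g1_supp: "norm (y - x) \<le> \<epsilon>" if "g1 y \<noteq> 0" for y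
    using that by (auto simp: g1_eq norm_minus_commute split: if_splits)
  have gL: "g \<in> L2" "integrable lebesgue g"
    using bounded_support_L2(1,2)[OF g B(2), of x R] gR R by auto
  have g2L: "g2 \<in> L2" "integrable lebesgue g2"
    using bounded_support_L2(1,2)[OF g2_meas g2_B, of x R] g2_supp R by auto
  have g1L: "g1 \<in> L2" "L2_sq g1 \<le> ennreal (B\<^sup>2 * (?w * \<epsilon> ^ ?n))"
    using bounded_support_L2(1,3)[OF g1_meas g1_B, of x \<epsilon>] g1_supp e by auto
  have repr: "AE z in lebesgue. norm (z - x) < r \<longrightarrow> S g2 z = (\<integral>y. K z y * g2 y \<partial>lebesgue)"
    using e R by (intro S_kernel_representation[OF g2_meas g2_B g2_supp]) (auto simp: r_def)
  have add: "AE z in lebesgue. S g1 z = S g z - S g2 z"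
    unfolding g1_def by (rule S_diff[OF gL(1) g2L(1)])
  have close: "norm (T_trunc \<epsilon> g x - (\<integral>y. K z y * g2 y \<partial>lebesgue)) \<le> C_smooth * B"
    if z: "norm (z - x) < r" for z
  proof -
    have "K z y * g2 y = Ktr (r / 2) z y * g2 y" for y
      using z g2_supp[of y] r by (intro Ktr_eq_kernel_on[of z x r]) (auto simp: r_def)
    then have eq: "(\<lambda>y. K z y * g2 y) = (\<lambda>y. Ktr (r / 2) z y * g2 y)" ..
    have int: "integrable lebesgue (\<lambda>y. K z y * g2 y)"
      unfolding eq using r by (intro integrable_Ktr g2L) auto
    have "T_trunc \<epsilon> g x - (\<integral>y. K z y * g2 y \<partial>lebesgue)
        = (\<integral>y. Ktr \<epsilon> x y * g y - K z y * g2 y \<partial>lebesgue)"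
      unfolding truncated_integral_Ktr
      using integrable_Ktr[OF e gL(2), of x] int by (intro Bochner_Integration.integral_diff[symmetric])
    then have "ennreal (norm (T_trunc \<epsilon> g x - (\<integral>y. K z y * g2 y \<partial>lebesgue)))
        \<le> (\<integral>\<^sup>+y. ennreal (norm (Ktr \<epsilon> x y * g y - K z y * g2 y)) \<partial>lebesgue)"
      using norm_integral_le_nn_integral[of lebesgue "\<lambda>y. Ktr \<epsilon> x y * g y - K z y * g2 y"] by simp
    also have "\<dots> = (\<integral>\<^sup>+y\<in>{y. norm (x - y) > \<epsilon>}. ennreal (norm (K x y - K z y) * norm (g y)) \<partial>lebesgue)"
      by (intro nn_integral_cong) (auto simp: Ktr_eq g2_def norm_mult[symmetric] left_diff_distrib split: split_indicator)
    also have "\<dots> \<le> ennreal (c * tail_const ?n \<delta> * (?w * B))"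
      using z B by (intro smooth_difference[OF g e]) (auto simp: r_def norm_minus_commute intro!: bounded_ball_average)
    finally show ?thesis
      using C_smooth_pos B by (simp add: C_smooth_def mult_ac ennreal_le_iff)
  qed
  let ?Z = "{z. ennreal ((s * B)\<^sup>2) < ennreal ((norm (S g1 z))\<^sup>2)}"
  let ?G = "{z. norm (S g z) > B}"
  have S_meas [measurable]: "S g \<in> borel_measurable lebesgue" "S g1 \<in> borel_measurable lebesgue"
    using S_measurable gL g1L by auto
  have Zm: "?Z \<in> sets lebesgue" by (rule lebesgue_set_greater) measurable
  have Gm: "?G \<in> sets lebesgue"
    by (rule lebesgue_set_greater_real) measurable
  have cGm: "cball x r \<inter> ?G \<in> sets lebesgue"
    by (intro sets.Int Gm sets_lebesgue_borel) simp
  have small: "emeasure lebesgue ?Z \<le> ennreal (?w * r ^ ?n / 2)"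
  proof -
    have "emeasure lebesgue ?Z \<le> ennreal (1 / (s * B)\<^sup>2) * L2_sq (S g1)"
      unfolding L2_sq_def using s B by (intro emeasure_greater_le) auto
    also have "\<dots> \<le> ennreal (1 / (s * B)\<^sup>2) * (ennreal (CS\<^sup>2) * ennreal (B\<^sup>2 * (?w * \<epsilon> ^ ?n)))"
      by (intro mult_left_mono order_trans[OF S_L2_sq[OF g1L(1)]] g1L(2)) auto
    also have "\<dots> = ennreal (1 / (s * B)\<^sup>2 * (CS\<^sup>2 * (B\<^sup>2 * (?w * \<epsilon> ^ ?n))))"
      using e by (simp add: ennreal_mult[symmetric])
    also have "1 / (s * B)\<^sup>2 * (CS\<^sup>2 * (B\<^sup>2 * (?w * \<epsilon> ^ ?n))) = (CS\<^sup>2 * 2 ^ ?n / s\<^sup>2) * (?w * r ^ ?n)"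
      using B by (simp add: r_def power_mult_distrib power_divide)
    also have "ennreal \<dots> \<le> ennreal (1 / 2 * (?w * r ^ ?n))"
    proof (intro ennreal_leI mult_right_mono)
      have "(1::real) \<le> 2 ^ ?n * 2" using one_le_power[of "2::real" ?n] by linarith
      then have "(2 ^ ?n * 2 :: real) \<le> (2 ^ ?n * 2)\<^sup>2" by (intro self_le_power) auto
      then have "CS\<^sup>2 * (2 ^ ?n * 2) \<le> CS\<^sup>2 * (2 ^ ?n * 2)\<^sup>2" by (intro mult_left_mono) auto
      then have "CS\<^sup>2 * 2 ^ ?n * 2 \<le> (CS * 2 ^ ?n * 2)\<^sup>2"
        by (simp only: power_mult_distrib mult.assoc)
      also have "(CS * 2 ^ ?n * 2)\<^sup>2 \<le> s\<^sup>2" using CS_pos by (intro power_mono) (auto simp: s_def)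
      finally show "CS\<^sup>2 * 2 ^ ?n / s\<^sup>2 \<le> 1 / 2" using s by (simp add: field_simps)
    qed (use w r in auto)
    finally show ?thesis by simp
  qed
  \<comment> \<open>The representation of \<open>S g2\<close> is available on the open ball only;
    the bounding sphere is discarded as a null set.\<close>
  have "AE z in lebesgue. z \<notin> sphere x r"
    using negligible_sphere[of x r] by (intro AE_not_in) (simp add: negligible_iff_null_sets)
  then have "AE z in lebesgue. z \<in> cball x r \<longrightarrow> z \<in> (cball x r \<inter> ?G) \<union> ?Z"
    using repr add
  proof eventually_elim
    case (elim z)
    show ?case
    proof
      assume "z \<in> cball x r"
      with elim(1) have z: "norm (z - x) < r" "z \<in> cball x r" by (auto simp: dist_norm norm_minus_commute)
      show "z \<in> (cball x r \<inter> ?G) \<union> ?Z"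
      proof (rule ccontr)
        assume "z \<notin> (cball x r \<inter> ?G) \<union> ?Z"
        then have "norm (S g z) \<le> B" and "ennreal ((norm (S g1 z))\<^sup>2) \<le> ennreal ((s * B)\<^sup>2)"
          using z by (auto simp: not_less)
        then have S1: "norm (S g1 z) \<le> s * B"
          using s B by (simp add: ennreal_le_iff power2_le_iff_abs_le)
        have "norm (T_trunc \<epsilon> g x)
            \<le> norm (T_trunc \<epsilon> g x - (\<integral>y. K z y * g2 y \<partial>lebesgue)) + norm (S g2 z)"
          using elim(2) z(1) norm_triangle_sub[of "T_trunc \<epsilon> g x" "S g2 z"] by (simp add: add.commute)
        also have "\<dots> \<le> C_smooth * B + (norm (S g z) + norm (S g1 z))"
          using close[OF z(1)] norm_triangle_ineq4[of "S g z" "S g1 z"] elim(3) by (intro add_mono) auto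
        also have "\<dots> \<le> C_smooth * B + (B + s * B)" using S1 \<open>norm (S g z) \<le> B\<close> by simp
        also have "\<dots> = C_cotlar * B" by (simp add: C_cotlar_def s_def algebra_simps)
        finally show False using big_e B by simp
      qed
    qed
  qed
  then have "emeasure lebesgue (cball x r) \<le> emeasure lebesgue ((cball x r \<inter> ?G) \<union> ?Z)"
    by (rule emeasure_mono_AE) (intro sets.Un Zm cGm)
  also have "\<dots> \<le> emeasure lebesgue (cball x r \<inter> ?G) + emeasure lebesgue ?Z"
    by (intro emeasure_subadditive cGm Zm)
  finally have le: "ennreal (?w * r ^ ?n) \<le> emeasure lebesgue (cball x r \<inter> ?G) + ennreal (?w * r ^ ?n / 2)"
    using add_left_mono[OF small, of "emeasure lebesgue (cball x r \<inter> ?G)"]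
    unfolding emeasure_lebesgue_cball[OF less_imp_le[OF r]] by (rule order_trans)
  \<comment> \<open>At least half of the ball lies in \<open>?G\<close>; the fraction one third
    leaves room for the strict inequality in \<open>maximal_set\<close>.\<close>
  have "ennreal (?w / 3 * r ^ ?n) < emeasure lebesgue (cball x r \<inter> ?G)"
  proof (rule ccontr)
    assume "\<not> ?thesis"
    then have "emeasure lebesgue (cball x r \<inter> ?G) \<le> ennreal (?w / 3 * r ^ ?n)" by (simp add: not_less)
    with le have "ennreal (?w * r ^ ?n) \<le> ennreal (?w / 3 * r ^ ?n) + ennreal (?w * r ^ ?n / 2)"
      by (meson add_right_mono order_trans)
    also have "\<dots> = ennreal (?w / 3 * r ^ ?n + ?w * r ^ ?n / 2)"
      using w r by (intro ennreal_plus[symmetric]) auto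
    finally have "?w * r ^ ?n \<le> ?w / 3 * r ^ ?n + ?w * r ^ ?n / 2"
      using w r by (subst (asm) ennreal_le_iff) auto
    moreover have "?w * r ^ ?n > 0" using w r by simp
    moreover have "?w / 3 * r ^ ?n = ?w * r ^ ?n / 3" by simp
    ultimately show False by linarith
  qed
  also have "emeasure lebesgue (cball x r \<inter> ?G) = (\<integral>\<^sup>+y\<in>cball x r. indicator ?G y \<partial>lebesgue)"
    unfolding nn_integral_indicator[OF cGm, symmetric]
    by (intro nn_integral_cong) (simp split: split_indicator)
  finally show ?thesis
    using r by (auto simp: maximal_set_def)
qed

text \<open>Cotlar's inequality reduces the claim to the maximal function of the indicator of
  \<open>{z. norm (S g z) > B}\<close>, and Chebyshev bounds the measure of that set by the
  \<open>L2\<close> norm. As \<open>g\<close> is bounded by \<open>B\<close>, its squared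
  \<open>L2\<close> norm is at most \<open>B\<close> times its mass, which turns the
  \<open>L2\<close> bound into an estimate in \<open>L1\<close>.\<close>

proposition good_part_weak_type:
  assumes g: "g \<in> borel_measurable lebesgue" and B: "B > 0" "\<And>y. norm (g y) \<le> B"
    and supp_g: "\<And>y. g y \<noteq> 0 \<Longrightarrow> norm (y - x0) \<le> R0"
  shows "emeasure lebesgue {x. ennreal (C_cotlar * B) < T_max g x}
    \<le> ennreal (3 * 5 ^ DIM('a) * CS\<^sup>2 / B) * mass g"
proof -
  let ?n = "DIM('a)" and ?w = "unit_ball_vol (real DIM('a))"
  have w: "?w > 0" by simp
  let ?G = "{z. norm (S g z) > B}"
  have gL: "g \<in> L2"
    using bounded_support_L2(1)[OF g B(2), of x0 "\<bar>R0\<bar>"] supp_g by force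
  have S_meas [measurable]: "S g \<in> borel_measurable lebesgue"
    using S_measurable gL by auto
  have Gm: "?G \<in> sets lebesgue"
    by (rule lebesgue_set_greater_real) measurable
  have "?G = {z. ennreal (B\<^sup>2) < ennreal ((norm (S g z))\<^sup>2)}"
    using B(1) by (auto simp: ennreal_less_iff intro: power_strict_mono power2_less_imp_less)
  then have "emeasure lebesgue ?G \<le> ennreal (1 / B\<^sup>2) * L2_sq (S g)"
    unfolding L2_sq_def using B(1) by (simp, intro emeasure_greater_le) auto
  also have "\<dots> \<le> ennreal (1 / B\<^sup>2) * (ennreal (CS\<^sup>2) * (ennreal B * mass g))"
  proof (intro mult_left_mono order_trans[OF S_L2_sq[OF gL]])
    have "L2_sq g \<le> (\<integral>\<^sup>+y. ennreal B * ennreal (norm (g y)) \<partial>lebesgue)"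
      unfolding L2_sq_def using B
      by (intro nn_integral_mono) (simp add: ennreal_mult'[symmetric] power2_eq_square ennreal_leI mult_right_mono)
    also have "\<dots> = ennreal B * mass g"
      by (intro nn_integral_cmult measurable_compose[OF measurable_compose[OF g borel_measurable_norm] measurable_ennreal])
    finally show "L2_sq g \<le> ennreal B * mass g" .
  qed auto
  also have "\<dots> = ennreal (CS\<^sup>2 / B) * mass g"
    using B(1) by (simp add: mult.assoc[symmetric] ennreal_mult[symmetric] power2_eq_square)
  finally have G: "emeasure lebesgue ?G \<le> ennreal (CS\<^sup>2 / B) * mass g" .
  have "emeasure lebesgue {x. ennreal (C_cotlar * B) < T_max g x}
      \<le> emeasure lebesgue (maximal_set (indicator ?G) (?w / 3))"
    using cotlar_bounded[OF g B supp_g] by (intro emeasure_mono) auto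
  also have "\<dots> \<le> ennreal (?w * 5 ^ ?n / (?w / 3)) * (\<integral>\<^sup>+y. indicator ?G y \<partial>lebesgue)"
    by (rule maximal_set_weak_type[OF borel_measurable_indicator[OF Gm]]) simp
  also have "\<dots> = ennreal (3 * 5 ^ ?n) * emeasure lebesgue ?G"
    unfolding nn_integral_indicator[OF Gm] using less_imp_neq[OF w] by (simp add: mult.commute)
  also have "\<dots> \<le> ennreal (3 * 5 ^ ?n) * (ennreal (CS\<^sup>2 / B) * mass g)"
    by (intro mult_left_mono G) auto
  also have "\<dots> = ennreal (3 * 5 ^ ?n * CS\<^sup>2 / B) * mass g"
    using B(1) by (simp add: mult.assoc[symmetric] ennreal_mult[symmetric])
  finally show ?thesis .
qed

end

section \<open>The Calderon-Zygmund decomposition\<close>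

lemma norm_diff_le_hcube:
  assumes "y \<in> hcube a l" "z \<in> hcube (a::'a::euclidean_space) l"
  shows "norm (y - z) \<le> real DIM('a) * l"
proof -
  have "\<bar>(y - z) \<bullet> i\<bar> \<le> l" if "i \<in> Basis" for i
  proof -
    have "a \<bullet> i \<le> y \<bullet> i" "y \<bullet> i < a \<bullet> i + l" "a \<bullet> i \<le> z \<bullet> i" "z \<bullet> i < a \<bullet> i + l"
      using assms that by (simp_all add: hcube_def)
    then show ?thesis unfolding inner_diff_left by linarith
  qed
  then have "(\<Sum>i\<in>Basis. \<bar>(y - z) \<bullet> i\<bar>) \<le> real DIM('a) * l"
    by (intro sum_bounded_above) auto
  then show ?thesis using norm_le_l1[of "y - z"] by simp
qed

lemma corner_in_hcube: "l > 0 \<Longrightarrow> a \<in> hcube a l"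
  by (simp add: hcube_def)

lemma borel_measurable_ennreal_norm:
  fixes f :: "'a \<Rightarrow> complex"
  assumes "f \<in> borel_measurable M"
  shows "(\<lambda>y. ennreal (norm (f y))) \<in> borel_measurable M"
  by (rule measurable_compose[OF measurable_compose[OF assms borel_measurable_norm] measurable_ennreal])

lemma set_integrable_hcube:
  fixes f :: "'a::euclidean_space \<Rightarrow> complex"
  shows "integrable lebesgue f \<Longrightarrow> set_integrable lebesgue (hcube a l) f"
  unfolding set_integrable_def by (intro integrable_mult_indicator hcube_lebesgue)

lemma norm_set_integral_le:
  fixes f :: "'a \<Rightarrow> complex"
  shows "ennreal (norm (LINT y:A|M. f y)) \<le> (\<integral>\<^sup>+y\<in>A. ennreal (norm (f y)) \<partial>M)"
proof -
  have "ennreal (norm (LINT y:A|M. f y)) \<le> (\<integral>\<^sup>+y. ennreal (norm (indicator A y *\<^sub>R f y)) \<partial>M)"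
    unfolding set_lebesgue_integral_def by (rule norm_integral_le_nn_integral)
  also have "\<dots> = (\<integral>\<^sup>+y\<in>A. ennreal (norm (f y)) \<partial>M)"
    by (intro nn_integral_cong) (simp split: split_indicator)
  finally show ?thesis .
qed

text \<open>On a cube \<open>g\<close> is the mean of \<open>f\<close>; off the cubes it is
  \<open>f\<close> where \<open>norm (f y) \<le> \<tau>\<close> and 0 elsewhere. This cut-off alters
  \<open>f\<close> only on a null set, and it makes the bound on \<open>g\<close> hold everywhere,
  as Cotlar's inequality for bounded functions requires.\<close>

proposition calderon_zygmund_decomposition:
  fixes f :: "'a::euclidean_space \<Rightarrow> complex"
  assumes f: "integrable lebesgue f" and supp_f: "\<And>y. f y \<noteq> 0 \<Longrightarrow> y \<in> hcube a l"
    and l: "l > 0" and \<tau>: "\<tau> > 0"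
    and avg: "mass f \<le> ennreal (\<tau> * l ^ DIM('a))"
  obtains g h :: "'a \<Rightarrow> complex" and b :: "nat \<Rightarrow> 'a" and s :: "nat \<Rightarrow> real" where
    "\<And>y. f y = g y + h y" "integrable lebesgue g" "integrable lebesgue h"
    "\<And>y. norm (g y) \<le> 2 ^ DIM('a) * \<tau>" "\<And>y. g y \<noteq> 0 \<Longrightarrow> y \<in> hcube a l"
    "mass g \<le> mass f"
    "mass h \<le> 2 * mass f"
    "\<And>j. s j \<ge> 0" "disjoint_family (\<lambda>j. hcube (b j) (s j))"
    "AE y in lebesgue. y \<notin> (\<Union>j. hcube (b j) (s j)) \<longrightarrow> h y = 0"
    "\<And>j. (LINT y:hcube (b j) (s j)|lebesgue. h y) = 0"
    "\<And>j. ennreal (\<tau> * s j ^ DIM('a)) \<le> mass_on (hcube (b j) (s j)) f"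
proof -
  let ?n = "DIM('a)"
  have f_meas: "f \<in> borel_measurable lebesgue" using f by (rule borel_measurable_integrable)
  have nf_meas: "(\<lambda>y. ennreal (norm (f y))) \<in> borel_measurable lebesgue"
    by (rule borel_measurable_ennreal_norm[OF f_meas])
  have "mass_on (hcube a l) f \<le> mass f"
    by (intro nn_integral_mono) (simp split: split_indicator)
  then have avg': "mass_on (hcube a l) f \<le> ennreal (\<tau> * l ^ ?n)"
    using avg by (rule order_trans)
  obtain b :: "nat \<Rightarrow> 'a" and s where s0: "\<And>j. s j \<ge> 0"
    and disj: "disjoint_family (\<lambda>j. hcube (b j) (s j))"
    and sub: "\<And>j. hcube (b j) (s j) \<subseteq> hcube a l"
    and lower: "\<And>j. ennreal (\<tau> * s j ^ ?n) \<le> mass_on (hcube (b j) (s j)) f"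
    and upper: "\<And>j. mass_on (hcube (b j) (s j)) f \<le> ennreal (2 ^ ?n * \<tau> * s j ^ ?n)"
    and ae: "AE x in lebesgue. x \<in> hcube a l \<longrightarrow> x \<notin> (\<Union>j. hcube (b j) (s j)) \<longrightarrow> ennreal (norm (f x)) \<le> ennreal \<tau>"
    by (rule calderon_zygmund_cubes[OF nf_meas l \<tau> avg']) (rule that, assumption+)
  define P where "P j = hcube (b j) (s j)" for j
  have P_sets [measurable]: "P j \<in> sets lebesgue" for j unfolding P_def by (rule hcube_lebesgue)
  have disjP: "disjoint_family P" using disj by (simp add: P_def[abs_def])
  define U where "U = (\<Union>j. P j)"
  have U_sets [measurable]: "U \<in> sets lebesgue" unfolding U_def by measurable
  \<comment> \<open>An empty cube has \<open>s j = 0\<close>, and division by zero then gives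
    \<open>av j = 0\<close>.\<close>
  define av where "av j = (LINT y:P j|lebesgue. f y) / of_real (s j ^ ?n)" for j
  \<comment> \<open>The index of the cube through \<open>y\<close>, written as a least number
    because this form is measurable; its value off the cubes is arbitrary and is masked by the case
    distinction in \<open>g\<close>.\<close>
  define J where "J y = (LEAST j. y \<in> P j)" for y
  have J: "J y = j" if "y \<in> P j" for y j
  proof -
    have "i = j" if "y \<in> P i" for i
      using disjP \<open>y \<in> P j\<close> that by (auto simp: disjoint_family_on_def)
    with that show ?thesis unfolding J_def by (metis LeastI)
  qed
  define g where "g y = (if y \<in> U then av (J y) else if norm (f y) \<le> \<tau> then f y else 0)" for y
  define h where "h y = f y - g y" for y
  have gP: "g y = av j" if "y \<in> P j" for y j
    using that J[OF that] by (auto simp: g_def U_def)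
  have J_meas: "J \<in> measurable lebesgue (count_space UNIV)"
  proof -
    have "{y \<in> space lebesgue. y \<in> P j} = P j" for j by simp
    then have "Measurable.pred lebesgue (\<lambda>y. y \<in> P j)" for j
      unfolding pred_def by (simp only: P_sets)
    then show ?thesis
      unfolding J_def[abs_def] by (rule measurable_Least)
  qed
  have avJ_meas: "(\<lambda>y. av (J y)) \<in> borel_measurable lebesgue"
    by (rule measurable_compose[OF J_meas]) simp
  have g_meas: "g \<in> borel_measurable lebesgue"
  proof -
    have "{y. norm (f y) \<le> \<tau>} = space lebesgue - {y. norm (f y) > \<tau>}" by auto
    also have "\<dots> \<in> sets lebesgue"
      by (rule sets.compl_sets[OF lebesgue_set_greater_real[OF measurable_compose[OF f_meas borel_measurable_norm]]])
    finally have small: "{y. norm (f y) \<le> \<tau>} \<in> sets lebesgue" .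
    have g_eq: "g = (\<lambda>y. indicator U y *\<^sub>R av (J y) + indicator (- U) y *\<^sub>R indicator {y. norm (f y) \<le> \<tau>} y *\<^sub>R f y)"
      by (auto simp: g_def fun_eq_iff split: split_indicator)
    have cU: "- U \<in> sets lebesgue" using sets.compl_sets[OF U_sets] by (simp add: Compl_eq_Diff_UNIV)
    show ?thesis
      unfolding g_eq
      by (intro borel_measurable_add borel_measurable_scaleR borel_measurable_indicator f_meas avJ_meas small U_sets cU)
  qed
  have int_P: "ennreal (norm (av j) * s j ^ ?n) \<le> mass_on (P j) f" for j
  proof -
    have "norm (av j) * s j ^ ?n \<le> norm (LINT y:P j|lebesgue. f y)"
      using s0[of j] by (simp add: av_def norm_divide norm_power)
    then show ?thesis
      using norm_set_integral_le[of lebesgue "P j" f] by (meson ennreal_leI order_trans)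
  qed
  have av_le: "norm (av j) \<le> 2 ^ ?n * \<tau>" for j
  proof (cases "s j = 0")
    case True
    then show ?thesis using \<tau> by (simp add: av_def zero_power)
  next
    case False
    then have "s j > 0" using s0[of j] by simp
    moreover have "ennreal (norm (av j) * s j ^ ?n) \<le> ennreal (2 ^ ?n * \<tau> * s j ^ ?n)"
      using int_P[of j] upper[of j] by (simp add: P_def)
    then have "norm (av j) * s j ^ ?n \<le> 2 ^ ?n * \<tau> * s j ^ ?n"
      using \<tau> s0[of j] by (subst (asm) ennreal_le_iff) auto
    ultimately show ?thesis by simp
  qed
  have one: "(1::real) \<le> 2 ^ ?n" by (rule one_le_power) simp
  have g_le: "norm (g y) \<le> 2 ^ ?n * \<tau>" for y
  proof -
    have t: "\<tau> \<le> 2 ^ ?n * \<tau>" using mult_right_mono[OF one, of \<tau>] \<tau> by simp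
    show ?thesis using av_le[of "J y"] \<tau> by (auto simp: g_def intro: order_trans[OF _ t])
  qed
  have g_supp: "y \<in> hcube a l" if "g y \<noteq> 0" for y
  proof (cases "y \<in> U")
    case True
    then show ?thesis using sub by (auto simp: U_def P_def)
  next
    case False
    then show ?thesis using that supp_f[of y] by (auto simp: g_def split: if_splits)
  qed
  have g_int_P: "mass_on (P j) g \<le> mass_on (P j) f" for j
  proof -
    have "mass_on (P j) g = (\<integral>\<^sup>+y. ennreal (norm (av j)) * indicator (P j) y \<partial>lebesgue)"
      by (intro nn_integral_cong) (simp add: gP split: split_indicator)
    also have "\<dots> = ennreal (norm (av j)) * emeasure lebesgue (P j)"
      by (rule nn_integral_cmult_indicator[OF P_sets])
    also have "\<dots> = ennreal (norm (av j) * s j ^ ?n)"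
      using s0[of j] by (simp add: P_def emeasure_hcube ennreal_mult)
    finally show ?thesis using int_P[of j] by simp
  qed
  have ng_meas: "(\<lambda>y. ennreal (norm (g y))) \<in> borel_measurable lebesgue"
    by (rule borel_measurable_ennreal_norm[OF g_meas])
  have split: "(\<integral>\<^sup>+y. u y \<partial>lebesgue) = (\<Sum>j. \<integral>\<^sup>+y\<in>P j. u y \<partial>lebesgue) + (\<integral>\<^sup>+y\<in>-U. u y \<partial>lebesgue)"
    if u: "u \<in> borel_measurable lebesgue" for u :: "'a \<Rightarrow> ennreal"
  proof -
    have cU: "- U \<in> sets lebesgue" using sets.compl_sets[OF U_sets] by (simp add: Compl_eq_Diff_UNIV)
    have "(\<integral>\<^sup>+y. u y \<partial>lebesgue) = (\<integral>\<^sup>+y\<in>U \<union> -U. u y \<partial>lebesgue)" by simp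
    also have "\<dots> = (\<integral>\<^sup>+y\<in>U. u y \<partial>lebesgue) + (\<integral>\<^sup>+y\<in>-U. u y \<partial>lebesgue)"
      by (rule nn_integral_disjoint_pair[OF u U_sets cU]) simp
    also have "(\<integral>\<^sup>+y\<in>U. u y \<partial>lebesgue) = (\<Sum>j. \<integral>\<^sup>+y\<in>P j. u y \<partial>lebesgue)"
      unfolding U_def by (rule nn_integral_disjoint_family[OF u P_sets disjP])
    finally show ?thesis .
  qed
  have g_norm: "mass g \<le> mass f"
    unfolding split[OF ng_meas] split[OF nf_meas]
  proof (rule add_mono)
    show "(\<Sum>j. \<integral>\<^sup>+y\<in>P j. ennreal (norm (g y)) \<partial>lebesgue) \<le> (\<Sum>j. \<integral>\<^sup>+y\<in>P j. ennreal (norm (f y)) \<partial>lebesgue)"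
      by (intro suminf_le g_int_P) auto
    show "mass_on (-U) g \<le> mass_on (-U) f"
      by (intro nn_integral_mono) (simp add: g_def split: split_indicator)
  qed
  have f_fin: "mass f < \<infinity>"
    using avg by (rule order_le_less_trans) simp
  have g_int: "integrable lebesgue g"
    by (rule integrableI_bounded[OF g_meas order_le_less_trans[OF g_norm f_fin]])
  have h_int: "integrable lebesgue h"
    unfolding h_def by (rule Bochner_Integration.integrable_diff[OF f g_int])
  have h_norm: "mass h \<le> 2 * mass f"
  proof -
    have "mass h \<le> (\<integral>\<^sup>+y. ennreal (norm (f y)) + ennreal (norm (g y)) \<partial>lebesgue)"
      unfolding h_def
      by (intro nn_integral_mono) (simp add: ennreal_plus[symmetric] norm_triangle_ineq4 ennreal_leI del: ennreal_plus)
    also have "\<dots> = mass f + mass g"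
      by (rule nn_integral_add[OF nf_meas ng_meas])
    also have "\<dots> \<le> mass f + mass f"
      by (intro add_left_mono g_norm)
    finally show ?thesis by (simp add: mult_2)
  qed
  have h_zero: "AE y in lebesgue. y \<notin> (\<Union>j. hcube (b j) (s j)) \<longrightarrow> h y = 0"
    using ae
  proof (rule AE_mp, intro AE_I2 impI)
    fix y assume *: "y \<in> hcube a l \<longrightarrow> y \<notin> (\<Union>j. hcube (b j) (s j)) \<longrightarrow> ennreal (norm (f y)) \<le> ennreal \<tau>"
      and y: "y \<notin> (\<Union>j. hcube (b j) (s j))"
    then have yU: "y \<notin> U" by (simp add: U_def P_def)
    show "h y = 0"
    proof (cases "y \<in> hcube a l")
      case True
      then have "norm (f y) \<le> \<tau>" using * y \<tau> by (simp add: ennreal_le_iff)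
      then show ?thesis using yU by (simp add: h_def g_def)
    next
      case False
      then show ?thesis using supp_f[of y] yU by (auto simp: h_def g_def)
    qed
  qed
  have h_mean: "(LINT y:hcube (b j) (s j)|lebesgue. h y) = 0" for j
  proof (cases "s j = 0")
    case True
    then show ?thesis by (simp add: hcube_empty set_lebesgue_integral_def)
  next
    case False
    have "(LINT y:P j|lebesgue. h y) = (LINT y:P j|lebesgue. f y) - (LINT y:P j|lebesgue. g y)"
      unfolding h_def P_def by (intro set_integral_diff(2) set_integrable_hcube f g_int)
    also have "(LINT y:P j|lebesgue. g y) = (LINT y:P j|lebesgue. av j)"
      using gP by (intro set_lebesgue_integral_cong P_sets) auto
    also have "\<dots> = measure lebesgue (P j) *\<^sub>R av j"
    proof -
      have "emeasure lebesgue (P j) < \<infinity>" by (simp add: P_def emeasure_hcube s0)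
      then have "integrable lebesgue (indicator (P j) :: 'a \<Rightarrow> real)"
        by (rule integrable_real_indicator[OF P_sets])
      then show ?thesis
        unfolding set_lebesgue_integral_def by (subst integral_scaleR_left) simp_all
    qed
    also have "measure lebesgue (P j) = s j ^ ?n"
      using emeasure_hcube[OF s0[of j], of "b j"] s0[of j] by (simp add: P_def measure_def)
    also have "s j ^ ?n *\<^sub>R av j = (LINT y:P j|lebesgue. f y)"
      using False by (simp add: av_def scaleR_conv_of_real)
    finally show ?thesis by (simp add: P_def)
  qed
  show ?thesis
    by (rule that[of g h s b]; (rule g_int h_int g_le g_supp g_norm h_norm s0 disj h_zero h_mean lower)?)
      (simp_all add: h_def g_supp)
qed

section \<open>The weak type estimate for the maximal singular integral\<close>

lemma norm_suminf_ennreal_le: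
  fixes F :: "nat \<Rightarrow> complex"
  shows "ennreal (norm (suminf F)) \<le> (\<Sum>j. ennreal (norm (F j)))"
proof (cases "summable (\<lambda>j. norm (F j))")
  case True
  then have "norm (suminf F) \<le> (\<Sum>j. norm (F j))" by (rule summable_norm)
  then have "ennreal (norm (suminf F)) \<le> ennreal (\<Sum>j. norm (F j))" by (rule ennreal_leI)
  also have "\<dots> = (\<Sum>j. ennreal (norm (F j)))" using True by (intro suminf_ennreal2[symmetric]) auto
  finally show ?thesis .
next
  case False
  then have "(\<Sum>j. ennreal (norm (F j))) = top"
    using summable_suminf_not_top[of "\<lambda>j. norm (F j)", OF norm_ge_zero] by blast
  then show ?thesis by (simp only: top_greatest)
qed

context cz_kernel begin

text \<open>The oscillation of the kernel over a cube with corner \<open>b\<close> and side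
  \<open>s\<close>, seen from \<open>x\<close>: the diameter bound \<open>DIM('a) * s\<close> to the
  power \<open>\<delta>\<close> against the distance to the corner. It is cut off at three diameter
  bounds, and its integral in \<open>x\<close> has a bound common to all cubes.\<close>

definition cube_tail :: "'a \<Rightarrow> real \<Rightarrow> 'a \<Rightarrow> ennreal" where
  "cube_tail b s x = ennreal ((real DIM('a) * s) powr \<delta>) *
     (ennreal (1 / norm (b - x) powr (real DIM('a) + \<delta>)) * indicator {x. norm (b - x) > 3 * (real DIM('a) * s)} x)"

text \<open>Cubes inside the truncated region are treated by cancellation; a cube that meets the ball of radius
  \<open>\<epsilon>\<close> lies in the ball of radius \<open>2 \<epsilon>\<close>, where the kernel is bounded by \<open>c \<epsilon>\<^sup>-\<^sup>n\<close>.\<close>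

lemma cancellation_on_cube:
  assumes h: "integrable lebesgue h" and mean: "(LINT y:hcube b s|lebesgue. h y) = 0"
    and e: "\<epsilon> > 0" and s: "s \<ge> 0" and far: "norm (b - x) > 3 * (real DIM('a) * s)"
  shows "ennreal (norm (LINT y:hcube b s|lebesgue. Ktr \<epsilon> x y * h y))
    \<le> ennreal c * (cube_tail b s x * mass_on (hcube b s) h) +
      ennreal (c / \<epsilon> ^ DIM('a)) * (\<integral>\<^sup>+y\<in>hcube b s. (ennreal (norm (h y)) * indicator (cball x (2 * \<epsilon>)) y) \<partial>lebesgue)"
    (is "_ \<le> ?A + ?B")
proof (cases "s = 0")
  case True
  then show ?thesis by (simp add: hcube_empty set_lebesgue_integral_def)
next
  case False
  let ?n = "DIM('a)" and ?P = "hcube b s"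
  define r where "r = real ?n * s"
  have s: "s > 0" using s False by simp
  have r: "r > 0" using s by (simp add: r_def)
  have nh: "(\<lambda>y. ennreal (norm (h y))) \<in> borel_measurable lebesgue"
    by (intro borel_measurable_ennreal_norm borel_measurable_integrable h)
  have nhP: "(\<lambda>y. ennreal (norm (h y)) * indicator ?P y) \<in> borel_measurable lebesgue"
    by (intro borel_measurable_times_ennreal nh borel_measurable_indicator hcube_lebesgue)
  have near: "norm (b - y) \<le> r" if "y \<in> ?P" for y
    unfolding r_def by (rule norm_diff_le_hcube[OF corner_in_hcube[OF s] that])
  show ?thesis
  proof (cases "\<forall>y\<in>?P. norm (x - y) > \<epsilon>")
    case True
    let ?D = "\<lambda>y. Ktr \<epsilon> x y * h y - K x b * h y"
    have "(LINT y:?P|lebesgue. ?D y) = (LINT y:?P|lebesgue. Ktr \<epsilon> x y * h y) - (LINT y:?P|lebesgue. K x b * h y)"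
      by (intro set_integral_diff(2) set_integrable_hcube integrable_Ktr e h integrable_mult_right)
    also have "(LINT y:?P|lebesgue. K x b * h y) = K x b * (LINT y:?P|lebesgue. h y)"
      unfolding set_lebesgue_integral_def by (simp add: mult.commute[of "K x b"] flip: integral_mult_left_zero scaleR_scaleR)
    finally have "(LINT y:?P|lebesgue. Ktr \<epsilon> x y * h y) = (LINT y:?P|lebesgue. ?D y)"
      by (simp add: mean)
    then have "ennreal (norm (LINT y:?P|lebesgue. Ktr \<epsilon> x y * h y))
        \<le> (\<integral>\<^sup>+y\<in>?P. ennreal (norm (?D y)) \<partial>lebesgue)"
      using norm_set_integral_le[of lebesgue ?P ?D] by simp
    also have "\<dots> \<le> (\<integral>\<^sup>+y. (ennreal c * cube_tail b s x) * (ennreal (norm (h y)) * indicator ?P y) \<partial>lebesgue)"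
    proof (intro nn_integral_mono)
      fix y
      show "ennreal (norm (?D y)) * indicator ?P y
          \<le> (ennreal c * cube_tail b s x) * (ennreal (norm (h y)) * indicator ?P y)"
      proof (cases "y \<in> ?P")
        case yP: True
        have "norm (K x b - K x y) \<le> c * (norm (b - y) powr \<delta> / norm (b - x) powr (real ?n + \<delta>))"
          using near[OF yP] far r by (intro smooth_snd) (simp add: r_def)
        also have "\<dots> \<le> c * (r powr \<delta> / norm (b - x) powr (real ?n + \<delta>))"
          using near[OF yP] c_pos delta_pos by (intro mult_left_mono divide_right_mono powr_mono2) auto
        finally have "norm (K x y - K x b) * norm (h y) \<le> c * (r powr \<delta> / norm (b - x) powr (real ?n + \<delta>)) * norm (h y)"
          by (intro mult_right_mono) (simp_all add: norm_minus_commute)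
        moreover have "?D y = (K x y - K x b) * h y"
          using True yP by (simp add: Ktr_eq left_diff_distrib)
        ultimately have "norm (?D y) \<le> c * (r powr \<delta> / norm (b - x) powr (real ?n + \<delta>)) * norm (h y)"
          by (simp only: norm_mult)
        then have "ennreal (norm (?D y)) \<le> ennreal (c * (r powr \<delta> / norm (b - x) powr (real ?n + \<delta>)) * norm (h y))"
          by (rule ennreal_leI)
        also have "\<dots> = (ennreal c * cube_tail b s x) * ennreal (norm (h y))"
          using far c_pos by (simp add: cube_tail_def r_def ennreal_mult'[symmetric] ennreal_mult[symmetric])
        finally show ?thesis using yP by simp
      qed simp
    qed
    also have "\<dots> = ?A"
      unfolding nn_integral_cmult[OF nhP] by (simp add: mult.assoc)
    also have "\<dots> \<le> ?A + ?B" by simp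
    finally show ?thesis .
  next
    case False
    then obtain y' where y': "y' \<in> ?P" "norm (x - y') \<le> \<epsilon>" by force
    have inside: "norm (x - y) \<le> 2 * \<epsilon>" if "y \<in> ?P" for y
    proof -
      have "norm (b - x) \<le> norm (b - y') + norm (x - y')"
        using norm_triangle_ineq[of "b - y'" "y' - x"] by (simp add: norm_minus_commute)
      \<comment> \<open>The origin of the factor 3 in \<open>far\<close>: the corner is farther than
        \<open>3 * r\<close> from \<open>x\<close> but at most \<open>r + \<epsilon>\<close> away,
        so the cube has diameter at most \<open>\<epsilon> / 2\<close> and cannot leave the ball of
        radius \<open>2 * \<epsilon>\<close>.\<close>
      then have "2 * r \<le> \<epsilon>" using far near[OF y'(1)] y'(2) by (simp add: r_def)
      moreover have "norm (y' - y) \<le> r"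
        unfolding r_def by (rule norm_diff_le_hcube[OF y'(1) that])
      moreover have "norm (x - y) \<le> norm (x - y') + norm (y' - y)"
        using norm_triangle_ineq[of "x - y'" "y' - y"] by simp
      ultimately show ?thesis using y'(2) r by linarith
    qed
    have nhB: "(\<lambda>y. ennreal (norm (h y)) * indicator (cball x (2 * \<epsilon>)) y * indicator ?P y) \<in> borel_measurable lebesgue"
      by (intro borel_measurable_times_ennreal nh borel_measurable_indicator hcube_lebesgue sets_lebesgue_borel) simp
    have "ennreal (norm (LINT y:?P|lebesgue. Ktr \<epsilon> x y * h y))
        \<le> (\<integral>\<^sup>+y\<in>?P. ennreal (norm (Ktr \<epsilon> x y * h y)) \<partial>lebesgue)"
      by (rule norm_set_integral_le)
    also have "\<dots> \<le> (\<integral>\<^sup>+y. ennreal (c / \<epsilon> ^ ?n) * (ennreal (norm (h y)) * indicator (cball x (2 * \<epsilon>)) y * indicator ?P y) \<partial>lebesgue)"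
    proof (intro nn_integral_mono)
      fix y
      show "ennreal (norm (Ktr \<epsilon> x y * h y)) * indicator ?P y
          \<le> ennreal (c / \<epsilon> ^ ?n) * (ennreal (norm (h y)) * indicator (cball x (2 * \<epsilon>)) y * indicator ?P y)"
        using norm_Ktr_mult[OF e, of x y "h y"] inside[of y] c_pos e
        by (auto simp: ennreal_mult'[symmetric] ennreal_leI dist_norm split: split_indicator)
    qed
    also have "\<dots> = ?B"
      by (rule nn_integral_cmult[OF nhB])
    also have "\<dots> \<le> ?A + ?B" by simp
    finally show ?thesis .
  qed
qed

lemma cube_tail_measurable: "cube_tail b s \<in> borel_measurable lebesgue"
proof -
  have "(\<lambda>x. ennreal (1 / norm (b - x) powr (real DIM('a) + \<delta>))) \<in> borel_measurable lebesgue"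
    by measurable
  then show ?thesis
    unfolding cube_tail_def[abs_def]
    by (intro borel_measurable_times_ennreal borel_measurable_const borel_measurable_indicator far_sets)
qed

text \<open>An instance of \<open>kernel_tail\<close> for the constant function 1, whose mean bound
  is the volume of the unit ball; \<open>(r / (3 * r)) powr \<delta> \<le> 1\<close> removes the
  dependence on the cube.\<close>

lemma cube_tail_integral:
  assumes "s \<ge> 0"
  shows "(\<integral>\<^sup>+x. cube_tail b s x \<partial>lebesgue) \<le> ennreal (tail_const DIM('a) \<delta> * unit_ball_vol DIM('a))"
proof (cases "s = 0")
  case True
  then show ?thesis using delta_pos by (simp add: cube_tail_def)
next
  case False
  let ?n = "DIM('a)" and ?w = "unit_ball_vol (real DIM('a))"
  define r where "r = real ?n * s"
  have r: "r > 0" using assms False by (simp add: r_def)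
  have m: "(\<lambda>x. ennreal (1 / norm (b - x) powr (real DIM('a) + \<delta>)) * indicator {x. norm (b - x) > 3 * r} x) \<in> borel_measurable lebesgue"
    by (intro borel_measurable_times_ennreal borel_measurable_indicator far_sets) measurable
  have "(\<integral>\<^sup>+x. cube_tail b s x \<partial>lebesgue) = ennreal (r powr \<delta>) *
      (\<integral>\<^sup>+x\<in>{x. norm (b - x) > 3 * r}. ennreal (1 / norm (b - x) powr (?n + \<delta>)) \<partial>lebesgue)"
    unfolding cube_tail_def r_def[symmetric] by (rule nn_integral_cmult[OF m])
  also have "(\<integral>\<^sup>+x\<in>{x. norm (b - x) > 3 * r}. ennreal (1 / norm (b - x) powr (?n + \<delta>)) \<partial>lebesgue)
      \<le> ennreal (tail_const ?n \<delta> * ?w / (3 * r) powr \<delta>)"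
  proof -
    have "(\<integral>\<^sup>+y\<in>cball b t. 1 \<partial>lebesgue) \<le> ennreal (?w * t ^ ?n)" if "t > 0" for t
      using that by (simp add: emeasure_lebesgue_cball)
    then show ?thesis
      using kernel_tail[of "\<lambda>_. 1" "3 * r" \<delta> ?w b] r delta_pos by simp
  qed
  also have "ennreal (r powr \<delta>) * ennreal (tail_const ?n \<delta> * ?w / (3 * r) powr \<delta>)
      = ennreal (tail_const ?n \<delta> * ?w * (r powr \<delta> / (3 * r) powr \<delta>))"
    by (simp add: ennreal_mult'[symmetric] mult_ac)
  also have "\<dots> \<le> ennreal (tail_const ?n \<delta> * ?w * 1)"
    using r delta_pos tail_const_pos[OF delta_pos, of ?n]
    by (intro ennreal_leI mult_left_mono) (auto simp: divide_le_eq intro!: powr_mono2)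
  finally show ?thesis by (simp add: mult_left_mono)
qed

end

context cz_operator begin

text \<open>The first bracket collects the factors of the level: good part, cancellation, and cubes
  near the truncation sphere. The second collects the weak type constants of the four exceptional
  sets. One number serves both purposes, so a single constant enters the iteration.\<close>

definition C_weak :: real where
  "C_weak = (C_cotlar * 2 ^ DIM('a) + c + c * 2 ^ DIM('a)) +
     (3 * 5 ^ DIM('a) * CS\<^sup>2 + unit_ball_vol DIM('a) * 5 ^ DIM('a) * 2 +
      unit_ball_vol DIM('a) * (3 * real DIM('a)) ^ DIM('a) + 2 * (tail_const DIM('a) \<delta> * unit_ball_vol DIM('a)))"

lemma C_weak_pos: "C_weak > 0"
proof -
  have "C_cotlar * 2 ^ DIM('a) + c + c * 2 ^ DIM('a) > 0"
    using C_cotlar_pos c_pos by (intro add_pos_pos mult_pos_pos) auto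
  moreover have "0 \<le> 3 * 5 ^ DIM('a) * CS\<^sup>2 + unit_ball_vol DIM('a) * 5 ^ DIM('a) * 2 +
      unit_ball_vol DIM('a) * (3 * real DIM('a)) ^ DIM('a) + 2 * (tail_const DIM('a) \<delta> * unit_ball_vol DIM('a))"
    using tail_const_pos[OF delta_pos, of "DIM('a)"] by (intro add_nonneg_nonneg mult_nonneg_nonneg) auto
  ultimately show ?thesis unfolding C_weak_def by linarith
qed

text \<open>Stated for a function carried by one cube on which its mean is at most the level, since
  then that cube can start the stopping procedure; the localisation applies it to \<open>f\<close>
  restricted to a tripled cube.\<close>

proposition weak_type_in_cube:
  assumes f: "integrable lebesgue f" and supp_f: "\<And>y. f y \<noteq> 0 \<Longrightarrow> y \<in> hcube a l"
    and l: "l > 0" and \<tau>: "\<tau> > 0"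
    and avg: "mass f \<le> ennreal (\<tau> * l ^ DIM('a))"
  shows "emeasure lebesgue {x. ennreal (C_weak * \<tau>) < T_max f x}
    \<le> ennreal (C_weak / \<tau>) * mass f"
proof -
  let ?n = "DIM('a)" and ?w = "unit_ball_vol (real DIM('a))" and ?\<mu> = "emeasure (lebesgue :: 'a measure)"
  define I where "I = mass f"
  obtain g h :: "'a \<Rightarrow> complex" and b :: "nat \<Rightarrow> 'a" and s where
    fgh: "\<And>y. f y = g y + h y" and g: "integrable lebesgue g" and h: "integrable lebesgue h"
    and g_le: "\<And>y. norm (g y) \<le> 2 ^ DIM('a) * \<tau>" and g_supp: "\<And>y. g y \<noteq> 0 \<Longrightarrow> y \<in> hcube a l"
    and gf: "mass g \<le> mass f"
    and hf: "mass h \<le> 2 * mass f"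
    and s0: "\<And>j. s j \<ge> 0" and disj: "disjoint_family (\<lambda>j. hcube (b j) (s j))"
    and h_zero: "AE y in lebesgue. y \<notin> (\<Union>j. hcube (b j) (s j)) \<longrightarrow> h y = 0"
    and h_mean: "\<And>j. (LINT y:hcube (b j) (s j)|lebesgue. h y) = 0"
    and lower: "\<And>j. ennreal (\<tau> * s j ^ DIM('a)) \<le> mass_on (hcube (b j) (s j)) f"
    by (rule calderon_zygmund_decomposition[OF f supp_f l \<tau> avg]) (assumption, rule that, assumption+)
  note g_I = gf[folded I_def] and h_I = hf[folded I_def]
  let ?P = "\<lambda>j. hcube (b j) (s j)"
  have nh: "(\<lambda>y. ennreal (norm (h y))) \<in> borel_measurable lebesgue"
    by (intro borel_measurable_ennreal_norm borel_measurable_integrable h)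
  have nf: "(\<lambda>y. ennreal (norm (f y))) \<in> borel_measurable lebesgue"
    by (intro borel_measurable_ennreal_norm borel_measurable_integrable f)
  define wt where "wt j = mass_on (?P j) h" for j
  \<comment> \<open>\<open>H\<close> sums the oscillations over the cubes, weighted by the mass of
    \<open>h\<close>. Off the exceptional sets the bad part is under control: \<open>G\<close>
    removes the neighbourhoods of the cubes, \<open>E4\<close> bounds \<open>H\<close>, and
    \<open>E2\<close> bounds the mass of \<open>h\<close> in the balls of radius
    \<open>2 * \<epsilon>\<close>.\<close>
  define H where "H x = (\<Sum>j. cube_tail (b j) (s j) x * wt j)" for x
  define G where "G = (\<Union>j. cball (b j) (3 * (real ?n * s j)))"
  define E1 where "E1 = {x. ennreal (C_cotlar * (2 ^ ?n * \<tau>)) < T_max g x}"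
  define E2 where "E2 = maximal_set (\<lambda>y. ennreal (norm (h y))) \<tau>"
  define E4 where "E4 = {x. ennreal \<tau> < H x}"
  have term_meas: "(\<lambda>x. cube_tail (b j) (s j) x * wt j) \<in> borel_measurable lebesgue" for j
    by (intro borel_measurable_times_ennreal cube_tail_measurable borel_measurable_const)
  have H_meas: "H \<in> borel_measurable lebesgue"
    unfolding H_def[abs_def] by (rule borel_measurable_suminf_order[OF term_meas])
  have wt_sum: "(\<Sum>j. wt j) \<le> 2 * I"
  proof -
    have "(\<Sum>j. wt j) = mass_on (\<Union>j. ?P j) h"
      unfolding wt_def by (rule nn_integral_disjoint_family[OF nh hcube_lebesgue disj, symmetric])
    also have "\<dots> \<le> mass h"
      by (intro nn_integral_mono) (simp split: split_indicator)
    finally show ?thesis using h_I by (rule order_trans)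
  qed
  have H_int: "(\<integral>\<^sup>+x. H x \<partial>lebesgue) \<le> ennreal (tail_const ?n \<delta> * ?w) * (2 * I)"
  proof -
    have "(\<integral>\<^sup>+x. H x \<partial>lebesgue) = (\<Sum>j. \<integral>\<^sup>+x. cube_tail (b j) (s j) x * wt j \<partial>lebesgue)"
      unfolding H_def by (rule nn_integral_suminf[OF term_meas])
    also have "\<dots> = (\<Sum>j. (\<integral>\<^sup>+x. cube_tail (b j) (s j) x \<partial>lebesgue) * wt j)"
      by (intro suminf_cong nn_integral_multc cube_tail_measurable)
    also have "\<dots> \<le> (\<Sum>j. ennreal (tail_const ?n \<delta> * ?w) * wt j)"
      by (intro suminf_le mult_right_mono cube_tail_integral s0) auto
    also have "\<dots> = ennreal (tail_const ?n \<delta> * ?w) * (\<Sum>j. wt j)" by simp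
    also have "\<dots> \<le> ennreal (tail_const ?n \<delta> * ?w) * (2 * I)"
      by (intro mult_left_mono wt_sum) auto
    finally show ?thesis .
  qed
  have bad: "T_max h x \<le> ennreal (c * \<tau> + c * 2 ^ ?n * \<tau>)"
    if x: "x \<notin> G" "x \<notin> E2" "x \<notin> E4" for x
  proof (rule maximal_singular_integral_le)
    fix \<epsilon> :: real assume e: "\<epsilon> > 0"
    have far: "norm (b j - x) > 3 * (real ?n * s j)" for j
    proof -
      have "x \<notin> cball (b j) (3 * (real ?n * s j))" using x(1) unfolding G_def by blast
      then show ?thesis by (simp add: dist_norm not_le)
    qed
    let ?F = "\<lambda>y. Ktr \<epsilon> x y * h y"
    have F_int: "integrable lebesgue ?F" by (rule integrable_Ktr[OF e h])
    have U_sets: "(\<Union>j. ?P j) \<in> sets lebesgue" by (intro sets.countable_UN) auto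
    have "T_trunc \<epsilon> h x = (LINT y:(\<Union>j. ?P j)|lebesgue. ?F y)"
      unfolding truncated_integral_Ktr set_lebesgue_integral_def
    proof (intro integral_cong_AE)
      show "AE y in lebesgue. ?F y = indicator (\<Union>j. ?P j) y *\<^sub>R ?F y"
        using h_zero by (rule AE_mp) (intro AE_I2 impI, auto split: split_indicator)
      show "?F \<in> borel_measurable lebesgue" by (rule borel_measurable_integrable[OF F_int])
      then show "(\<lambda>y. indicator (\<Union>j. ?P j) y *\<^sub>R ?F y) \<in> borel_measurable lebesgue"
        by (intro borel_measurable_scaleR borel_measurable_indicator U_sets)
    qed
    also have "\<dots> = (\<Sum>j. LINT y:?P j|lebesgue. ?F y)"
    proof (rule lebesgue_integral_countable_add)
      show "set_integrable lebesgue (\<Union>j. ?P j) ?F"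
        unfolding set_integrable_def by (rule integrable_mult_indicator[OF U_sets F_int])
    qed (use disj in \<open>auto simp: disjoint_family_on_def hcube_lebesgue\<close>)
    finally have "ennreal (norm (T_trunc \<epsilon> h x)) \<le> (\<Sum>j. ennreal (norm (LINT y:?P j|lebesgue. ?F y)))"
      using norm_suminf_ennreal_le by simp
    also have "\<dots> \<le> (\<Sum>j. ennreal c * (cube_tail (b j) (s j) x * wt j) +
        ennreal (c / \<epsilon> ^ ?n) * (\<integral>\<^sup>+y\<in>?P j. (ennreal (norm (h y)) * indicator (cball x (2 * \<epsilon>)) y) \<partial>lebesgue))"
      unfolding wt_def by (intro suminf_le cancellation_on_cube h h_mean e s0 far) auto
    also have "\<dots> = ennreal c * H x +
        ennreal (c / \<epsilon> ^ ?n) * (\<Sum>j. \<integral>\<^sup>+y\<in>?P j. (ennreal (norm (h y)) * indicator (cball x (2 * \<epsilon>)) y) \<partial>lebesgue)"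
      unfolding H_def by (simp add: suminf_add[symmetric])
    also have "(\<Sum>j. \<integral>\<^sup>+y\<in>?P j. (ennreal (norm (h y)) * indicator (cball x (2 * \<epsilon>)) y) \<partial>lebesgue)
        = (\<integral>\<^sup>+y\<in>(\<Union>j. ?P j). (ennreal (norm (h y)) * indicator (cball x (2 * \<epsilon>)) y) \<partial>lebesgue)"
      by (intro nn_integral_disjoint_family[symmetric] hcube_lebesgue disj borel_measurable_times_ennreal nh
          borel_measurable_indicator sets_lebesgue_borel) simp
    also have "\<dots> \<le> mass_on (cball x (2 * \<epsilon>)) h"
      by (intro nn_integral_mono) (simp split: split_indicator)
    also have "\<dots> \<le> ennreal (\<tau> * (2 * \<epsilon>) ^ ?n)"
      using x(2) e unfolding E2_def by (intro not_in_maximal_set) auto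
    also have "ennreal c * H x + ennreal (c / \<epsilon> ^ ?n) * ennreal (\<tau> * (2 * \<epsilon>) ^ ?n)
        \<le> ennreal c * ennreal \<tau> + ennreal (c / \<epsilon> ^ ?n) * ennreal (\<tau> * (2 * \<epsilon>) ^ ?n)"
      using x(3) by (intro add_right_mono mult_left_mono) (auto simp: E4_def not_less)
    also have "\<dots> = ennreal (c * \<tau> + c / \<epsilon> ^ ?n * (\<tau> * (2 * \<epsilon>) ^ ?n))"
      using c_pos \<tau> e by (simp add: ennreal_mult[symmetric] ennreal_plus[symmetric] del: ennreal_plus)
    also have "c * \<tau> + c / \<epsilon> ^ ?n * (\<tau> * (2 * \<epsilon>) ^ ?n) = c * \<tau> + c * 2 ^ ?n * \<tau>"
      using e by (simp add: power_mult_distrib)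
    finally show "ennreal (norm (T_trunc \<epsilon> h x)) \<le> ennreal (c * \<tau> + c * 2 ^ ?n * \<tau>)"
      by (simp add: add_left_mono mult_left_mono)
  qed
  define Q where "Q = C_cotlar * 2 ^ ?n + c + c * 2 ^ ?n"
  have sub: "{x. ennreal (C_weak * \<tau>) < T_max f x} \<subseteq> E1 \<union> E2 \<union> G \<union> E4"
  proof (rule subsetI, rule ccontr)
    fix x assume x: "x \<in> {x. ennreal (C_weak * \<tau>) < T_max f x}" and "x \<notin> E1 \<union> E2 \<union> G \<union> E4"
    then have nx: "x \<notin> E1" "x \<notin> G" "x \<notin> E2" "x \<notin> E4" by auto
    have "T_max f x \<le> T_max g x + T_max h x"
      using maximal_singular_integral_add_le[OF g h, of x] fgh by (simp add: fun_eq_iff[symmetric] ext[of f, OF fgh])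
    also have "\<dots> \<le> ennreal (C_cotlar * (2 ^ ?n * \<tau>)) + ennreal (c * \<tau> + c * 2 ^ ?n * \<tau>)"
      using nx(1) by (intro add_mono bad nx(2-4)) (simp add: E1_def not_less)
    also have "\<dots> = ennreal (Q * \<tau>)"
      using C_cotlar_pos c_pos \<tau> by (simp add: Q_def ennreal_plus[symmetric] algebra_simps del: ennreal_plus)
    also have "\<dots> \<le> ennreal (C_weak * \<tau>)"
      using tail_const_pos[OF delta_pos, of ?n] \<tau> unfolding C_weak_def Q_def
      by (intro ennreal_leI mult_right_mono) (auto intro!: add_nonneg_nonneg mult_nonneg_nonneg)
    finally show False using x by simp
  qed
  have m1: "E1 \<in> sets lebesgue"
    unfolding E1_def by (intro lebesgue_set_greater maximal_singular_integral_measurable g)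
  have m2: "E2 \<in> sets lebesgue" unfolding E2_def by (rule maximal_set_sets)
  have m3: "G \<in> sets lebesgue" unfolding G_def by (intro sets.countable_UN) auto
  have m4: "E4 \<in> sets lebesgue" unfolding E4_def by (rule lebesgue_set_greater[OF H_meas])
  define A1 where "A1 = 3 * 5 ^ ?n * CS\<^sup>2"
  define A2 where "A2 = ?w * 5 ^ ?n * 2"
  define A3 where "A3 = ?w * (3 * real ?n) ^ ?n"
  define A4 where "A4 = 2 * (tail_const ?n \<delta> * ?w)"
  have A: "A1 \<ge> 0" "A2 \<ge> 0" "A3 \<ge> 0" "A4 \<ge> 0"
    using tail_const_pos[OF delta_pos, of ?n] by (auto simp: A1_def A2_def A3_def A4_def)
  have e1: "?\<mu> E1 \<le> ennreal (A1 / \<tau>) * I"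
  proof -
    have "norm (y - a) \<le> real ?n * l" if "g y \<noteq> 0" for y
      by (rule norm_diff_le_hcube[OF g_supp[OF that] corner_in_hcube[OF l]])
    then have "?\<mu> E1 \<le> ennreal (3 * 5 ^ ?n * CS\<^sup>2 / (2 ^ ?n * \<tau>)) * mass g"
      unfolding E1_def using \<tau>
      by (intro good_part_weak_type[of g "2 ^ ?n * \<tau>" a "real ?n * l"] borel_measurable_integrable g g_le) auto
    also have "\<dots> \<le> ennreal (A1 / \<tau>) * I"
    proof (intro mult_mono ennreal_leI g_I)
      have "\<tau> \<le> 2 ^ ?n * \<tau>" using mult_right_mono[OF one_le_power[of 2 ?n], of \<tau>] \<tau> by simp
      then show "3 * 5 ^ ?n * CS\<^sup>2 / (2 ^ ?n * \<tau>) \<le> A1 / \<tau>"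
        unfolding A1_def using \<tau> by (intro divide_left_mono) auto
    qed auto
    finally show ?thesis .
  qed
  have e2: "?\<mu> E2 \<le> ennreal (A2 / \<tau>) * I"
  proof -
    have "?\<mu> E2 \<le> ennreal (?w * 5 ^ ?n / \<tau>) * mass h"
      unfolding E2_def by (rule maximal_set_weak_type[OF nh \<tau>])
    also have "\<dots> \<le> ennreal (?w * 5 ^ ?n / \<tau>) * (ennreal 2 * I)"
      using h_I by (intro mult_left_mono) auto
    also have "\<dots> = ennreal (A2 / \<tau>) * I"
      using \<tau> by (simp add: A2_def mult.assoc[symmetric] ennreal_mult[symmetric] del: ennreal_numeral)
    finally show ?thesis .
  qed
  have e3: "?\<mu> G \<le> ennreal (A3 / \<tau>) * I"
  proof -
    have "?\<mu> G \<le> (\<Sum>j. ?\<mu> (cball (b j) (3 * (real ?n * s j))))"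
      unfolding G_def by (intro emeasure_subadditive_countably) auto
    also have "\<dots> \<le> (\<Sum>j. ennreal (A3 / \<tau>) * mass_on (?P j) f)"
    proof (intro suminf_le)
      fix j
      \<comment> \<open>The stopping condition \<open>lower\<close> converts the volume of a cube,
        and hence of its enlarged ball, into mass of \<open>f\<close>.\<close>
      have "?\<mu> (cball (b j) (3 * (real ?n * s j))) = ennreal (A3 / \<tau>) * ennreal (\<tau> * s j ^ ?n)"
        using s0[of j] \<tau> A
        by (simp add: emeasure_lebesgue_cball A3_def ennreal_mult[symmetric] power_mult_distrib)
      also have "\<dots> \<le> ennreal (A3 / \<tau>) * mass_on (?P j) f"
        by (intro mult_left_mono lower) auto
      finally show "?\<mu> (cball (b j) (3 * (real ?n * s j))) \<le> ennreal (A3 / \<tau>) * mass_on (?P j) f" .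
    qed auto
    also have "\<dots> = ennreal (A3 / \<tau>) * mass_on (\<Union>j. ?P j) f"
      unfolding nn_integral_disjoint_family[OF nf hcube_lebesgue disj] by simp
    also have "\<dots> \<le> ennreal (A3 / \<tau>) * I"
      unfolding I_def by (intro mult_left_mono nn_integral_mono) (auto split: split_indicator)
    finally show ?thesis .
  qed
  have e4: "?\<mu> E4 \<le> ennreal (A4 / \<tau>) * I"
  proof -
    have "?\<mu> E4 \<le> ennreal (1 / \<tau>) * (\<integral>\<^sup>+x. H x \<partial>lebesgue)"
      unfolding E4_def by (rule emeasure_greater_le[OF H_meas \<tau>])
    also have "\<dots> \<le> ennreal (1 / \<tau>) * (ennreal (tail_const ?n \<delta> * ?w) * (ennreal 2 * I))"
      using H_int by (intro mult_left_mono) auto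
    also have "\<dots> = ennreal (1 / \<tau> * (tail_const ?n \<delta> * ?w * 2)) * I"
      using \<tau> tail_const_pos[OF delta_pos, of ?n]
      by (subst (1 2) ennreal_mult) (simp_all add: mult.assoc)
    also have "1 / \<tau> * (tail_const ?n \<delta> * ?w * 2) = A4 / \<tau>" by (simp add: A4_def)
    finally show ?thesis .
  qed
  have "?\<mu> {x. ennreal (C_weak * \<tau>) < T_max f x} \<le> ?\<mu> (E1 \<union> E2 \<union> G \<union> E4)"
    by (intro emeasure_mono sub sets.Un m1 m2 m3 m4)
  also have "\<dots> \<le> ?\<mu> (E1 \<union> E2 \<union> G) + ?\<mu> E4"
    by (intro emeasure_subadditive sets.Un m1 m2 m3 m4)
  also have "\<dots> \<le> (?\<mu> (E1 \<union> E2) + ?\<mu> G) + ?\<mu> E4"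
    by (intro add_right_mono emeasure_subadditive sets.Un m1 m2 m3)
  also have "\<dots> \<le> ((?\<mu> E1 + ?\<mu> E2) + ?\<mu> G) + ?\<mu> E4"
    by (intro add_right_mono emeasure_subadditive m1 m2)
  also have "\<dots> \<le> ((ennreal (A1 / \<tau>) * I + ennreal (A2 / \<tau>) * I) + ennreal (A3 / \<tau>) * I) + ennreal (A4 / \<tau>) * I"
    by (intro add_mono e1 e2 e3 e4)
  also have "\<dots> = ennreal ((A1 + A2 + A3 + A4) / \<tau>) * I"
    using A \<tau> by (simp add: distrib_right[symmetric] ennreal_plus[symmetric] add_divide_distrib del: ennreal_plus)
  also have "\<dots> \<le> ennreal (C_weak / \<tau>) * I"
  proof (intro mult_right_mono ennreal_leI divide_right_mono)
    have "0 \<le> Q" using C_cotlar_pos c_pos by (simp add: Q_def)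
    moreover have "C_weak = Q + (A1 + A2 + A3 + A4)"
      by (simp add: C_weak_def Q_def A1_def A2_def A3_def A4_def)
    ultimately show "A1 + A2 + A3 + A4 \<le> C_weak" by simp
  qed (use \<tau> in auto)
  finally show ?thesis unfolding I_def .
qed

end

section \<open>Localisation and iteration\<close>

text \<open>The concentric cube of three times the side, again half-open so that the weak type
  estimate in a cube applies to it directly.\<close>

definition triple :: "'a::euclidean_space \<Rightarrow> real \<Rightarrow> 'a set" where
  "triple b s = hcube (b - s *\<^sub>R One) (3 * s)"

definition restrict_to :: "'a set \<Rightarrow> ('a \<Rightarrow> complex) \<Rightarrow> 'a \<Rightarrow> complex" where
  "restrict_to A f y = (if y \<in> A then f y else 0)"

lemma mem_triple: "y \<in> triple b s \<longleftrightarrow> (\<forall>i\<in>Basis. b \<bullet> i - s \<le> y \<bullet> i \<and> y \<bullet> i < b \<bullet> i + 2 * s)"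
  unfolding triple_def hcube_def by (simp add: inner_simps algebra_simps)

lemma triple_lebesgue [measurable]: "triple b s \<in> sets lebesgue"
  unfolding triple_def by (rule hcube_lebesgue)

lemma restrict_to_indicator: "restrict_to A f = (\<lambda>y. indicator A y *\<^sub>R f y)"
  by (auto simp: restrict_to_def fun_eq_iff)

lemma integrable_restrict_to:
  "A \<in> sets M \<Longrightarrow> integrable M f \<Longrightarrow> integrable M (restrict_to A f)"
  unfolding restrict_to_indicator by (rule integrable_mult_indicator)

lemma nn_integral_restrict_to:
  "(\<integral>\<^sup>+y. ennreal (norm (restrict_to A f y)) \<partial>M) = (\<integral>\<^sup>+y\<in>A. ennreal (norm (f y)) \<partial>M)"
  by (intro nn_integral_cong) (simp add: restrict_to_def split: split_indicator)

lemma hcube_subset_imp: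
  assumes "hcube B t \<subseteq> hcube b s" "t > 0" "i \<in> Basis"
  shows "b \<bullet> i \<le> B \<bullet> i" "B \<bullet> i + t \<le> b \<bullet> i + s"
proof -
  show "b \<bullet> i \<le> B \<bullet> i"
    using corner_in_hcube[OF assms(2), of B] assms(1,3) by (auto simp: hcube_def)
  \<comment> \<open>The far corner does not belong to the half-open cube, so it is approached along
    the diagonal.\<close>
  have "B \<bullet> i + \<theta> < b \<bullet> i + s" if "0 < \<theta>" "\<theta> < t" for \<theta>
  proof -
    have "B + \<theta> *\<^sub>R One \<in> hcube B t" using that by (simp add: hcube_def inner_simps)
    then have "B + \<theta> *\<^sub>R One \<in> hcube b s" using assms(1) by blast
    then show ?thesis using assms(3) by (simp add: hcube_def inner_simps)
  qed
  then have "\<theta> \<le> b \<bullet> i + s - B \<bullet> i" if "0 < \<theta>" "\<theta> < t" for \<theta>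
    using that by (simp add: less_imp_le algebra_simps)
  then have "t \<le> b \<bullet> i + s - B \<bullet> i"
    by (rule dense_le_bounded[OF assms(2)])
  then show "B \<bullet> i + t \<le> b \<bullet> i + s" by simp
qed

lemma triple_mono:
  assumes "hcube B t \<subseteq> hcube b s" "t > 0"
  shows "triple B t \<subseteq> triple b s"
proof
  fix y assume y: "y \<in> triple B t"
  show "y \<in> triple b s"
    unfolding mem_triple
  proof
    fix i :: 'a assume i: "i \<in> Basis"
    have "B \<bullet> i - t \<le> y \<bullet> i" "y \<bullet> i < B \<bullet> i + 2 * t" using y i by (auto simp: mem_triple)
    then show "b \<bullet> i - s \<le> y \<bullet> i \<and> y \<bullet> i < b \<bullet> i + 2 * s"
      using hcube_subset_imp[OF assms i] by linarith
  qed
qed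

lemma norm_diff_outside_triple:
  assumes "x \<in> hcube b s" "y \<notin> triple b s"
  shows "s \<le> norm (x - y)"
proof -
  obtain i where i: "i \<in> Basis" "y \<bullet> i < b \<bullet> i - s \<or> b \<bullet> i + 2 * s \<le> y \<bullet> i"
    using assms(2) by (auto simp: mem_triple not_le not_less)
  have "b \<bullet> i \<le> x \<bullet> i" "x \<bullet> i < b \<bullet> i + s" using assms(1) i by (auto simp: hcube_def)
  then have "s \<le> \<bar>(x - y) \<bullet> i\<bar>" using i(2) unfolding inner_diff_left by linarith
  also have "\<dots> \<le> norm (x - y)" by (rule Basis_le_norm[OF i(1)])
  finally show ?thesis .
qed

text \<open>\<open>HL_maximal\<close> ranges over closed cubes, so the competitor is the closure of
  the tripled cube, which has the same measure.\<close>

lemma average_le_HL_maximal: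
  assumes x: "x \<in> hcube b s" and s: "s > 0"
  shows "mass_on (triple b s) f / ennreal ((3 * s) ^ DIM('a)) \<le> HL_maximal f (x::'a::euclidean_space)"
proof -
  let ?Q = "cbox (b - s *\<^sub>R One) (b - s *\<^sub>R One + (3 * s) *\<^sub>R One)"
  have Q: "is_cube ?Q" unfolding is_cube_def using s by (intro exI[of _ "b - s *\<^sub>R One"] exI[of _ "3 * s"]) simp
  have xQ: "x \<in> ?Q"
  proof -
    have "b \<bullet> i - s \<le> x \<bullet> i \<and> x \<bullet> i \<le> b \<bullet> i + 2 * s" if "i \<in> Basis" for i
    proof -
      have "b \<bullet> i \<le> x \<bullet> i" "x \<bullet> i < b \<bullet> i + s" using x that by (auto simp: hcube_def)
      then show ?thesis using s by linarith
    qed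
    then show ?thesis by (simp add: mem_box inner_simps algebra_simps)
  qed
  have mQ: "emeasure lebesgue ?Q = ennreal ((3 * s) ^ DIM('a))"
    using s by (intro emeasure_cube_cbox) simp
  have "mass_on (triple b s) f \<le> mass_on ?Q f"
    unfolding triple_def by (rule nn_set_integral_mono_set[OF hcube_subset_cbox])
  then have "mass_on (triple b s) f / ennreal ((3 * s) ^ DIM('a))
      \<le> mass_on ?Q f / emeasure lebesgue ?Q"
    unfolding mQ by (rule divide_right_mono_ennreal)
  also have "\<dots> \<le> HL_maximal f x"
    unfolding HL_maximal_def using Q xQ by (intro SUP_upper) simp
  finally show ?thesis .
qed

context cz_kernel begin

definition C_local :: real where
  "C_local = c * tail_const DIM('a) \<delta> + c * (3 * real DIM('a)) ^ DIM('a)"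

lemma C_local_pos: "C_local > 0"
  using c_pos tail_const_pos[OF delta_pos, of "DIM('a)"] by (simp add: C_local_def add_pos_pos)

text \<open>The part of \<open>u\<close> outside the triple, truncated at \<open>\<epsilon>\<close>
  around \<open>x\<close>, is compared with all of \<open>u\<close> truncated at
  \<open>3 * \<rho>\<close> around \<open>x'\<close>. Beyond that radius the smoothness of the
  kernel controls the difference; inside, its size bound against the mass of a ball about
  \<open>x'\<close> does. These are the two summands of \<open>C_local\<close>.\<close>

lemma local_truncation:
  assumes u: "integrable lebesgue u" and s: "s > 0" and x: "x \<in> hcube b s" and x': "x' \<in> hcube b s"
    and \<tau>: "\<tau> \<ge> 0" and max: "x' \<notin> maximal_set (\<lambda>y. ennreal (norm (u y))) \<tau>"
  shows "T_max u x \<le> T_max (restrict_to (triple b s) u) x +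
    (T_max u x' + ennreal (C_local * \<tau>))"
proof (rule maximal_singular_integral_le)
  fix \<epsilon> :: real assume e: "\<epsilon> > 0"
  let ?n = "DIM('a)"
  define r where "r = real ?n * s"
  \<comment> \<open>The larger of the truncation radius and the diameter bound. Where the outer part
    of \<open>u\<close> survives the truncation, \<open>norm (x - y)\<close> is at least both
    \<open>\<epsilon>\<close> and \<open>s\<close>, hence at least \<open>\<rho> / DIM('a)\<close>;
    this is the source of the factor \<open>real ?n ^ ?n\<close>.\<close>
  define \<rho> where "\<rho> = max \<epsilon> r"
  have n1: "real ?n \<ge> 1" using DIM_positive[where 'a = 'a] by linarith
  have r: "r > 0" "s \<le> r" using s n1 by (auto simp: r_def)
  have \<rho>: "\<rho> > 0" "r \<le> \<rho>" "\<epsilon> \<le> \<rho>" using r e by (auto simp: \<rho>_def)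
  let ?u1 = "restrict_to (triple b s) u" and ?v = "restrict_to (- triple b s) u"
  have ct: "- triple b s \<in> sets lebesgue"
    using sets.compl_sets[OF triple_lebesgue[of b s]] by (simp add: Compl_eq_Diff_UNIV)
  have u1: "integrable lebesgue ?u1" by (intro integrable_restrict_to triple_lebesgue u)
  have v: "integrable lebesgue ?v" by (intro integrable_restrict_to ct u)
  have nu: "(\<lambda>y. ennreal (norm (u y))) \<in> borel_measurable lebesgue"
    by (intro borel_measurable_ennreal_norm borel_measurable_integrable u)
  have uv: "u = (\<lambda>y. ?u1 y + ?v y)" by (auto simp: restrict_to_def fun_eq_iff)
  have xx': "norm (x - x') \<le> r" unfolding r_def by (rule norm_diff_le_hcube[OF x x'])
  \<comment> \<open>The ball of radius \<open>3 * \<rho>\<close> about \<open>x'\<close> swallows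
    the triple, so truncation at that radius sees only the outer part of \<open>u\<close>.\<close>
  have in_triple: "norm (x' - y) \<le> 3 * \<rho>" if "y \<in> triple b s" for y
  proof -
    have "x' \<in> triple b s"
      unfolding mem_triple
    proof
      fix i :: 'a assume i: "i \<in> Basis"
      have "b \<bullet> i \<le> x' \<bullet> i" "x' \<bullet> i < b \<bullet> i + s" using x' i by (auto simp: hcube_def)
      then show "b \<bullet> i - s \<le> x' \<bullet> i \<and> x' \<bullet> i < b \<bullet> i + 2 * s" using s by linarith
    qed
    then have "norm (x' - y) \<le> real ?n * (3 * s)"
      using that unfolding triple_def by (rule norm_diff_le_hcube)
    then show ?thesis using \<rho> by (simp add: r_def)
  qed
  let ?D = "\<lambda>y. Ktr \<epsilon> x y * ?v y - Ktr (3 * \<rho>) x' y * u y"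
  let ?g1 = "\<lambda>y. ennreal (norm (K x' y - K x y) * norm (u y)) * indicator {y. norm (x' - y) > 3 * \<rho>} y"
  let ?g2 = "\<lambda>y. ennreal (c * real ?n ^ ?n / \<rho> ^ ?n) * (ennreal (norm (u y)) * indicator (cball x' (3 * \<rho>)) y)"
  have pt: "ennreal (norm (?D y)) \<le> ?g1 y + ?g2 y" for y
  proof (cases "norm (x' - y) > 3 * \<rho>")
    case True
    then have "y \<notin> triple b s" using in_triple[of y] by linarith
    moreover have "norm (x' - y) \<le> norm (x - x') + norm (x - y)"
      using norm_triangle_ineq[of "x' - x" "x - y"] by (simp add: norm_minus_commute)
    then have "norm (x - y) > \<epsilon>" using True xx' \<rho> by linarith
    ultimately have "?D y = - ((K x' y - K x y) * u y)"
      using True by (simp add: Ktr_eq restrict_to_def algebra_simps)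
    then have "norm (?D y) = norm (K x' y - K x y) * norm (u y)" by (simp add: norm_mult)
    then show ?thesis using True by simp
  next
    case False
    then have D: "?D y = Ktr \<epsilon> x y * ?v y" by (simp add: Ktr_eq)
    have "norm (Ktr \<epsilon> x y * ?v y) \<le> c * real ?n ^ ?n / \<rho> ^ ?n * norm (u y)"
    proof (cases "norm (x - y) > \<epsilon> \<and> y \<notin> triple b s")
      case True
      then have "s \<le> norm (x - y)" using norm_diff_outside_triple[OF x] by blast
      then have "r \<le> real ?n * norm (x - y)" using n1 by (simp add: r_def mult_left_mono)
      moreover have "\<epsilon> \<le> real ?n * norm (x - y)"
        using True mult_right_mono[OF n1, of "norm (x - y)"] by simp
      ultimately have le: "\<rho> \<le> real ?n * norm (x - y)" by (simp add: \<rho>_def)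
      have xy: "norm (x - y) > 0" using True e by linarith
      have "norm (K x y) \<le> c / norm (x - y) ^ ?n" using xy by (intro size_bound) auto
      also have "\<dots> = c * real ?n ^ ?n / (real ?n * norm (x - y)) ^ ?n"
        using n1 by (simp add: power_mult_distrib)
      also have "\<dots> \<le> c * real ?n ^ ?n / \<rho> ^ ?n"
        using le \<rho> c_pos by (intro divide_left_mono power_mono mult_pos_pos zero_less_power) auto
      finally have "norm (K x y) * norm (u y) \<le> c * real ?n ^ ?n / \<rho> ^ ?n * norm (u y)"
        by (rule mult_right_mono) simp
      then show ?thesis using True by (simp add: Ktr_eq restrict_to_def norm_mult)
    next
      case False
      then have "Ktr \<epsilon> x y * ?v y = 0" by (auto simp: Ktr_eq restrict_to_def)
      moreover have "0 \<le> c * real ?n ^ ?n / \<rho> ^ ?n * norm (u y)"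
        using c_pos \<rho> by (intro mult_nonneg_nonneg divide_nonneg_nonneg) auto
      ultimately show ?thesis by (simp only: norm_zero)
    qed
    then have "ennreal (norm (?D y)) \<le> ennreal (c * real ?n ^ ?n / \<rho> ^ ?n * norm (u y))"
      unfolding D by (rule ennreal_leI)
    also have "\<dots> = ?g2 y"
      using False c_pos \<rho> by (simp add: ennreal_mult'[symmetric] dist_norm)
    finally show ?thesis by (rule add_increasing[OF zero_le])
  qed
  have "ennreal (norm (T_trunc \<epsilon> ?v x - T_trunc (3 * \<rho>) u x'))
      = ennreal (norm (\<integral>y. ?D y \<partial>lebesgue))"
    unfolding truncated_integral_Ktr using e \<rho>
    by (subst Bochner_Integration.integral_diff) (auto intro!: integrable_Ktr u v)
  also have "\<dots> \<le> (\<integral>\<^sup>+y. ennreal (norm (?D y)) \<partial>lebesgue)" by (rule norm_integral_le_nn_integral)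
  also have "\<dots> \<le> (\<integral>\<^sup>+y. ?g1 y + ?g2 y \<partial>lebesgue)" by (intro nn_integral_mono pt)
  also have "\<dots> = (\<integral>\<^sup>+y. ?g1 y \<partial>lebesgue) + (\<integral>\<^sup>+y. ?g2 y \<partial>lebesgue)"
  proof (rule nn_integral_add)
    \<comment> \<open>Measurability is known for truncated kernels. On the region of the indicator,
      truncating at \<open>3 * \<rho> - r\<close> around \<open>x\<close> changes nothing, since
      \<open>x\<close> and \<open>x'\<close> are at most \<open>r\<close> apart.\<close>
    have "(\<lambda>y. ennreal (norm (Ktr (3 * \<rho>) x' y - Ktr (3 * \<rho> - r) x y) * norm (u y)) * indicator {y. norm (x' - y) > 3 * \<rho>} y)
        \<in> borel_measurable lebesgue"
      using \<rho> r u
      by (intro borel_measurable_times_ennreal borel_measurable_indicator far_sets measurable_compose[OF _ measurable_ennreal]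
          borel_measurable_times measurable_compose[OF _ borel_measurable_norm] borel_measurable_diff Ktr_measurable
          borel_measurable_integrable) auto
    also have "(\<lambda>y. ennreal (norm (Ktr (3 * \<rho>) x' y - Ktr (3 * \<rho> - r) x y) * norm (u y)) * indicator {y. norm (x' - y) > 3 * \<rho>} y) = ?g1"
    proof
      fix y
      have "norm (x - y) > 3 * \<rho> - r" if "norm (x' - y) > 3 * \<rho>"
      proof -
        have "norm (x' - y) \<le> norm (x - x') + norm (x - y)"
          using norm_triangle_ineq[of "x' - x" "x - y"] by (simp add: norm_minus_commute)
        then show ?thesis using that xx' by linarith
      qed
      then show "ennreal (norm (Ktr (3 * \<rho>) x' y - Ktr (3 * \<rho> - r) x y) * norm (u y)) * indicator {y. norm (x' - y) > 3 * \<rho>} y = ?g1 y"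
        by (auto simp: Ktr_eq split: split_indicator)
    qed
    finally show "?g1 \<in> borel_measurable lebesgue" .
    show "?g2 \<in> borel_measurable lebesgue"
      by (intro borel_measurable_times_ennreal borel_measurable_const nu borel_measurable_indicator sets_lebesgue_borel) simp
  qed
  also have "\<dots> \<le> ennreal (c * tail_const ?n \<delta> * \<tau>) + ennreal (c * (3 * real ?n) ^ ?n * \<tau>)"
  proof (rule add_mono)
    show "(\<integral>\<^sup>+y. ?g1 y \<partial>lebesgue) \<le> ennreal (c * tail_const ?n \<delta> * \<tau>)"
      using \<rho> xx' by (intro smooth_difference[OF borel_measurable_integrable[OF u]] \<tau> not_in_maximal_set[OF max])
        (auto simp: norm_minus_commute)
    have "(\<integral>\<^sup>+y. ?g2 y \<partial>lebesgue) = ennreal (c * real ?n ^ ?n / \<rho> ^ ?n) * mass_on (cball x' (3 * \<rho>)) u"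
      by (intro nn_integral_cmult borel_measurable_times_ennreal nu borel_measurable_indicator sets_lebesgue_borel) simp
    also have "\<dots> \<le> ennreal (c * real ?n ^ ?n / \<rho> ^ ?n) * ennreal (\<tau> * (3 * \<rho>) ^ ?n)"
      using \<rho> by (intro mult_left_mono not_in_maximal_set[OF max]) auto
    also have "\<dots> = ennreal (c * real ?n ^ ?n / \<rho> ^ ?n * (\<tau> * (3 * \<rho>) ^ ?n))"
      using c_pos \<rho> by (intro ennreal_mult'[symmetric]) auto
    also have "c * real ?n ^ ?n / \<rho> ^ ?n * (\<tau> * (3 * \<rho>) ^ ?n) = c * (3 * real ?n) ^ ?n * \<tau>"
      using \<rho> by (simp add: power_mult_distrib)
    finally show "(\<integral>\<^sup>+y. ?g2 y \<partial>lebesgue) \<le> ennreal (c * (3 * real ?n) ^ ?n * \<tau>)" .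
  qed
  also have "\<dots> = ennreal (C_local * \<tau>)"
    using c_pos \<tau> tail_const_pos[OF delta_pos, of ?n]
    by (simp add: C_local_def ennreal_plus[symmetric] distrib_right del: ennreal_plus)
  finally have diff: "ennreal (norm (T_trunc \<epsilon> ?v x - T_trunc (3 * \<rho>) u x')) \<le> ennreal (C_local * \<tau>)" .
  let ?a = "T_trunc \<epsilon> ?u1 x" and ?b = "T_trunc (3 * \<rho>) u x'"
    and ?d = "T_trunc \<epsilon> ?v x - T_trunc (3 * \<rho>) u x'"
  have "T_trunc \<epsilon> u x = ?a + T_trunc \<epsilon> ?v x"
    by (subst uv) (rule truncated_integral_add[OF e u1 v])
  then have eq: "T_trunc \<epsilon> u x = ?a + (?b + ?d)" by simp
  have "norm (T_trunc \<epsilon> u x) \<le> norm ?a + (norm ?b + norm ?d)"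
    unfolding eq by (rule order_trans[OF norm_triangle_ineq add_left_mono[OF norm_triangle_ineq]])
  then have "ennreal (norm (T_trunc \<epsilon> u x)) \<le> ennreal (norm ?a + (norm ?b + norm ?d))"
    by (rule ennreal_leI)
  also have "\<dots> = ennreal (norm ?a) + (ennreal (norm ?b) + ennreal (norm ?d))" by simp
  also have "\<dots> \<le> T_max ?u1 x + (T_max u x' + ennreal (C_local * \<tau>))"
    using e \<rho> by (intro add_mono truncated_integral_le_maximal diff) auto
  finally show "ennreal (norm (T_trunc \<epsilon> u x)) \<le> T_max ?u1 x +
      (T_max u x' + ennreal (C_local * \<tau>))" .
qed

end

context cz_operator begin

text \<open>The multiple of the mean over the triple that serves as level. It brings the exceptional
  set down to the fraction \<open>1 / 2 ^ (DIM('a) + 2)\<close> of the cube,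
  \<open>3 ^ DIM('a)\<close> being the volume ratio of triple and cube; the summand 1 keeps the mean
  itself below the level.\<close>

definition A_step :: real where
  "A_step = 1 + (C_weak + unit_ball_vol DIM('a) * 5 ^ DIM('a)) * 3 ^ DIM('a) * 2 ^ (DIM('a) + 2)"

definition C_step :: real where "C_step = (C_weak + C_local) * A_step"

lemma A_step_pos: "A_step > 0"
  using C_weak_pos by (simp add: A_step_def add_pos_nonneg)

lemma C_step_pos: "C_step > 0"
  using C_weak_pos C_local_pos A_step_pos by (simp add: C_step_def)

text \<open>The cubes come from the stopping rule applied to the indicator of the exceptional set
  \<open>E\<close> at level \<open>\<sigma> = 1 / 2 ^ (DIM('a) + 1)\<close>. The lower bound makes
  their total measure at most \<open>2 ^ (DIM('a) + 1)\<close> times that of \<open>E\<close>, that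
  is, half of the cube. The upper bound lets \<open>E\<close> fill at most half of each, so each
  contains a point outside \<open>E\<close>. Off the cubes the indicator is almost everywhere below
  1, hence 0.\<close>

proposition local_step:
  assumes f: "integrable lebesgue f" and s: "s > 0"
  obtains B :: "nat \<Rightarrow> 'a" and t :: "nat \<Rightarrow> real" and N where
    "\<And>j. t j \<ge> 0" "disjoint_family (\<lambda>j. hcube (B j) (t j))"
    "emeasure lebesgue (\<Union>j. hcube (B j) (t j)) \<le> ennreal (s ^ DIM('a) / 2)"
    "N \<in> null_sets lebesgue"
    "\<And>x. x \<in> hcube b s \<Longrightarrow> x \<notin> N \<Longrightarrow> x \<notin> (\<Union>j. hcube (B j) (t j)) \<Longrightarrow>
      T_max (restrict_to (triple b s) f) x \<le> ennreal C_step * HL_maximal f x"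
    "\<And>x j. x \<in> hcube (B j) (t j) \<Longrightarrow>
      T_max (restrict_to (triple b s) f) x \<le>
        T_max (restrict_to (triple (B j) (t j)) f) x + ennreal C_step * HL_maximal f x"
proof -
  let ?n = "DIM('a)" and ?w = "unit_ball_vol (real DIM('a))" and ?\<mu> = "emeasure (lebesgue :: 'a measure)"
  define u where "u = restrict_to (triple b s) f"
  define I where "I = mass u"
  have u: "integrable lebesgue u"
    unfolding u_def by (intro integrable_restrict_to triple_lebesgue f)
  have nu: "(\<lambda>y. ennreal (norm (u y))) \<in> borel_measurable lebesgue"
    by (intro borel_measurable_ennreal_norm borel_measurable_integrable u)
  have I_f: "I = mass_on (triple b s) f"
    unfolding I_def u_def by (rule nn_integral_restrict_to)
  have "I < \<infinity>" using u unfolding I_def by (simp add: integrable_iff_bounded)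
  then obtain i where i: "I = ennreal i" "i \<ge> 0"
    by (metis ennreal_cases infinity_ennreal_def less_irrefl)
  show ?thesis
  proof (cases "i = 0")
    \<comment> \<open>With zero mass the level \<open>\<tau>\<close> would be 0; here
      \<open>T_max u\<close> vanishes identically and the family of empty cubes serves.\<close>
    case True
    then have "I = 0" using i by simp
    then have "AE y in lebesgue. ennreal (norm (u y)) = 0"
      unfolding I_def using nn_integral_0_iff_AE[OF nu] by blast
    then have "AE y in lebesgue. u y = 0" by simp
    then have "T_max u x = T_max (\<lambda>y. 0) x" for x
      by (intro maximal_singular_integral_cong_AE borel_measurable_integrable u borel_measurable_const)
    moreover have "T_max (\<lambda>y. 0) x \<le> 0" for x
      by (rule maximal_singular_integral_le) (simp add: truncated_integral_Ktr)
    ultimately have z: "T_max u x \<le> 0" for x by simp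
    show ?thesis
    proof (rule that[of "\<lambda>_. 0" "\<lambda>_. b" "{}"])
      show "T_max (restrict_to (triple b s) f) x \<le> ennreal C_step * HL_maximal f x" for x
        using z[of x] unfolding u_def by (rule order_trans) (rule zero_le)
    qed (simp_all add: hcube_empty disjoint_family_on_def)
  next
    case False
    then have i0: "i > 0" using i by simp
    define \<tau> where "\<tau> = A_step * i / (3 * s) ^ ?n"
    have s3: "(3 * s) ^ ?n > 0" using s by simp
    have \<tau>: "\<tau> > 0" using A_step_pos i0 s3 by (simp add: \<tau>_def)
    have A1: "A_step \<ge> 1" using C_weak_pos by (simp add: A_step_def)
    have \<tau>_HL: "ennreal (C * \<tau>) \<le> ennreal (C * A_step) * HL_maximal f x" if "x \<in> hcube b s" "C \<ge> 0" for x C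
    proof -
      have "ennreal (C * \<tau>) = ennreal (C * A_step) * ennreal (i / (3 * s) ^ ?n)"
        using A_step_pos i0 s3 that by (simp add: \<tau>_def ennreal_mult[symmetric])
      also have "ennreal (i / (3 * s) ^ ?n) = I / ennreal ((3 * s) ^ ?n)"
        using i s3 by (simp add: divide_ennreal)
      also have "\<dots> \<le> HL_maximal f x"
        unfolding I_f by (rule average_le_HL_maximal[OF that(1) s])
      finally show ?thesis by (simp add: mult_left_mono)
    qed
    have supp_u: "u y \<noteq> 0 \<Longrightarrow> y \<in> hcube (b - s *\<^sub>R One) (3 * s)" for y
      by (auto simp: u_def restrict_to_def triple_def split: if_splits)
    have I_le: "I \<le> ennreal (\<tau> * (3 * s) ^ ?n)"
    proof -
      have "i \<le> \<tau> * (3 * s) ^ ?n"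
        using mult_right_mono[OF A1, of i] i0 s by (simp add: \<tau>_def)
      then show ?thesis using i by (simp add: ennreal_leI)
    qed
    define E where "E = hcube b s \<inter> ({x. ennreal (C_weak * \<tau>) < T_max u x} \<union>
      maximal_set (\<lambda>y. ennreal (norm (u y))) \<tau>)"
    have W: "{x. ennreal (C_weak * \<tau>) < T_max u x} \<in> sets lebesgue"
      by (intro lebesgue_set_greater maximal_singular_integral_measurable u)
    have E: "E \<in> sets lebesgue"
      unfolding E_def by (intro sets.Int sets.Un W maximal_set_sets hcube_lebesgue)
    have \<mu>E: "?\<mu> E \<le> ennreal (s ^ ?n / 2 ^ (?n + 2))"
    proof -
      have "?\<mu> E \<le> ?\<mu> ({x. ennreal (C_weak * \<tau>) < T_max u x} \<union>
          maximal_set (\<lambda>y. ennreal (norm (u y))) \<tau>)"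
        by (intro emeasure_mono sets.Un W maximal_set_sets) (auto simp: E_def)
      also have "\<dots> \<le> ?\<mu> {x. ennreal (C_weak * \<tau>) < T_max u x} +
          ?\<mu> (maximal_set (\<lambda>y. ennreal (norm (u y))) \<tau>)"
        by (intro emeasure_subadditive W maximal_set_sets)
      also have "\<dots> \<le> ennreal (C_weak / \<tau>) * I + ennreal (?w * 5 ^ ?n / \<tau>) * I"
      proof (rule add_mono)
        show "?\<mu> {x. ennreal (C_weak * \<tau>) < T_max u x} \<le> ennreal (C_weak / \<tau>) * I"
          unfolding I_def
          by (rule weak_type_in_cube[OF u supp_u _ \<tau> I_le[unfolded I_def]]) (use s in auto)
        show "?\<mu> (maximal_set (\<lambda>y. ennreal (norm (u y))) \<tau>) \<le> ennreal (?w * 5 ^ ?n / \<tau>) * I"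
          unfolding I_def by (rule maximal_set_weak_type[OF nu \<tau>])
      qed
      also have "\<dots> = ennreal ((C_weak + ?w * 5 ^ ?n) * i / \<tau>)"
        unfolding i(1) using C_weak_pos i(2) \<tau>
        by (simp add: ennreal_mult[symmetric] ennreal_plus[symmetric] add_divide_distrib distrib_right del: ennreal_plus)
      also have "\<dots> \<le> ennreal (s ^ ?n / 2 ^ (?n + 2))"
      proof (rule ennreal_leI)
        define D where "D = C_weak + ?w * 5 ^ ?n"
        have "D * 3 ^ ?n * 2 ^ (?n + 2) \<le> A_step" by (simp add: A_step_def D_def)
        then have "D * 3 ^ ?n / A_step \<le> 1 / 2 ^ (?n + 2)"
          using A_step_pos by (simp add: field_simps)
        then have "D * 3 ^ ?n / A_step * s ^ ?n \<le> 1 / 2 ^ (?n + 2) * s ^ ?n"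
          using s by (intro mult_right_mono) auto
        moreover have "D * i / \<tau> = D * 3 ^ ?n / A_step * s ^ ?n"
          using i0 A_step_pos s by (simp add: \<tau>_def power_mult_distrib)
        ultimately show "(C_weak + ?w * 5 ^ ?n) * i / \<tau> \<le> s ^ ?n / 2 ^ (?n + 2)"
          unfolding D_def by simp
      qed
      finally show ?thesis .
    qed
    have indE: "(indicator E :: 'a \<Rightarrow> ennreal) \<in> borel_measurable lebesgue"
      by (rule borel_measurable_indicator[OF E])
    have ind_int: "(\<integral>\<^sup>+y\<in>P. indicator E y \<partial>lebesgue) = ?\<mu> (P \<inter> E)" if "P \<in> sets lebesgue" for P
      unfolding nn_integral_indicator[OF sets.Int[OF that E], symmetric]
      by (intro nn_integral_cong) (simp split: split_indicator)
    define \<sigma> where "\<sigma> = 1 / (2::real) ^ (?n + 1)"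
    have \<sigma>: "\<sigma> > 0" "\<sigma> < 1" "2 ^ ?n * \<sigma> = 1 / 2"
      using one_less_power[of "2::real" "?n + 1"] by (simp_all add: \<sigma>_def)
    have avgE: "(\<integral>\<^sup>+y\<in>hcube b s. indicator E y \<partial>lebesgue) \<le> ennreal (\<sigma> * s ^ ?n)"
    proof -
      have "hcube b s \<inter> E = E" by (auto simp: E_def)
      then have "(\<integral>\<^sup>+y\<in>hcube b s. indicator E y \<partial>lebesgue) = ?\<mu> E"
        using ind_int[OF hcube_lebesgue[of b s]] by simp
      also have "\<dots> \<le> ennreal (s ^ ?n / 2 ^ (?n + 2))" by (rule \<mu>E)
      also have "\<dots> \<le> ennreal (\<sigma> * s ^ ?n)"
        using s by (intro ennreal_leI) (simp add: \<sigma>_def field_simps)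
      finally show ?thesis .
    qed
    obtain B :: "nat \<Rightarrow> 'a" and t where t0: "\<And>j. t j \<ge> 0"
      and disj: "disjoint_family (\<lambda>j. hcube (B j) (t j))"
      and sub: "\<And>j. hcube (B j) (t j) \<subseteq> hcube b s"
      and lower: "\<And>j. ennreal (\<sigma> * t j ^ ?n) \<le> (\<integral>\<^sup>+y\<in>hcube (B j) (t j). indicator E y \<partial>lebesgue)"
      and upper: "\<And>j. (\<integral>\<^sup>+y\<in>hcube (B j) (t j). indicator E y \<partial>lebesgue) \<le> ennreal (2 ^ ?n * \<sigma> * t j ^ ?n)"
      and ae: "AE x in lebesgue. x \<in> hcube b s \<longrightarrow> x \<notin> (\<Union>j. hcube (B j) (t j)) \<longrightarrow> indicator E x \<le> ennreal \<sigma>"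
      by (rule calderon_zygmund_cubes[OF indE s \<sigma>(1) avgE]) (rule that, assumption+)
    obtain N where N: "N \<in> null_sets lebesgue"
      "{x \<in> space lebesgue. \<not> (x \<in> hcube b s \<longrightarrow> x \<notin> (\<Union>j. hcube (B j) (t j)) \<longrightarrow> indicator E x \<le> ennreal \<sigma>)} \<subseteq> N"
      by (rule AE_E[OF ae], rule that, rule null_setsI, assumption+)
    have good: "T_max u x \<le> ennreal (C_weak * \<tau>)"
        "x \<notin> maximal_set (\<lambda>y. ennreal (norm (u y))) \<tau>" if "x \<in> hcube b s" "x \<notin> E" for x
      using that by (auto simp: E_def not_less)
    have C_le: "C_weak * A_step \<le> C_step"
      using C_local_pos A_step_pos by (simp add: C_step_def mult_right_mono)
    show ?thesis
    proof (rule that[of t B N])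
      show "?\<mu> (\<Union>j. hcube (B j) (t j)) \<le> ennreal (s ^ ?n / 2)"
      proof -
        have "ennreal (2 ^ (?n + 1)) * ennreal (s ^ ?n / 2 ^ (?n + 2)) = ennreal (s ^ ?n / 2)"
          using s by (simp add: ennreal_mult[symmetric] field_simps)
        have "?\<mu> (\<Union>j. hcube (B j) (t j)) = (\<Sum>j. ?\<mu> (hcube (B j) (t j)))"
          by (rule suminf_emeasure[symmetric, OF image_subsetI[OF hcube_lebesgue] disj])
        also have "\<dots> \<le> (\<Sum>j. ennreal (2 ^ (?n + 1)) * ?\<mu> (hcube (B j) (t j) \<inter> E))"
        proof (intro suminf_le)
          fix j
          have "?\<mu> (hcube (B j) (t j)) = ennreal (2 ^ (?n + 1)) * ennreal (\<sigma> * t j ^ ?n)"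
            unfolding emeasure_hcube[OF t0] using t0[of j] by (simp add: \<sigma>_def ennreal_mult[symmetric])
          also have "\<dots> \<le> ennreal (2 ^ (?n + 1)) * ?\<mu> (hcube (B j) (t j) \<inter> E)"
            using lower[of j] unfolding ind_int[OF hcube_lebesgue] by (rule mult_left_mono) simp
          finally show "?\<mu> (hcube (B j) (t j)) \<le> ennreal (2 ^ (?n + 1)) * ?\<mu> (hcube (B j) (t j) \<inter> E)" .
        qed auto
        also have "\<dots> = ennreal (2 ^ (?n + 1)) * (\<Sum>j. ?\<mu> (hcube (B j) (t j) \<inter> E))" by simp
        also have "(\<Sum>j. ?\<mu> (hcube (B j) (t j) \<inter> E)) = ?\<mu> (\<Union>j. hcube (B j) (t j) \<inter> E)"
          using disj by (intro suminf_emeasure image_subsetI sets.Int hcube_lebesgue E) (auto simp: disjoint_family_on_def)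
        also have "\<dots> \<le> ?\<mu> E" by (intro emeasure_mono E) auto
        also have "\<dots> \<le> ennreal (s ^ ?n / 2 ^ (?n + 2))" by (rule \<mu>E)
        also have "ennreal (2 ^ (?n + 1)) * ennreal (s ^ ?n / 2 ^ (?n + 2)) = ennreal (s ^ ?n / 2)"
          by fact
        finally show ?thesis by (simp add: mult_left_mono)
      qed
      show "N \<in> null_sets lebesgue" by (rule N(1))
      show "T_max (restrict_to (triple b s) f) x \<le> ennreal C_step * HL_maximal f x"
        if x: "x \<in> hcube b s" "x \<notin> N" "x \<notin> (\<Union>j. hcube (B j) (t j))" for x
      proof -
        have "indicator E x \<le> ennreal \<sigma>" using N(2) x by auto
        then have "x \<notin> E" using \<sigma> by (auto simp: ennreal_le_iff indicator_def split: if_splits)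
        then have "T_max u x \<le> ennreal (C_weak * \<tau>)" using good(1) x by blast
        also have "\<dots> \<le> ennreal (C_weak * A_step) * HL_maximal f x"
          using C_weak_pos by (intro \<tau>_HL x) simp
        also have "\<dots> \<le> ennreal C_step * HL_maximal f x"
          by (intro mult_right_mono ennreal_leI C_le) simp
        finally show ?thesis unfolding u_def .
      qed
      show "T_max (restrict_to (triple b s) f) x \<le>
          T_max (restrict_to (triple (B j) (t j)) f) x + ennreal C_step * HL_maximal f x"
        if x: "x \<in> hcube (B j) (t j)" for x j
      proof -
        have tj: "t j > 0"
          using x hcube_empty[of "t j" "B j"] by (cases "t j \<le> 0") auto
        have "\<exists>x'. x' \<in> hcube (B j) (t j) \<and> x' \<notin> E"
        proof (rule ccontr)
          assume "\<nexists>x'. x' \<in> hcube (B j) (t j) \<and> x' \<notin> E"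
          then have "hcube (B j) (t j) \<inter> E = hcube (B j) (t j)" by blast
          then have "?\<mu> (hcube (B j) (t j)) \<le> ennreal (2 ^ ?n * \<sigma> * t j ^ ?n)"
            using upper[of j] unfolding ind_int[OF hcube_lebesgue] by simp
          then have "t j ^ ?n \<le> 2 ^ ?n * \<sigma> * t j ^ ?n"
            unfolding emeasure_hcube[OF t0] using tj \<sigma> by (subst (asm) ennreal_le_iff) auto
          then have "t j ^ ?n \<le> 1 / 2 * t j ^ ?n" unfolding \<sigma>(3) .
          moreover have "t j ^ ?n > 0" using tj by simp
          ultimately show False by linarith
        qed
        then obtain x' where x': "x' \<in> hcube (B j) (t j)" "x' \<notin> E" by blast
        then have x'b: "x' \<in> hcube b s" using sub by blast
        \<comment> \<open>The triple of a subcube stays inside the triple of the cube, so the local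
          part involves \<open>f\<close> itself and the next round can start from it.\<close>
        have "restrict_to (triple (B j) (t j)) u = restrict_to (triple (B j) (t j)) f"
          using triple_mono[OF sub tj] by (auto simp: u_def restrict_to_def fun_eq_iff)
        then have "T_max u x \<le> T_max (restrict_to (triple (B j) (t j)) f) x +
            (T_max u x' + ennreal (C_local * \<tau>))"
          using local_truncation[OF u tj x x'(1) less_imp_le[OF \<tau>] good(2)[OF x'b x'(2)]] by simp
        also have "\<dots> \<le> T_max (restrict_to (triple (B j) (t j)) f) x +
            (ennreal (C_weak * \<tau>) + ennreal (C_local * \<tau>))"
          by (intro add_left_mono add_right_mono good(1) x'b x'(2))
        also have "ennreal (C_weak * \<tau>) + ennreal (C_local * \<tau>) = ennreal ((C_weak + C_local) * \<tau>)"
          using C_weak_pos C_local_pos \<tau> by (simp add: ennreal_plus[symmetric] distrib_right del: ennreal_plus)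
        also have "\<dots> \<le> ennreal C_step * HL_maximal f x"
          unfolding C_step_def using C_weak_pos C_local_pos x sub by (intro \<tau>_HL) auto
        finally show ?thesis unfolding u_def by (simp add: add_left_mono)
      qed
    qed (use t0 disj in auto)
  qed
qed

text \<open>The induction hypothesis is applied to all cubes of a step at once: their exceptional
  sets together form the next one, up to the null set \<open>N\<close>. The measures halve because
  the cubes fill at most half of the original one, and the bounds add because every round refers to
  the same \<open>HL_maximal f\<close>.\<close>

proposition local_exponential_decay:
  assumes f: "integrable lebesgue f" and s: "s \<ge> 0"
  shows "\<exists>E\<in>sets lebesgue. emeasure lebesgue E \<le> ennreal ((1 / 2) ^ m * s ^ DIM('a)) \<and>
    (\<forall>x\<in>hcube b s - E. T_max (restrict_to (triple b s) f) x
      \<le> ennreal (real m * C_step) * HL_maximal f x)"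
  using s
proof (induction m arbitrary: b s)
  \<comment> \<open>With no round performed, the exceptional set is the whole cube.\<close>
  case 0
  then show ?case
    by (intro bexI[of _ "hcube b s"]) (simp_all add: emeasure_hcube hcube_lebesgue)
next
  case (Suc m)
  let ?n = "DIM('a)" and ?\<mu> = "emeasure (lebesgue :: 'a measure)"
  show ?case
  \<comment> \<open>The families delivered by \<open>local_step\<close> may contain empty cubes, and
    the induction hypothesis has to cover them.\<close>
  proof (cases "s = 0")
    case True
    then show ?thesis by (intro bexI[of _ "{}"]) (simp_all add: hcube_empty)
  next
    case False
    then have s: "s > 0" using Suc.prems by simp
    obtain B :: "nat \<Rightarrow> 'a" and t and N where t0: "\<And>j. t j \<ge> 0"
      and disj: "disjoint_family (\<lambda>j. hcube (B j) (t j))"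
      and half: "?\<mu> (\<Union>j. hcube (B j) (t j)) \<le> ennreal (s ^ ?n / 2)"
      and N: "N \<in> null_sets lebesgue"
      and off: "\<And>x. x \<in> hcube b s \<Longrightarrow> x \<notin> N \<Longrightarrow> x \<notin> (\<Union>j. hcube (B j) (t j)) \<Longrightarrow>
        T_max (restrict_to (triple b s) f) x \<le> ennreal C_step * HL_maximal f x"
      and on: "\<And>x j. x \<in> hcube (B j) (t j) \<Longrightarrow>
        T_max (restrict_to (triple b s) f) x \<le>
          T_max (restrict_to (triple (B j) (t j)) f) x + ennreal C_step * HL_maximal f x"
      by (rule local_step[OF f s, of b]) (rule that, assumption+)
    have "\<forall>j. \<exists>E. E \<in> sets lebesgue \<and> ?\<mu> E \<le> ennreal ((1 / 2) ^ m * t j ^ ?n) \<and>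
      (\<forall>x\<in>hcube (B j) (t j) - E. T_max (restrict_to (triple (B j) (t j)) f) x
        \<le> ennreal (real m * C_step) * HL_maximal f x)"
      using Suc.IH[OF t0] by blast
    then obtain E where E: "\<And>j. E j \<in> sets lebesgue" "\<And>j. ?\<mu> (E j) \<le> ennreal ((1 / 2) ^ m * t j ^ ?n)"
      and E_le: "\<And>j x. x \<in> hcube (B j) (t j) - E j \<Longrightarrow>
        T_max (restrict_to (triple (B j) (t j)) f) x \<le> ennreal (real m * C_step) * HL_maximal f x"
      by metis
    have UE: "(\<Union>j. E j) \<in> sets lebesgue" by (intro sets.countable_UN image_subsetI E(1))
    have Nn: "N \<in> sets lebesgue" "?\<mu> N = 0" using N by auto
    have "?\<mu> ((\<Union>j. E j) \<union> N) = ?\<mu> (\<Union>j. E j)"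
      by (rule emeasure_Un_null_set[OF UE N])
    also have "\<dots> \<le> (\<Sum>j. ?\<mu> (E j))"
      by (intro emeasure_subadditive_countably image_subsetI E(1))
    also have "\<dots> \<le> (\<Sum>j. ennreal ((1 / 2) ^ m) * ?\<mu> (hcube (B j) (t j)))"
    proof (intro suminf_le)
      fix j show "?\<mu> (E j) \<le> ennreal ((1 / 2) ^ m) * ?\<mu> (hcube (B j) (t j))"
        unfolding emeasure_hcube[OF t0] using E(2)[of j] t0[of j]
        by (simp add: ennreal_mult[symmetric])
    qed auto
    also have "\<dots> = ennreal ((1 / 2) ^ m) * (\<Sum>j. ?\<mu> (hcube (B j) (t j)))" by simp
    also have "(\<Sum>j. ?\<mu> (hcube (B j) (t j))) = ?\<mu> (\<Union>j. hcube (B j) (t j))"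
      by (rule suminf_emeasure[OF image_subsetI[OF hcube_lebesgue] disj])
    also have "ennreal ((1 / 2) ^ m) * \<dots> \<le> ennreal ((1 / 2) ^ m) * ennreal (s ^ ?n / 2)"
      by (intro mult_left_mono half) simp
    also have "\<dots> = ennreal ((1 / 2) ^ Suc m * s ^ ?n)"
      using s by (simp add: ennreal_mult[symmetric])
    finally have small: "?\<mu> ((\<Union>j. E j) \<union> N) \<le> ennreal ((1 / 2) ^ Suc m * s ^ ?n)" .
    have C_sum: "ennreal (real m * C_step) * M + ennreal C_step * M = ennreal (real (Suc m) * C_step) * M" for M
    proof -
      have "ennreal (real m * C_step) + ennreal C_step = ennreal (real (Suc m) * C_step)"
        using C_step_pos by (simp add: ennreal_plus[symmetric] algebra_simps del: ennreal_plus)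
      then show ?thesis by (simp only: distrib_right[symmetric])
    qed
    have "T_max (restrict_to (triple b s) f) x \<le> ennreal (real (Suc m) * C_step) * HL_maximal f x"
      if x: "x \<in> hcube b s - ((\<Union>j. E j) \<union> N)" for x
    proof (cases "x \<in> (\<Union>j. hcube (B j) (t j))")
      case True
      then obtain j where j: "x \<in> hcube (B j) (t j)" by blast
      then have "x \<in> hcube (B j) (t j) - E j" using x by blast
      then have "T_max (restrict_to (triple b s) f) x
          \<le> ennreal (real m * C_step) * HL_maximal f x + ennreal C_step * HL_maximal f x"
        using on[OF j] E_le[of x j] by (meson add_right_mono order_trans)
      then show ?thesis unfolding C_sum .
    next
      case False
      then have "T_max (restrict_to (triple b s) f) x \<le> ennreal C_step * HL_maximal f x"
        using x by (intro off) auto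
      also have "\<dots> \<le> ennreal (real m * C_step) * HL_maximal f x + ennreal C_step * HL_maximal f x"
        by (rule add_increasing[OF zero_le order_refl])
      finally show ?thesis unfolding C_sum .
    qed
    then show ?thesis
      using small UE Nn(1) by (intro bexI[of _ "(\<Union>j. E j) \<union> N"] conjI ballI) (auto intro: sets.Un)
  qed
qed

end

section \<open>Exponential decay\<close>

lemma CZ_operator_imp_cz_operator:
  fixes T :: "('a::euclidean_space \<Rightarrow> complex) \<Rightarrow> 'a \<Rightarrow> complex"
  assumes "CZ_operator T K"
  shows "\<exists>c \<delta> S CS. cz_operator K c \<delta> S CS"
proof -
  have K: "CZ_kernel K" using assms unfolding CZ_operator_def by blast
  then obtain c0 \<delta> where size: "\<And>x y. x \<noteq> y \<Longrightarrow> norm (K x y) \<le> c0 / norm (x - y) ^ DIM('a)"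
    and \<delta>: "\<delta> > 0"
    and smooth: "\<And>x y z. 2 * norm (x - z) < norm (x - y) \<Longrightarrow>
      norm (K x y - K z y) + norm (K y x - K y z)
        \<le> c0 * (norm (x - z) powr \<delta> / norm (x - y) powr (real DIM('a) + \<delta>))"
    unfolding CZ_kernel_def by blast
  obtain S where S: "bounded_operator_L2 S" "\<forall>f\<in>Cc_infinity. AE x in lebesgue. S f x = T f x"
    using assms unfolding CZ_operator_def by blast
  obtain C0 where C0: "\<And>f. f \<in> L2 \<Longrightarrow> L2_norm (S f) \<le> C0 * L2_norm f"
    using S(1) unfolding bounded_operator_L2_def by blast
  \<comment> \<open>The maximum with 1 makes the constant positive, as the locale demands, and only
    weakens the bounds.\<close>
  define c where "c = max c0 1"
  define CS where "CS = max C0 1"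
  have smooth': "norm (K x y - K z y) + norm (K y x - K y z)
        \<le> c * (norm (x - z) powr \<delta> / norm (x - y) powr (real DIM('a) + \<delta>))"
    if "2 * norm (x - z) < norm (x - y)" for x y z
    by (rule order_trans[OF smooth[OF that]], rule mult_right_mono) (simp_all add: c_def)
  have "cz_operator K c \<delta> S CS"
  proof unfold_locales
    show "c > 0" "CS > 0" by (auto simp: c_def CS_def)
    show "\<delta> > 0" by (rule \<delta>)
    show "norm (K x y) \<le> c / norm (x - y) ^ DIM('a)" if "x \<noteq> y" for x y
      by (rule order_trans[OF size[OF that]], rule divide_right_mono) (simp_all add: c_def)
    show "norm (K x y - K z y) \<le> c * (norm (x - z) powr \<delta> / norm (x - y) powr (real DIM('a) + \<delta>))"
      if "2 * norm (x - z) < norm (x - y)" for x y z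
      using smooth'[OF that] norm_ge_zero[of "K y x - K y z"] by linarith
    show "norm (K y x - K y z) \<le> c * (norm (x - z) powr \<delta> / norm (x - y) powr (real DIM('a) + \<delta>))"
      if "2 * norm (x - z) < norm (x - y)" for x y z
      using smooth'[OF that] norm_ge_zero[of "K x y - K z y"] by linarith
    show "ae_linear_on L2 S" "\<And>f. f \<in> L2 \<Longrightarrow> S f \<in> L2"
      using S(1) by (auto simp: bounded_operator_L2_def)
    show "L2_norm (S f) \<le> CS * L2_norm f" if "f \<in> L2" for f
      by (rule order_trans[OF C0[OF that]], rule mult_right_mono) (simp_all add: CS_def L2_norm_def)
    show "AE x in lebesgue. x \<notin> supp \<phi> \<longrightarrow> S \<phi> x = (\<integral>y. K x y * \<phi> y \<partial>lebesgue)" if "\<phi> \<in> Cc_infinity" for \<phi>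
    proof -
      have "AE x in lebesgue. S \<phi> x = T \<phi> x" using S(2) that by blast
      moreover have "AE x in lebesgue. x \<notin> supp \<phi> \<longrightarrow> T \<phi> x = (\<integral>y. K x y * \<phi> y \<partial>lebesgue)"
        using assms that unfolding CZ_operator_def by blast
      ultimately show ?thesis by eventually_elim simp
    qed
  qed
  then show ?thesis by blast
qed

text \<open>Growing a closed cube by a small \<open>\<theta>\<close> on every side keeps its mean
  above \<open>t\<close>, by continuity of the volume in the side length, and the grown cube
  contains a ball about every point of the old one. Measurability of the uncountable supremum
  follows.\<close>

lemma open_HL_maximal:
  fixes f :: "'a::euclidean_space \<Rightarrow> complex"
  assumes f: "integrable lebesgue f"
  shows "open {x. t < HL_maximal f x}"
proof (rule openI)
  let ?n = "DIM('a)"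
  fix x assume "x \<in> {x. t < HL_maximal f x}"
  then obtain Q where Q: "is_cube Q" "x \<in> Q"
      "t < mass_on Q f / emeasure lebesgue Q"
    by (auto simp: HL_maximal_def less_SUP_iff)
  then obtain a l where al: "l > 0" "Q = cbox a (a + l *\<^sub>R One)" by (auto simp: is_cube_def)
  define w where "w = mass_on Q f"
  have "w \<le> mass f"
    unfolding w_def by (intro nn_integral_mono) (simp split: split_indicator)
  also have "\<dots> < \<infinity>" using f by (simp add: integrable_iff_bounded)
  finally obtain v where v: "w = ennreal v" "v \<ge> 0"
    by (metis ennreal_cases infinity_ennreal_def less_irrefl)
  have avg: "w / ennreal (L ^ ?n) = ennreal (v / L ^ ?n)" if "L > 0" for L
    using v that by (simp add: divide_ennreal)
  have t: "t < ennreal (v / l ^ ?n)"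
    using Q(3) emeasure_cube_cbox[of l a] al avg[of l] by (simp add: w_def)
  have "((\<lambda>\<theta>. ennreal (v / (l + 2 * \<theta>) ^ ?n)) \<longlongrightarrow> ennreal (v / (l + 2 * 0) ^ ?n)) (at_right 0)"
    using al by (intro tendsto_intros) auto
  then have "eventually (\<lambda>\<theta>. t < ennreal (v / (l + 2 * \<theta>) ^ ?n)) (at_right 0)"
    by (rule order_tendstoD) (use t in simp)
  then obtain d where d: "d > 0" "\<And>\<theta>. 0 < \<theta> \<Longrightarrow> \<theta> < d \<Longrightarrow> t < ennreal (v / (l + 2 * \<theta>) ^ ?n)"
    unfolding eventually_at_right_field by auto
  define \<theta> where "\<theta> = d / 2"
  have \<theta>: "\<theta> > 0" "\<theta> < d" using d(1) by (auto simp: \<theta>_def)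
  note t\<theta> = d(2)[OF \<theta>]
  let ?Q' = "cbox (a - \<theta> *\<^sub>R One) (a - \<theta> *\<^sub>R One + (l + 2 * \<theta>) *\<^sub>R One)"
  have mem: "z \<in> ?Q' \<longleftrightarrow> (\<forall>i\<in>Basis. a \<bullet> i - \<theta> \<le> z \<bullet> i \<and> z \<bullet> i \<le> a \<bullet> i + l + \<theta>)" for z
    by (simp add: mem_box inner_simps algebra_simps)
  have memQ: "z \<in> Q \<longleftrightarrow> (\<forall>i\<in>Basis. a \<bullet> i \<le> z \<bullet> i \<and> z \<bullet> i \<le> a \<bullet> i + l)" for z
    unfolding al(2) by (simp add: mem_box inner_simps)
  have "Q \<subseteq> ?Q'"
  proof
    fix z assume z: "z \<in> Q"
    show "z \<in> ?Q'"
      unfolding mem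
    proof
      fix i :: 'a assume "i \<in> Basis"
      then have "a \<bullet> i \<le> z \<bullet> i \<and> z \<bullet> i \<le> a \<bullet> i + l" using z memQ by blast
      then show "a \<bullet> i - \<theta> \<le> z \<bullet> i \<and> z \<bullet> i \<le> a \<bullet> i + l + \<theta>" using \<theta>(1) by linarith
    qed
  qed
  then have wQ': "w \<le> (mass_on ?Q' f)"
    unfolding w_def by (rule nn_set_integral_mono_set)
  have cube: "is_cube ?Q'"
    unfolding is_cube_def using al \<theta> by (intro exI[of _ "a - \<theta> *\<^sub>R One"] exI[of _ "l + 2 * \<theta>"]) simp
  show "\<exists>e>0. ball x e \<subseteq> {x. t < HL_maximal f x}"
  proof (intro exI conjI subsetI)
    show "\<theta> > 0" by (rule \<theta>)
    fix z assume z: "z \<in> ball x \<theta>"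
    have "z \<in> ?Q'"
      unfolding mem
    proof
      fix i :: 'a assume i: "i \<in> Basis"
      then have "\<bar>(x - z) \<bullet> i\<bar> \<le> norm (x - z)" by (rule Basis_le_norm)
      then have "\<bar>x \<bullet> i - z \<bullet> i\<bar> < \<theta>" using z by (simp add: dist_norm inner_diff_left)
      moreover have "a \<bullet> i \<le> x \<bullet> i \<and> x \<bullet> i \<le> a \<bullet> i + l" using Q(2) memQ i by blast
      ultimately show "a \<bullet> i - \<theta> \<le> z \<bullet> i \<and> z \<bullet> i \<le> a \<bullet> i + l + \<theta>" by linarith
    qed
    have "t < ennreal (v / (l + 2 * \<theta>) ^ ?n)" by (rule t\<theta>)
    also have "\<dots> = w / ennreal ((l + 2 * \<theta>) ^ ?n)" using al \<theta> by (intro avg[symmetric]) simp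
    also have "\<dots> \<le> (mass_on ?Q' f) / ennreal ((l + 2 * \<theta>) ^ ?n)"
      by (rule divide_right_mono_ennreal[OF wQ'])
    also have "ennreal ((l + 2 * \<theta>) ^ ?n) = emeasure lebesgue ?Q'"
      using al \<theta> by (intro emeasure_cube_cbox[symmetric]) simp
    also have "(mass_on ?Q' f) / emeasure lebesgue ?Q' \<le> HL_maximal f z"
      unfolding HL_maximal_def using cube \<open>z \<in> ?Q'\<close> by (intro SUP_upper) simp
    finally show "z \<in> {x. t < HL_maximal f x}" by simp
  qed
qed

lemma HL_maximal_measurable:
  assumes "integrable lebesgue f"
  shows "HL_maximal f \<in> borel_measurable lebesgue"
proof -
  have "HL_maximal f \<in> borel_measurable borel"
    using open_HL_maximal[OF assms] by (intro borel_measurableI_greater) (simp add: borel_open)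
  then show ?thesis by (rule borel_measurable_imp_lebesgue)
qed

text \<open>The complement of \<open>ess_supp f\<close> is a union of possibly uncountably many open
  sets; by Lindelof countably many of them suffice, and their exceptional null sets can be
  joined.\<close>

lemma AE_outside_ess_supp: "AE x in lebesgue. x \<notin> ess_supp f \<longrightarrow> f x = 0"
proof -
  let ?F = "{U. open U \<and> (AE x in lebesgue. x \<in> U \<longrightarrow> f x = 0)}"
  obtain F' where F': "F' \<subseteq> ?F" "countable F'" "\<Union>F' = \<Union>?F"
    using Lindelof[of ?F] by blast
  have "AE x in lebesgue. \<forall>U\<in>F'. x \<in> U \<longrightarrow> f x = 0"
    using F' by (intro AE_ball_countable[THEN iffD2]) auto
  then show ?thesis
    by (rule AE_mp) (intro AE_I2 impI, use F'(3) in \<open>auto simp: ess_supp_def\<close>)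
qed

lemma Linfty_c_integrable:
  fixes f :: "'a::euclidean_space \<Rightarrow> complex"
  assumes "f \<in> Linfty_c"
  shows "integrable lebesgue f"
proof -
  have f: "f \<in> borel_measurable lebesgue" "compact (ess_supp f)" using assms by (auto simp: Linfty_c_def)
  obtain B where B: "AE x in lebesgue. norm (f x) \<le> B" using assms by (auto simp: Linfty_c_def)
  obtain R where R: "ess_supp f \<subseteq> cball 0 R" "R > 0"
    using compact_imp_bounded[OF f(2)] unfolding bounded_pos by (auto simp: subset_iff)
  have "mass f \<le> (\<integral>\<^sup>+y. ennreal \<bar>B\<bar> * indicator (cball (0::'a) R) y \<partial>lebesgue)"
  proof (intro nn_integral_mono_AE)
    show "AE y in lebesgue. ennreal (norm (f y)) \<le> ennreal \<bar>B\<bar> * indicator (cball 0 R) y"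
      using B AE_outside_ess_supp[of f]
    proof eventually_elim
      case (elim y)
      show ?case
      proof (cases "f y = 0")
        case False
        then have "y \<in> cball 0 R" using elim(2) R(1) by blast
        moreover have "norm (f y) \<le> \<bar>B\<bar>" using elim(1) by linarith
        ultimately show ?thesis by (simp add: ennreal_leI)
      qed simp
    qed
  qed
  also have "\<dots> \<le> ennreal (\<bar>B\<bar> * (unit_ball_vol DIM('a) * R ^ DIM('a)))"
    using R(2) by (intro nn_integral_bounded_on) auto
  also have "\<dots> < \<infinity>" by simp
  finally show ?thesis using f(1) by (intro integrableI_bounded)
qed

context cz_operator begin

proposition exponential_decay:
  assumes Q: "is_cube Q" and f: "f \<in> Linfty_c" and supp: "ess_supp f \<subseteq> Q" and t: "t > 0"
  shows "{x \<in> Q. T_max f x > ennreal t * HL_maximal f x} \<in> lmeasurable \<and>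
    measure lebesgue {x \<in> Q. T_max f x > ennreal t * HL_maximal f x}
      \<le> 2 * exp (- (ln 2 / C_step) * t) * measure lebesgue Q"
proof -
  let ?n = "DIM('a)" and ?\<mu> = "emeasure (lebesgue :: 'a measure)"
  let ?W = "{x \<in> Q. T_max f x > ennreal t * HL_maximal f x}"
  obtain a l where al: "l > 0" "Q = cbox a (a + l *\<^sub>R One)" using Q by (auto simp: is_cube_def)
  have \<mu>Q: "?\<mu> Q = ennreal (l ^ ?n)" unfolding al(2) using al(1) by (intro emeasure_cube_cbox) simp
  have Q_sets: "Q \<in> sets lebesgue" unfolding al(2) by (rule sets_lebesgue_borel) simp
  have f_int: "integrable lebesgue f" by (rule Linfty_c_integrable[OF f])
  have QT: "Q \<subseteq> triple a l"
  proof
    fix z assume z: "z \<in> Q"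
    show "z \<in> triple a l"
      unfolding mem_triple
    proof
      fix i :: 'a assume i: "i \<in> Basis"
      have "a \<bullet> i \<le> z \<bullet> i \<and> z \<bullet> i \<le> a \<bullet> i + l"
        using z i unfolding al(2) by (simp add: mem_box inner_simps)
      then show "a \<bullet> i - l \<le> z \<bullet> i \<and> z \<bullet> i < a \<bullet> i + 2 * l" using al(1) by linarith
    qed
  qed
  have "AE y in lebesgue. f y = restrict_to (triple a l) f y"
    using AE_outside_ess_supp[of f]
    by (rule AE_mp) (intro AE_I2 impI, use supp QT in \<open>auto simp: restrict_to_def\<close>)
  then have T_eq: "T_max f x = T_max (restrict_to (triple a l) f) x" for x
    by (intro maximal_singular_integral_cong_AE borel_measurable_integrable integrable_restrict_to triple_lebesgue f_int)
  \<comment> \<open>The number of rounds that fit under the level \<open>t\<close>. Rounding down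
    loses less than one round, whence the factor 2 in front of the exponential; its rate
    \<open>ln 2 / C_step\<close> is one halving per \<open>C_step\<close>.\<close>
  define m where "m = nat \<lfloor>t / C_step\<rfloor>"
  have m: "real m * C_step \<le> t" "t / C_step - 1 \<le> real m"
  proof -
    have "real m = of_int \<lfloor>t / C_step\<rfloor>" using t C_step_pos by (simp add: m_def)
    then have "real m \<le> t / C_step" "t / C_step - 1 \<le> real m" by linarith+
    then show "real m * C_step \<le> t" "t / C_step - 1 \<le> real m" using C_step_pos by (simp_all add: field_simps)
  qed
  obtain E where E: "E \<in> sets lebesgue" "?\<mu> E \<le> ennreal ((1 / 2) ^ m * l ^ ?n)"
    and E_le: "\<And>x. x \<in> hcube a l - E \<Longrightarrow> T_max (restrict_to (triple a l) f) x
      \<le> ennreal (real m * C_step) * HL_maximal f x"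
    using local_exponential_decay[OF f_int less_imp_le[OF al(1)], of m a] by blast
  have hQ: "hcube a l \<subseteq> Q" unfolding al(2) by (rule hcube_subset_cbox)
  \<comment> \<open>The cubes of the statement are closed, those of the iteration half-open; they
    differ by a null set.\<close>
  have null: "?\<mu> (Q - hcube a l) = 0"
    using emeasure_Diff[OF _ Q_sets hcube_lebesgue hQ] emeasure_hcube[of l a] \<mu>Q al(1) by simp
  have W_sub: "?W \<subseteq> E \<union> (Q - hcube a l)"
  proof (rule subsetI, rule ccontr)
    fix x assume x: "x \<in> ?W" and "x \<notin> E \<union> (Q - hcube a l)"
    then have "x \<in> hcube a l - E" by auto
    then have "T_max f x \<le> ennreal (real m * C_step) * HL_maximal f x"
      unfolding T_eq by (rule E_le)
    also have "\<dots> \<le> ennreal t * HL_maximal f x"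
      by (intro mult_right_mono ennreal_leI m(1)) simp
    finally show False using x by (simp add: not_less[symmetric])
  qed
  have W_sets: "?W \<in> sets lebesgue"
  proof -
    have "{x \<in> space lebesgue. ennreal t * HL_maximal f x < T_max f x} \<in> sets lebesgue"
      by (intro borel_measurable_less borel_measurable_times_ennreal borel_measurable_const
          HL_maximal_measurable maximal_singular_integral_measurable f_int)
    then have "Q \<inter> {x \<in> space lebesgue. ennreal t * HL_maximal f x < T_max f x} \<in> sets lebesgue"
      by (rule sets.Int[OF Q_sets])
    also have "Q \<inter> {x \<in> space lebesgue. ennreal t * HL_maximal f x < T_max f x} = ?W"
      by auto
    finally show ?thesis .
  qed
  have "?\<mu> ?W \<le> ?\<mu> (E \<union> (Q - hcube a l))"
    by (intro emeasure_mono W_sub sets.Un sets.Diff E(1) Q_sets hcube_lebesgue)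
  also have "\<dots> \<le> ?\<mu> E + ?\<mu> (Q - hcube a l)"
    by (intro emeasure_subadditive sets.Diff E(1) Q_sets hcube_lebesgue)
  also have "\<dots> \<le> ennreal ((1 / 2) ^ m * l ^ ?n)" unfolding null using E(2) by simp
  finally have W_le: "?\<mu> ?W \<le> ennreal ((1 / 2) ^ m * l ^ ?n)" .
  have "(1 / 2 :: real) ^ m = exp (- (real m * ln 2))"
    by (simp add: exp_minus exp_of_nat_mult power_one_over inverse_eq_divide)
  also have "\<dots> \<le> exp (- ((t / C_step - 1) * ln 2))"
    using m(2) by (simp add: mult_right_mono)
  also have "\<dots> = 2 * exp (- (ln 2 / C_step) * t)"
    by (simp add: left_diff_distrib exp_diff exp_minus exp_add divide_inverse algebra_simps)
  finally have half: "(1 / 2 :: real) ^ m \<le> 2 * exp (- (ln 2 / C_step) * t)" .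
  \<comment> \<open>Finite measure ensures that \<open>measure\<close> is the true measure of the
    set and not its default value 0.\<close>
  have W_lmeasurable: "?W \<in> lmeasurable"
    by (rule fmeasurableI[OF W_sets order_le_less_trans[OF W_le]]) simp
  have W_measure: "measure lebesgue ?W \<le> (1 / 2) ^ m * l ^ ?n"
    unfolding measure_def by (intro enn2real_leI W_le) (use al(1) in simp)
  have Q_measure: "measure lebesgue Q = l ^ ?n"
    unfolding measure_def \<mu>Q using al(1) by simp
  have le: "(1 / 2) ^ m * l ^ ?n \<le> 2 * exp (- (ln 2 / C_step) * t) * l ^ ?n"
    using al(1) by (intro mult_right_mono half) simp
  show ?thesis
    unfolding Q_measure by (rule conjI[OF W_lmeasurable order_trans[OF W_measure le]])
qed

end

theorem theorem2p2:
  fixes T :: "('a::euclidean_space \<Rightarrow> complex) \<Rightarrow> 'a \<Rightarrow> complex"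
    and K :: "'a \<Rightarrow> 'a \<Rightarrow> complex"
  assumes "CZ_operator T K"
  shows "\<exists>\<alpha>>0. \<exists>c>0. \<forall>Q f t. is_cube Q \<and> f \<in> Linfty_c \<and> ess_supp f \<subseteq> Q \<and> t > 0 \<longrightarrow>
    {x \<in> Q. maximal_singular_integral K f x > ennreal t * HL_maximal f x} \<in> lmeasurable \<and>
    measure lebesgue {x \<in> Q. maximal_singular_integral K f x > ennreal t * HL_maximal f x}
      \<le> c * exp (- \<alpha> * t) * measure lebesgue Q"
proof -
  obtain c \<delta> S CS where "cz_operator K c \<delta> S CS"
    using CZ_operator_imp_cz_operator[OF assms] by blast
  then interpret cz_operator K c \<delta> S CS .
  show ?thesis
  proof (intro exI conjI)
    show "ln 2 / C_step > 0" using C_step_pos by simp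
    show "(2::real) > 0" by simp
    show "\<forall>Q f t. is_cube Q \<and> f \<in> Linfty_c \<and> ess_supp f \<subseteq> Q \<and> t > 0 \<longrightarrow>
      {x \<in> Q. maximal_singular_integral K f x > ennreal t * HL_maximal f x} \<in> lmeasurable \<and>
      measure lebesgue {x \<in> Q. maximal_singular_integral K f x > ennreal t * HL_maximal f x}
        \<le> 2 * exp (- (ln 2 / C_step) * t) * measure lebesgue Q"
      using exponential_decay by blast
  qed
qed

end
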